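(* Let $\mathcal D$ be a smooth codimension-1 distribution on $\mathbb{R}^N$ (with frame, $\Theta_0$, $Q$ as in the context) and let $-Q<n<0$. Then $T\in\Psi^n_{\mathcal D}(\mathbb{R}^N)$ if and only if there exists a tempered distribution $k_0(x,u)$ on $\mathbb{R}^N\times\mathbb{R}^N$, smooth on $\mathbb{R}^N\times(\mathbb{R}^N\setminus\{0\})$, satisfying $$|\partial_x^I\partial_u^\gamma k_0(x,u)|\le C_{I,\gamma,M}\|u\|^{-Q-n-\|\gamma\|-M}$$ for all multi-indices $\gamma,I$ and all $M\ge0$, such that $Tf(x)=\int_{\mathbb{R}^N}k_0(x,\Theta_0(x,y))f(y)\,dy$ for all $x\in\mathbb{R}^N$.
   Context: $\mathcal D$ is a smooth codimension-1 distribution of tangent subspaces on $\mathbb{R}^N$, $N\ge2$, with vector fields $X_i=\sum_{j=1}^NA_i^j(x)\partial_{x^j}$ ($1\le i\le N$), $X_1,\dots,X_{N-1}$ spanning $\mathcal D$, all $A_i^j$ smooth with uniformly bounded $C^k$ norms for every $k$, and $|\det(A_i^j(x))|\ge c>0$. $M_x\xi=\sum_i(\sum_jA_i^j(x)\xi_j)dx^i$. For $\xi=(\xi',\xi_N)$ set $\|\xi\|=|\xi'|+|\xi_N|^{1/2}$, and for multi-indices $\alpha=(\alpha',\alpha_N)$ set $\|\alpha\|=|\alpha'|+2\alpha_N$. $\Psi^n_{\mathcal D}(\mathbb{R}^N)$ is the class of operators $Tf(x)=\int a_0(x,M_x\xi)\hat f(\xi)e^{2\pi ix\cdot\xi}d\xi$,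 $\hat f(\xi)=\int f(x)e^{-2\pi ix\cdot\xi}dx$, with $|\partial_x^I\partial_\xi^\alpha a_0(x,\xi)|\le C_{I,\alpha}(1+\|\xi\|)^{n-\|\alpha\|}$. Let $(B_j^k)$ be the inverse matrix of $(A_i^j)$, $L_x\colon\mathbb{R}^N\to\mathbb{R}^N$ the linear map with $(L_xu)^k=\sum_jB_j^k(x)u^j$, $\Theta_0(x,y)=L_x(x-y)$, and $Q=N+1$.
   Formalization: The kernel k_0 is taken to be a function (with the estimates, locally integrable in u, hence a tempered distribution) and the integral is a Lebesgue integral; for general tempered distributions the "if" part fails, e.g. k_0 = δ_0(u) with the standard frame gives T = identity. *)

theory Defs
  imports "HOL-Analysis.Analysis"
begin

definition dirderiv :: "'a::real_normed_vector \<Rightarrow> ('a \<Rightarrow> 'b::real_normed_vector) \<Rightarrow> 'a \<Rightarrow> 'b" where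
  "dirderiv v f p = vector_derivative (\<lambda>t::real. f (p + t *\<^sub>R v)) (at 0)"

fun iterdir :: "'a::real_normed_vector list \<Rightarrow> ('a \<Rightarrow> 'b::real_normed_vector) \<Rightarrow> 'a \<Rightarrow> 'b" where
  "iterdir [] f = f"
| "iterdir (v # vs) f = dirderiv v (iterdir vs f)"

definition smooth_on :: "'a::real_normed_vector set \<Rightarrow> ('a \<Rightarrow> 'b::real_normed_vector) \<Rightarrow> bool" where
  "smooth_on S f \<longleftrightarrow>
     (\<forall>vs. continuous_on S (iterdir vs f) \<and>
        (\<forall>v. \<forall>p\<in>S. (\<lambda>t::real. iterdir vs f (p + t *\<^sub>R v)) differentiable (at 0)))"

definition lastc :: "'n::{finite,linorder}" where
  "lastc = Max UNIV"

definition mderiv :: "('n::{finite,linorder} \<Rightarrow> nat) \<Rightarrow> ((real, 'n) vec \<Rightarrow> 'b::real_normed_vector) \<Rightarrow> (real, 'n) vec \<Rightarrow> 'b" where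
  "mderiv \<alpha> f = iterdir (concat (map (\<lambda>i. replicate (\<alpha> i) (axis i 1)) (sorted_list_of_set UNIV))) f"

definition hnorm :: "(real, 'n::{finite,linorder}) vec \<Rightarrow> real" where
  "hnorm \<xi> = sqrt (\<Sum>i\<in>UNIV - {lastc}. (\<xi> $ i)\<^sup>2) + sqrt \<bar>\<xi> $ lastc\<bar>"

definition hord :: "('n::{finite,linorder} \<Rightarrow> nat) \<Rightarrow> nat" where
  "hord \<alpha> = (\<Sum>i\<in>UNIV - {lastc}. \<alpha> i) + 2 * \<alpha> lastc"

definition Qdim :: "'n::finite itself \<Rightarrow> nat" where
  "Qdim _ = CARD('n) + 1"

definition schwartz :: "((real, 'n::{finite,linorder}) vec \<Rightarrow> complex) \<Rightarrow> bool" where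
  "schwartz f \<longleftrightarrow> smooth_on UNIV f \<and>
     (\<forall>\<alpha> \<beta> :: 'n \<Rightarrow> nat. \<exists>C. \<forall>x.
        (\<Prod>i\<in>UNIV. \<bar>x $ i\<bar> ^ \<alpha> i) * norm (mderiv \<beta> f x) \<le> C)"

definition fourier :: "((real, 'n::finite) vec \<Rightarrow> complex) \<Rightarrow> (real, 'n) vec \<Rightarrow> complex" where
  "fourier f \<xi> = (LINT x|lborel. f x * cis (- 2 * pi * (x \<bullet> \<xi>)))"

text \<open>A x $ i $ j = A_i^j(x);  X_i = sum_j A_i^j d/dx^j;  X_1..X_(N-1) span D.\<close>
definition admissible_frame :: "((real, 'n::{finite,linorder}) vec \<Rightarrow> ((real, 'n) vec, 'n) vec) \<Rightarrow> bool" where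
  "admissible_frame A \<longleftrightarrow>
     (\<forall>i j. smooth_on UNIV (\<lambda>x. A x $ i $ j) \<and>
            (\<forall>\<beta>. \<exists>C. \<forall>x. \<bar>mderiv \<beta> (\<lambda>x. A x $ i $ j) x\<bar> \<le> C)) \<and>
     (\<exists>c>0. \<forall>x. \<bar>det (A x)\<bar> \<ge> c)"

definition Mmap :: "((real, 'n::finite) vec \<Rightarrow> ((real, 'n) vec, 'n) vec) \<Rightarrow> (real, 'n) vec \<Rightarrow> (real, 'n) vec \<Rightarrow> (real, 'n) vec" where
  "Mmap A x \<xi> = (\<chi> i. \<Sum>j\<in>UNIV. A x $ i $ j * \<xi> $ j)"

definition Lmap :: "((real, 'n::finite) vec \<Rightarrow> ((real, 'n) vec, 'n) vec) \<Rightarrow> (real, 'n) vec \<Rightarrow> (real, 'n) vec \<Rightarrow> (real, 'n) vec" where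
  "Lmap A x u = (\<chi> k. \<Sum>j\<in>UNIV. matrix_inv (A x) $ j $ k * u $ j)"

definition Theta0 :: "((real, 'n::finite) vec \<Rightarrow> ((real, 'n) vec, 'n) vec) \<Rightarrow> (real, 'n) vec \<Rightarrow> (real, 'n) vec \<Rightarrow> (real, 'n) vec" where
  "Theta0 A x y = Lmap A x (x - y)"

definition symbol_class :: "real \<Rightarrow> ((real, 'n::{finite,linorder}) vec \<Rightarrow> (real, 'n) vec \<Rightarrow> complex) \<Rightarrow> bool" where
  "symbol_class n a \<longleftrightarrow> smooth_on UNIV (\<lambda>(x, \<xi>). a x \<xi>) \<and>
     (\<forall>I \<alpha> :: 'n \<Rightarrow> nat. \<exists>C. \<forall>x \<xi>.
        norm (mderiv I (\<lambda>x'. mderiv \<alpha> (a x') \<xi>) x) \<le> C * (1 + hnorm \<xi>) powr (n - real (hord \<alpha>)))"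

definition PsiD :: "((real, 'n::{finite,linorder}) vec \<Rightarrow> ((real, 'n) vec, 'n) vec) \<Rightarrow> real \<Rightarrow>
     (((real, 'n) vec \<Rightarrow> complex) \<Rightarrow> ((real, 'n) vec \<Rightarrow> complex)) set" where
  "PsiD A n = {T. \<exists>a0. symbol_class n a0 \<and>
      (\<forall>f. schwartz f \<longrightarrow> (\<forall>x. T f x =
         (LINT \<xi>|lborel. a0 x (Mmap A x \<xi>) * fourier f \<xi> * cis (2 * pi * (x \<bullet> \<xi>)))))}"

end

theory Submission
  imports Defs "HOL-Probability.Probability"
begin

text \<open>
  The kernel attached to a symbol \<open>a\<^sub>0\<close> is \<open>k\<^sub>0(x,u) = |det A(x)|^(-1) \<integral> a\<^sub>0(x,\<eta>) e(u\<sqdot>\<eta>) d\<eta>\<close>, because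
  \<open>(x-y)\<sqdot>\<xi> = \<Theta>\<^sub>0(x,y)\<sqdot>M\<^sub>x\<xi>\<close>; conversely \<open>a\<^sub>0(x,\<eta>) = |det A(x)| \<integral> k\<^sub>0(x,u) e(-u\<sqdot>\<eta>) du\<close>. Neither integral is
  estimated directly. The function to be transformed is cut by a smooth partition of unity into pieces
  supported on the annuli \<open>\<Parallel>\<eta>\<Parallel> ~ 2^j\<close> (and, for a symbol, one piece near the origin). After the anisotropic dilation by \<open>2^j\<close> all pieces lie in one bounded
  family of smooth functions supported in one compact set, so their Fourier transforms
  decay faster than any power, uniformly in \<open>j\<close>. Undoing the dilation, a derivative of weighted order \<open>w\<close> of
  the \<open>j\<close>-th transform is at most \<open>C R^(s+w) min(1, (R\<Parallel>u\<Parallel>)^(-K))\<close> with \<open>R = 2^j\<close>, for every \<open>K\<close>, and summing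
  over \<open>j\<close> gives \<open>C \<Parallel>u\<Parallel>^(-s-w)\<close>. In the direction from symbols to kernels \<open>s = Q + n\<close>, in the other one
  \<open>s = -n\<close>; the hypothesis \<open>-Q < n < 0\<close> is exactly \<open>s > 0\<close> in both cases. The operator identity holds
  for each piece by Fubini's theorem (together with Fourier inversion for Schwartz
  functions when starting from the kernel), and both sides are summed over \<open>j\<close> by dominated convergence.
\<close>

section \<open>Uniformly bounded families of smooth functions\<close>

text \<open>Smoothness is given through derivatives along lines, and bounds are given only for
  multi-indices, which fix one order of the coordinates. Facts that are automatic for Frechet
  derivatives must therefore be proved: symmetry, linearity in the direction, and stability of
  uniform bounds under products, reciprocals and substitutions. The last is handled by
  \<open>bounded_Ck\<close>, in which derivative families are supplied rather than computed. The two
  directions need different scales. A symbol is harmless near 0, its bounds being in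
  \<open>1 + hnorm \<xi>\<close>, so the scales 2^j with j >= 0 suffice; a kernel is singular at u =
  0 and needs all integer scales. A derivative of weighted order w of the resulting symbol
  multiplies the piece at scale R by R^w, and for large R this growth is paid for by the kernel
  bounds with M > 0. Since n < 0, the kernel bound with M = 0 is locally integrable; hence the
  kernel acts as a function, and its value at u = 0 concerns only the null set y = x.\<close>

definition has_dirderiv :: "('a::real_normed_vector \<Rightarrow> 'b::real_normed_vector) \<Rightarrow> 'a \<Rightarrow> 'b \<Rightarrow> 'a \<Rightarrow> bool" where
  "has_dirderiv f v D p \<longleftrightarrow> ((\<lambda>t::real. f (p + t *\<^sub>R v)) has_vector_derivative D) (at 0)"

text \<open>\<open>dirderiv\<close> is a choice that has some value even where no derivative exists.
  Facts are therefore proved for the relation \<open>has_dirderiv\<close>, which asserts existence,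
  and transferred by this rule.\<close>

lemma dirderiv_eqI: "has_dirderiv f v D p \<Longrightarrow> dirderiv v f p = D"
  unfolding has_dirderiv_def dirderiv_def by (rule vector_derivative_at)

lemma eventually_line_in_open:
  fixes p v :: "'a::real_normed_vector"
  assumes "open S" "p \<in> S"
  shows "\<forall>\<^sub>F t::real in nhds 0. p + t *\<^sub>R v \<in> S"
proof -
  have "((\<lambda>t::real. p + t *\<^sub>R v) \<longlongrightarrow> p + 0 *\<^sub>R v) (nhds 0)"
    by (intro tendsto_add tendsto_scaleR tendsto_const) (simp add: filterlim_ident)
  from topological_tendstoD[OF this assms(1)] show ?thesis
    using assms(2) by simp
qed

lemma has_dirderiv_cong:
  assumes "open S" "p \<in> S" "\<And>q. q \<in> S \<Longrightarrow> f q = g q" "has_dirderiv f v D p"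
  shows "has_dirderiv g v D p"
proof -
  have ev: "\<forall>\<^sub>F t in nhds 0. f (p + t *\<^sub>R v) = g (p + t *\<^sub>R v)"
    using eventually_line_in_open[OF assms(1,2), of v] by eventually_elim (simp add: assms(3))
  then show ?thesis
    using assms(4) unfolding has_dirderiv_def
    by (subst (asm) has_vector_derivative_cong_ev) (auto simp: assms elim: eventually_mono)
qed

lemma dirderiv_cong:
  assumes "open S" "p \<in> S" "\<And>q. q \<in> S \<Longrightarrow> f q = g q"
  shows "dirderiv v f p = dirderiv v g p"
proof -
  have ev: "\<forall>\<^sub>F t in nhds 0. f (p + t *\<^sub>R v) = g (p + t *\<^sub>R v)"
    using eventually_line_in_open[OF assms(1,2), of v] by eventually_elim (simp add: assms(3))
  then show ?thesis
    unfolding dirderiv_def by (intro vector_derivative_cong_eq) auto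
qed

text \<open>Shifting the parameter moves the base point along its own line, so a derivative defined
  only at parameter 0 gives ordinary calculus along the whole line.\<close>

lemma has_dirderiv_line:
  assumes "has_dirderiv f v D (p + s *\<^sub>R v)"
  shows "((\<lambda>t. f (p + t *\<^sub>R v)) has_vector_derivative D) (at s)"
proof -
  have "((\<lambda>t. f ((p + s *\<^sub>R v) + t *\<^sub>R v)) \<circ> (\<lambda>t. t - s) has_vector_derivative (1 *\<^sub>R D)) (at s)"
    by (intro vector_diff_chain_at) (use assms in \<open>auto simp: has_dirderiv_def intro!: derivative_eq_intros\<close>)
  then show ?thesis
    by (simp add: o_def algebra_simps)
qed

lemma has_dirderiv_linear_comp:
  assumes "linear L"
  shows "has_dirderiv (\<lambda>p. f (L p)) v D p \<longleftrightarrow> has_dirderiv f (L v) D (L p)"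
  by (simp add: has_dirderiv_def linear_add[OF assms] linear_scale[OF assms])

lemma dirderiv_linear_comp:
  assumes "linear L"
  shows "dirderiv v (\<lambda>p. f (L p)) p = dirderiv (L v) f (L p)"
  by (simp add: dirderiv_def linear_add[OF assms] linear_scale[OF assms])

text \<open>A linear map sends lines to lines with the same parameter, so this chain rule is an
  identity of definitions and asks nothing of \<open>f\<close>.\<close>

lemma iterdir_linear_comp:
  assumes "linear L"
  shows "iterdir vs (\<lambda>p. f (L p)) = (\<lambda>p. iterdir (map L vs) f (L p))"
proof (induction vs)
  case (Cons v vs)
  show ?case by (rule ext) (simp add: Cons dirderiv_linear_comp[OF assms])
qed simp

lemma iterdir_append: "iterdir (vs @ ws) f = iterdir vs (iterdir ws f)"
  by (induction vs) simp_all

lemma smooth_on_continuous: "smooth_on S f \<Longrightarrow> continuous_on S (iterdir vs f)"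
  by (simp add: smooth_on_def)

lemma smooth_on_has_dirderiv:
  assumes "smooth_on S f" "p \<in> S"
  shows "has_dirderiv (iterdir vs f) v (iterdir (v # vs) f p) p"
  using assms unfolding smooth_on_def has_dirderiv_def
  by (simp add: dirderiv_def vector_derivative_works)

lemma smooth_onI:
  assumes "\<And>vs. continuous_on S (iterdir vs f)"
    and "\<And>vs v p. p \<in> S \<Longrightarrow> \<exists>D. has_dirderiv (iterdir vs f) v D p"
  shows "smooth_on S f"
  using assms unfolding smooth_on_def has_dirderiv_def
  by (metis differentiableI_vector)

lemma smooth_on_iterdir: "smooth_on S f \<Longrightarrow> smooth_on S (iterdir ws f)"
  using smooth_on_def[of S f] by (auto simp: smooth_on_def iterdir_append[symmetric])

lemma smooth_on_subset: "smooth_on S f \<Longrightarrow> T \<subseteq> S \<Longrightarrow> smooth_on T f"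
  unfolding smooth_on_def by (meson continuous_on_subset subsetD)

text \<open>The bounds are uniform in the index \<open>j\<close> and on \<open>S\<close>. For each
  direction some family \<open>G\<close> of one order less has to serve as derivative; because it is
  merely exhibited, closure properties follow by induction on \<open>k\<close> without any formula
  for iterated derivatives.\<close>

primrec bounded_Ck :: "nat \<Rightarrow> 'a::real_normed_vector set \<Rightarrow> ('i \<Rightarrow> 'a \<Rightarrow> 'b::real_normed_vector) \<Rightarrow> bool" where
  "bounded_Ck 0 S F \<longleftrightarrow> (\<forall>j. continuous_on S (F j)) \<and> (\<exists>C. \<forall>j. \<forall>p\<in>S. norm (F j p) \<le> C)"
| "bounded_Ck (Suc k) S F \<longleftrightarrow> (\<forall>j. continuous_on S (F j)) \<and> (\<exists>C. \<forall>j. \<forall>p\<in>S. norm (F j p) \<le> C) \<and>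
     (\<forall>v. \<exists>G. bounded_Ck k S G \<and> (\<forall>j. \<forall>p\<in>S. has_dirderiv (F j) v (G j p) p))"

definition bdd_smooth :: "'a::real_normed_vector set \<Rightarrow> ('i \<Rightarrow> 'a \<Rightarrow> 'b::real_normed_vector) \<Rightarrow> bool" where
  "bdd_smooth S F \<longleftrightarrow> (\<forall>j. smooth_on S (F j)) \<and> (\<forall>vs. \<exists>C. \<forall>j. \<forall>p\<in>S. norm (iterdir vs (F j) p) \<le> C)"

lemma bounded_Ck_bound: "bounded_Ck k S F \<Longrightarrow> \<exists>C. \<forall>j. \<forall>p\<in>S. norm (F j p) \<le> C"
  by (cases k) simp_all

lemma bounded_Ck_continuous: "bounded_Ck k S F \<Longrightarrow> continuous_on S (F j)"
  by (cases k) simp_all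

lemma bounded_Ck_derivative:
  assumes "bounded_Ck (Suc k) S F"
  obtains G where "bounded_Ck k S G" "\<forall>j. \<forall>p\<in>S. has_dirderiv (F j) v (G j p) p"
  using assms unfolding bounded_Ck.simps by blast

lemma bounded_Ck_0: "bounded_Ck k S F \<Longrightarrow> bounded_Ck 0 S F"
  by (cases k) auto

lemma bounded_Ck_SucI:
  "bounded_Ck 0 S F \<Longrightarrow> (\<And>v. \<exists>G. bounded_Ck k S G \<and> (\<forall>j. \<forall>p\<in>S. has_dirderiv (F j) v (G j p) p)) \<Longrightarrow> bounded_Ck (Suc k) S F"
  by simp

lemma bounded_Ck_SucD: "bounded_Ck (Suc k) S F \<Longrightarrow> bounded_Ck k S F"
proof (induction k arbitrary: F)
  case 0
  then show ?case using bounded_Ck_0 by blast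
next
  case (Suc k)
  show ?case
  proof (rule bounded_Ck_SucI)
    show "bounded_Ck 0 S F" by (rule bounded_Ck_0[OF Suc.prems])
    show "\<exists>G. bounded_Ck k S G \<and> (\<forall>j. \<forall>p\<in>S. has_dirderiv (F j) v (G j p) p)" for v
      by (rule bounded_Ck_derivative[OF Suc.prems, of v]) (use Suc.IH in blast)
  qed
qed

lemma bounded_Ck_cong:
  assumes "open S"
  shows "bounded_Ck k S F \<Longrightarrow> (\<And>j p. p \<in> S \<Longrightarrow> F j p = G j p) \<Longrightarrow> bounded_Ck k S G"
proof (induction k)
  case 0
  obtain C where "\<forall>j. \<forall>p\<in>S. norm (F j p) \<le> C" using bounded_Ck_bound[OF 0(1)] by blast
  moreover have "continuous_on S (G j)" for j
    using bounded_Ck_continuous[OF 0(1), of j] 0(2) by (simp cong: continuous_on_cong)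
  ultimately show ?case using 0(2) by (metis bounded_Ck.simps(1))
next
  case (Suc k)
  have "has_dirderiv (G j) v D p" if "p \<in> S" "has_dirderiv (F j) v D p" for j v D p
    using has_dirderiv_cong[OF assms that(1), of "F j" "G j"] that Suc.prems(2) by auto
  moreover have "continuous_on S (G j)" for j
    using Suc.prems by (simp cong: continuous_on_cong)
  ultimately show ?case using Suc.prems by (simp, metis)
qed

lemma bdd_smooth_imp_bounded_Ck: "bdd_smooth S F \<Longrightarrow> bounded_Ck k S F"
proof (induction k arbitrary: F)
  case 0
  show ?case
  proof (simp, intro conjI allI)
    fix j show "continuous_on S (F j)"
      using 0 smooth_on_continuous[of S "F j" "[]"] by (simp add: bdd_smooth_def)
    show "\<exists>C. \<forall>j. \<forall>p\<in>S. norm (F j p) \<le> C"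
      using 0 unfolding bdd_smooth_def by (metis iterdir.simps(1))
  qed
next
  case (Suc k)
  have "bdd_smooth S (\<lambda>j. dirderiv v (F j))" for v
    using Suc.prems smooth_on_iterdir[of S _ "[v]"] unfolding bdd_smooth_def
    by (auto simp: iterdir_append[of _ "[_]", simplified, symmetric])
  moreover have "has_dirderiv (F j) v (dirderiv v (F j) p) p" if "p \<in> S" for j v p
    using smooth_on_has_dirderiv[of S "F j" p "[]"] Suc.prems that by (simp add: bdd_smooth_def)
  moreover have "bounded_Ck 0 S F"
  proof (simp, intro conjI allI)
    fix j show "continuous_on S (F j)"
      using Suc.prems smooth_on_continuous[of S "F j" "[]"] by (simp add: bdd_smooth_def)
    show "\<exists>C. \<forall>j. \<forall>p\<in>S. norm (F j p) \<le> C"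
      using Suc.prems unfolding bdd_smooth_def by (metis iterdir.simps(1))
  qed
  ultimately show ?case
    using Suc.IH by (intro bounded_Ck_SucI) metis+
qed

lemma bounded_Ck_dirderiv:
  assumes "open S" "bounded_Ck (Suc k) S F"
  shows "bounded_Ck k S (\<lambda>j. dirderiv v (F j))"
proof -
  obtain G where "bounded_Ck k S G" "\<forall>j. \<forall>p\<in>S. has_dirderiv (F j) v (G j p) p"
    using assms(2) unfolding bounded_Ck.simps by blast
  then show ?thesis
    by (elim bounded_Ck_cong[OF assms(1)]) (metis dirderiv_eqI)
qed

text \<open>On an open set an exhibited derivative family must coincide with
  \<open>dirderiv\<close>, so \<open>bounded_Ck\<close> at every order bounds every iterated
  derivative. Closure properties are proved for \<open>bounded_Ck\<close> and read back through this
  equivalence.\<close>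

lemma bdd_smooth_iff:
  assumes "open S"
  shows "bdd_smooth S F \<longleftrightarrow> (\<forall>k. bounded_Ck k S F)"
proof
  assume *: "\<forall>k. bounded_Ck k S F"
  have it: "bounded_Ck k S (\<lambda>j. iterdir vs (F j))" for k vs
  proof (induction vs arbitrary: k)
    case (Cons v vs)
    from bounded_Ck_dirderiv[OF assms Cons[of "Suc k"]] show ?case by simp
  qed (use * in simp)
  show "bdd_smooth S F" unfolding bdd_smooth_def
  proof (intro conjI allI smooth_onI)
    fix j vs show "continuous_on S (iterdir vs (F j))"
      using it[of 0 vs] by simp
    fix v p assume "p \<in> S"
    then show "\<exists>D. has_dirderiv (iterdir vs (F j)) v D p"
      using it[of 1 vs] by (simp add: One_nat_def) metis
  next
    fix vs show "\<exists>C. \<forall>j. \<forall>p\<in>S. norm (iterdir vs (F j) p) \<le> C"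
      using it[of 0 vs] by simp
  qed
qed (simp add: bdd_smooth_imp_bounded_Ck)

lemma bdd_smooth_dirderiv: "open S \<Longrightarrow> bdd_smooth S F \<Longrightarrow> bdd_smooth S (\<lambda>j. dirderiv v (F j))"
  by (simp add: bdd_smooth_iff bounded_Ck_dirderiv del: bounded_Ck.simps)

lemma bdd_smooth_reindex: "bdd_smooth S F \<Longrightarrow> bdd_smooth S (\<lambda>j. F (h j))"
  unfolding bdd_smooth_def by meson

lemma bounded_Ck_const: "bounded_Ck k S (\<lambda>j p. c)"
proof (induction k arbitrary: c)
  case (Suc k)
  show ?case
    by (intro bounded_Ck_SucI) (auto intro!: exI[of _ "\<lambda>j p. 0"] Suc simp: has_dirderiv_def)
qed auto

lemma bdd_smooth_const: "open S \<Longrightarrow> bdd_smooth S (\<lambda>j p. c)"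
  by (simp add: bdd_smooth_iff bounded_Ck_const del: bounded_Ck.simps)

section \<open>Closure under sums, products, substitution, reciprocals and extension by zero\<close>

lemma bounded_Ck_add:
  "bounded_Ck k S F \<Longrightarrow> bounded_Ck k S G \<Longrightarrow> bounded_Ck k S (\<lambda>j p. F j p + G j p)"
proof (induction k arbitrary: F G)
  case 0
  obtain C D where "\<forall>j. \<forall>p\<in>S. norm (F j p) \<le> C" "\<forall>j. \<forall>p\<in>S. norm (G j p) \<le> D"
    using bounded_Ck_bound[OF 0(1)] bounded_Ck_bound[OF 0(2)] by blast
  then have "\<forall>j. \<forall>p\<in>S. norm (F j p + G j p) \<le> C + D"
    by (meson add_mono norm_triangle_ineq order_trans)
  with 0 show ?case by (auto intro!: continuous_intros)
next
  case (Suc k)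
  obtain C D where "\<forall>j. \<forall>p\<in>S. norm (F j p) \<le> C" "\<forall>j. \<forall>p\<in>S. norm (G j p) \<le> D"
    using bounded_Ck_bound[OF Suc.prems(1)] bounded_Ck_bound[OF Suc.prems(2)] by blast
  then have "\<forall>j. \<forall>p\<in>S. norm (F j p + G j p) \<le> C + D"
    by (meson add_mono norm_triangle_ineq order_trans)
  then have 0: "bounded_Ck 0 S (\<lambda>j p. F j p + G j p)"
    using Suc.prems by (auto intro!: continuous_intros)
  show ?case
  proof (rule bounded_Ck_SucI[OF 0])
    fix v
    obtain F' G' where "bounded_Ck k S F'" "\<forall>j. \<forall>p\<in>S. has_dirderiv (F j) v (F' j p) p"
       "bounded_Ck k S G'" "\<forall>j. \<forall>p\<in>S. has_dirderiv (G j) v (G' j p) p"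
      using bounded_Ck_derivative[OF Suc.prems(1), of v] bounded_Ck_derivative[OF Suc.prems(2), of v] by metis
    then show "\<exists>H. bounded_Ck k S H \<and> (\<forall>j. \<forall>p\<in>S. has_dirderiv (\<lambda>p. F j p + G j p) v (H j p) p)"
      by (intro exI[of _ "\<lambda>j p. F' j p + G' j p"])
         (auto simp: has_dirderiv_def intro!: Suc.IH has_vector_derivative_add)
  qed
qed

text \<open>The product rule leaves products of a factor with a derivative, and both belong to order
  \<open>k\<close>; induction thus replaces the Leibniz formula. Stating it for any bounded bilinear
  map covers multiplication and scaling at once.\<close>

lemma bounded_Ck_bilinear:
  fixes F :: "'i \<Rightarrow> 'a::real_normed_vector \<Rightarrow> 'b::real_normed_vector" and G :: "'i \<Rightarrow> 'a \<Rightarrow> 'c::real_normed_vector"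
    and pr :: "'b \<Rightarrow> 'c \<Rightarrow> 'd::real_normed_vector"
  assumes bl: "bounded_bilinear pr"
  shows "bounded_Ck k S F \<Longrightarrow> bounded_Ck k S G \<Longrightarrow> bounded_Ck k S (\<lambda>j p. pr (F j p) (G j p))"
proof (induction k arbitrary: F G)
  have *: "bounded_Ck 0 S (\<lambda>j p. pr (F j p) (G j p))" if H: "bounded_Ck 0 S F" "bounded_Ck 0 S G" 
    for F :: "'i \<Rightarrow> 'a \<Rightarrow> 'b" and G :: "'i \<Rightarrow> 'a \<Rightarrow> 'c"
  proof -
    obtain C D where CD: "\<forall>j. \<forall>p\<in>S. norm (F j p) \<le> C" "\<forall>j. \<forall>p\<in>S. norm (G j p) \<le> D"
      using bounded_Ck_bound[OF H(1)] bounded_Ck_bound[OF H(2)] by blast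
    obtain K where K: "K \<ge> 0" "\<And>a b. norm (pr a b) \<le> norm a * norm b * K"
      using bounded_bilinear.nonneg_bounded[OF bl] by auto
    have "norm (pr (F j p) (G j p)) \<le> C * D * K" if "p \<in> S" for j p
    proof -
      have "norm (F j p) \<le> C" "norm (G j p) \<le> D" using CD that by auto
      then have "norm (F j p) * norm (G j p) \<le> C * D"
        by (intro mult_mono) (auto intro: order_trans[OF norm_ge_zero])
      then show ?thesis using K by (meson mult_right_mono order_trans)
    qed
    moreover have "continuous_on S (\<lambda>p. pr (F j p) (G j p))" for j
      by (rule bounded_bilinear.continuous_on[OF bl bounded_Ck_continuous[OF H(1)] bounded_Ck_continuous[OF H(2)]])
    ultimately show ?thesis by auto
  qed
  {
    case 0
    then show ?case using * by blast
  next
    case (Suc k)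
    have 0: "bounded_Ck 0 S (\<lambda>j p. pr (F j p) (G j p))"
      by (intro * bounded_Ck_0[OF Suc.prems(1)] bounded_Ck_0[OF Suc.prems(2)])
    show ?case
    proof (rule bounded_Ck_SucI[OF 0])
      fix v
      obtain F' G' where D: "bounded_Ck k S F'" "\<forall>j. \<forall>p\<in>S. has_dirderiv (F j) v (F' j p) p"
         "bounded_Ck k S G'" "\<forall>j. \<forall>p\<in>S. has_dirderiv (G j) v (G' j p) p"
        using bounded_Ck_derivative[OF Suc.prems(1), of v] bounded_Ck_derivative[OF Suc.prems(2), of v] by metis
      have FG: "bounded_Ck k S F" "bounded_Ck k S G"
        using Suc.prems bounded_Ck_SucD by blast+
      have "has_dirderiv (\<lambda>p. pr (F j p) (G j p)) v (pr (F j p) (G' j p) + pr (F' j p) (G j p)) p"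
        if "p \<in> S" for j p
        using bounded_bilinear.has_vector_derivative[OF bl, of "\<lambda>t. F j (p + t *\<^sub>R v)" "F' j p" 0 UNIV "\<lambda>t. G j (p + t *\<^sub>R v)" "G' j p"] D that
        by (simp add: has_dirderiv_def)
      then show "\<exists>H. bounded_Ck k S H \<and> (\<forall>j. \<forall>p\<in>S. has_dirderiv (\<lambda>p. pr (F j p) (G j p)) v (H j p) p)"
        by (intro exI[of _ "\<lambda>j p. pr (F j p) (G' j p) + pr (F' j p) (G j p)"])
           (auto intro!: bounded_Ck_add Suc.IH D FG)
    qed
  }
qed

lemma bdd_smooth_add:
  "open S \<Longrightarrow> bdd_smooth S F \<Longrightarrow> bdd_smooth S G \<Longrightarrow> bdd_smooth S (\<lambda>j p. F j p + G j p)"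
  by (simp add: bdd_smooth_iff bounded_Ck_add del: bounded_Ck.simps)

lemma bdd_smooth_bilinear:
  "bounded_bilinear pr \<Longrightarrow> open S \<Longrightarrow> bdd_smooth S F \<Longrightarrow> bdd_smooth S G \<Longrightarrow> bdd_smooth S (\<lambda>j p. pr (F j p) (G j p))"
  by (simp add: bdd_smooth_iff bounded_Ck_bilinear del: bounded_Ck.simps)

lemmas bdd_smooth_mult = bdd_smooth_bilinear[OF bounded_bilinear_mult]
lemmas bdd_smooth_scaleR = bdd_smooth_bilinear[OF bounded_bilinear_scaleR]

text \<open>The first derivatives are constants and the higher ones vanish; boundedness of
  \<open>S\<close> is what bounds the function itself.\<close>

lemma bdd_smooth_linear_fun:
  assumes L: "bounded_linear L" and "open S" "bounded S"
  shows "bdd_smooth S (\<lambda>j. L)"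
proof -
  have "bounded (L ` S)"
    using assms bounded_linear_image by blast
  then have 0: "bounded_Ck 0 S (\<lambda>j. L)"
    by (auto simp: bounded_iff linear_continuous_on[OF L])
  have hd: "has_dirderiv L v (L v) p" for v p
  proof -
    interpret bounded_linear L by fact
    have "((\<lambda>t. L p + t *\<^sub>R L v) has_vector_derivative L v) (at 0)"
      by (auto intro!: derivative_eq_intros)
    then show ?thesis by (simp add: has_dirderiv_def add scaleR)
  qed
  have "bounded_Ck k S (\<lambda>j. L)" for k
  proof (cases k)
    case (Suc m)
    show ?thesis unfolding Suc
      by (intro bounded_Ck_SucI[OF 0] exI) (auto intro!: bounded_Ck_const hd)
  qed (use 0 in simp)
  then show ?thesis unfolding bdd_smooth_iff[OF assms(2)] by blast
qed

lemma bounded_Ck_precompose: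
  fixes F :: "'i \<Rightarrow> 'b::real_normed_vector \<Rightarrow> 'c::real_normed_vector" and L :: "'a::real_normed_vector \<Rightarrow> 'b"
  assumes "bounded_linear L" "L ` S' \<subseteq> S"
  shows "bounded_Ck k S F \<Longrightarrow> bounded_Ck k S' (\<lambda>j p. F j (L p))"
proof (induction k arbitrary: F)
  have *: "bounded_Ck 0 S' (\<lambda>j p. F j (L p))" if H: "bounded_Ck 0 S F" for F :: "'i \<Rightarrow> 'b \<Rightarrow> 'c"
  proof -
    have "continuous_on S' (\<lambda>p. F j (L p))" for j
      by (rule continuous_on_compose2[OF bounded_Ck_continuous[OF H, of j] linear_continuous_on[OF assms(1)] assms(2)])
    moreover obtain C where "\<forall>j. \<forall>p\<in>S. norm (F j p) \<le> C" using bounded_Ck_bound[OF H] by blast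
    ultimately show ?thesis using assms(2) by (auto simp: image_subset_iff intro!: exI[of _ C])
  qed
  {
    case 0
    then show ?case using * by blast
  next
    case (Suc k)
    have 0: "bounded_Ck 0 S' (\<lambda>j p. F j (L p))"
      by (intro * bounded_Ck_0[OF Suc.prems(1)])
    have lin: "linear L" using assms bounded_linear.linear by blast
    show ?case
    proof (rule bounded_Ck_SucI[OF 0])
      fix v
      obtain F' where D: "bounded_Ck k S F'" "\<forall>j. \<forall>p\<in>S. has_dirderiv (F j) (L v) (F' j p) p"
        using bounded_Ck_derivative[OF Suc.prems] by blast
      then show "\<exists>H. bounded_Ck k S' H \<and> (\<forall>j. \<forall>p\<in>S'. has_dirderiv (\<lambda>p. F j (L p)) v (H j p) p)"
        using assms by (intro exI[of _ "\<lambda>j p. F' j (L p)"])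
           (auto intro!: Suc.IH simp: has_dirderiv_linear_comp[OF lin])
    qed
  }
qed

lemma bdd_smooth_precompose:
  "bounded_linear L \<Longrightarrow> open S \<Longrightarrow> open S' \<Longrightarrow> L ` S' \<subseteq> S \<Longrightarrow> bdd_smooth S F \<Longrightarrow> bdd_smooth S' (\<lambda>j p. F j (L p))"
  by (simp add: bdd_smooth_iff bounded_Ck_precompose del: bounded_Ck.simps)

text \<open>The outer function depends on one real variable, so the chain rule yields one product
  \<open>g'\<close> times \<open>X' (g)\<close>, and the induction hypothesis is applied to
  \<open>X'\<close>. The index type \<open>unit\<close> turns the single function \<open>X\<close>
  into a family.\<close>

lemma bounded_Ck_compose_real:
  fixes X :: "real \<Rightarrow> 'b::real_normed_vector"
  assumes "\<And>j p. p \<in> S \<Longrightarrow> g j p \<in> T"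
  shows "bounded_Ck k T (\<lambda>_::unit. X) \<Longrightarrow> bounded_Ck k S g \<Longrightarrow> bounded_Ck k S (\<lambda>j p. X (g j p))"
proof (induction k arbitrary: X)
  have *: "bounded_Ck 0 S (\<lambda>j p. X (g j p))"
    if H: "bounded_Ck 0 T (\<lambda>_::unit. X)" "bounded_Ck 0 S g" for X :: "real \<Rightarrow> 'b"
  proof -
    have "continuous_on S (\<lambda>p. X (g j p))" for j
      by (rule continuous_on_compose2[OF bounded_Ck_continuous[OF H(1)] bounded_Ck_continuous[OF H(2)]])
         (use assms in auto)
    moreover obtain C where "\<forall>y\<in>T. norm (X y) \<le> C" using bounded_Ck_bound[OF H(1)] by blast
    ultimately show ?thesis using assms by (auto intro!: exI[of _ C])
  qed
  {
    case 0
    then show ?case using * by blast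
  next
    case (Suc k)
    have 0: "bounded_Ck 0 S (\<lambda>j p. X (g j p))"
      by (intro * bounded_Ck_0[OF Suc.prems(1)] bounded_Ck_0[OF Suc.prems(2)])
    obtain X' where X': "bounded_Ck k T (\<lambda>_::unit. X')" "\<forall>y\<in>T. has_dirderiv X 1 (X' y) y"
    proof -
      obtain Z where "bounded_Ck k T Z" "\<forall>j::unit. \<forall>p\<in>T. has_dirderiv X 1 (Z j p) p"
        using bounded_Ck_derivative[OF Suc.prems(1), of 1] by metis
      moreover have "Z = (\<lambda>_. Z ())" by (auto simp: fun_eq_iff)
      ultimately show ?thesis using that[of "Z ()"] by metis
    qed
    show ?case
    proof (rule bounded_Ck_SucI[OF 0])
      fix v
      obtain g' where D: "bounded_Ck k S g'" "\<forall>j. \<forall>p\<in>S. has_dirderiv (g j) v (g' j p) p"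
        using bounded_Ck_derivative[OF Suc.prems(2), of v] by metis
      have IH: "bounded_Ck k S (\<lambda>j p. X' (g j p))"
        using Suc.IH X' Suc.prems(2) bounded_Ck_SucD by blast
      have "has_dirderiv (\<lambda>p. X (g j p)) v (g' j p *\<^sub>R X' (g j p)) p" if "p \<in> S" for j p
      proof -
        have "((\<lambda>t. g j (p + t *\<^sub>R v)) has_vector_derivative g' j p) (at 0)"
          using D(2) that by (simp add: has_dirderiv_def)
        moreover have "(X has_vector_derivative X' (g j p)) (at (g j (p + 0 *\<^sub>R v)))"
          using has_dirderiv_line[of X 1 "X' (g j p)" 0 "g j p"] X'(2) assms that by auto
        ultimately show ?thesis
          using vector_diff_chain_at[of "\<lambda>t. g j (p + t *\<^sub>R v)" "g' j p" 0 X "X' (g j p)"]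
          by (simp add: has_dirderiv_def o_def)
      qed
      then show "\<exists>H. bounded_Ck k S H \<and> (\<forall>j. \<forall>p\<in>S. has_dirderiv (\<lambda>p. X (g j p)) v (H j p) p)"
        by (intro exI[of _ "\<lambda>j p. g' j p *\<^sub>R X' (g j p)"])
           (auto intro!: bounded_Ck_bilinear[OF bounded_bilinear_scaleR] IH D)
    qed
  }
qed

lemma bdd_smooth_compose_real:
  fixes X :: "real \<Rightarrow> 'b::real_normed_vector"
  assumes "open S" "open T" "\<And>j p. p \<in> S \<Longrightarrow> g j p \<in> T"
    "bdd_smooth T (\<lambda>_::unit. X)" "bdd_smooth S g"
  shows "bdd_smooth S (\<lambda>j p. X (g j p))"
  using bounded_Ck_compose_real[of S g T] assms by (metis bdd_smooth_iff)

text \<open>The derivative of 1/d is -(1/d) d' (1/d), a product involving 1/d itself at one order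
  less, which the induction hypothesis already covers. The lower bound \<open>c\<close> is used only
  for the bound of order 0.\<close>

lemma bounded_Ck_inverse:
  fixes d :: "'i \<Rightarrow> 'a::real_normed_vector \<Rightarrow> real"
  assumes "c > 0" "\<And>j p. p \<in> S \<Longrightarrow> \<bar>d j p\<bar> \<ge> c"
  shows "bounded_Ck k S d \<Longrightarrow> bounded_Ck k S (\<lambda>j p. inverse (d j p))"
proof (induction k)
  have nz: "d j p \<noteq> 0" if "p \<in> S" for j p using assms(2)[OF that, of j] assms(1) by auto
  have *: "bounded_Ck 0 S (\<lambda>j p. inverse (d j p))" if "bounded_Ck 0 S d"
  proof -
    have "norm (inverse (d j p)) \<le> inverse c" if "p \<in> S" for j p
      using assms(1) assms(2)[OF that, of j] by (simp add: le_imp_inverse_le)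
    then show ?thesis using that nz by (auto intro!: continuous_intros)
  qed
  {
    case 0
    then show ?case using * by blast
  next
    case (Suc k)
    have 0: "bounded_Ck 0 S (\<lambda>j p. inverse (d j p))"
      by (intro * bounded_Ck_0[OF Suc.prems(1)])
    have IH: "bounded_Ck k S (\<lambda>j p. inverse (d j p))"
      using Suc bounded_Ck_SucD by blast
    show ?case
    proof (rule bounded_Ck_SucI[OF 0])
      fix v
      obtain d' where D: "bounded_Ck k S d'" "\<forall>j. \<forall>p\<in>S. has_dirderiv (d j) v (d' j p) p"
        using bounded_Ck_derivative[OF Suc.prems, of v] by metis
      have "has_dirderiv (\<lambda>p. inverse (d j p)) v ((-1) * (inverse (d j p) * d' j p * inverse (d j p))) p" if "p \<in> S" for j p
      proof -
        have "((\<lambda>t. d j (p + t *\<^sub>R v)) has_field_derivative d' j p) (at 0)"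
          using D(2) that by (simp add: has_dirderiv_def has_real_derivative_iff_has_vector_derivative)
        from DERIV_inverse'[OF this] nz[OF that] show ?thesis
          by (simp add: has_dirderiv_def has_real_derivative_iff_has_vector_derivative)
      qed
      then show "\<exists>H. bounded_Ck k S H \<and> (\<forall>j. \<forall>p\<in>S. has_dirderiv (\<lambda>p. inverse (d j p)) v (H j p) p)"
        by (intro exI[of _ "\<lambda>j p. (-1) * (inverse (d j p) * d' j p * inverse (d j p))"])
           (intro conjI bounded_Ck_bilinear[OF bounded_bilinear_mult] bounded_Ck_const IH D, blast)
    qed
  }
qed

lemma bdd_smooth_inverse:
  fixes d :: "'i \<Rightarrow> 'a::real_normed_vector \<Rightarrow> real"
  assumes "open S" "c > 0" "\<And>j p. p \<in> S \<Longrightarrow> \<bar>d j p\<bar> \<ge> c" "bdd_smooth S d"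
  shows "bdd_smooth S (\<lambda>j p. inverse (d j p))"
  using bounded_Ck_inverse[of c S d] assms by (simp add: bdd_smooth_iff del: bounded_Ck.simps)

text \<open>The open sets \<open>S\<close> and \<open>- K\<close> cover the space; on the second one
  every derivative is 0, so all statements can be checked on the two pieces separately.\<close>

lemma bounded_Ck_extend_zero:
  fixes F :: "'i \<Rightarrow> 'a::real_normed_vector \<Rightarrow> 'b::real_normed_vector"
  assumes "open S" "closed K" "K \<subseteq> S"
  shows "bounded_Ck k S F \<Longrightarrow> (\<And>j p. p \<notin> K \<Longrightarrow> F j p = 0) \<Longrightarrow> bounded_Ck k UNIV F"
proof (induction k arbitrary: F)
  have un: "S \<union> - K = UNIV" using assms by auto
  have *: "bounded_Ck 0 UNIV F" if H: "bounded_Ck 0 S F" "\<And>j p. p \<notin> K \<Longrightarrow> F j p = 0" for F :: "'i \<Rightarrow> 'a \<Rightarrow> 'b"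
  proof -
    obtain C where C: "\<And>j p. p \<in> S \<Longrightarrow> norm (F j p) \<le> C" using bounded_Ck_bound[OF H(1)] by blast
    have "norm (F j p) \<le> max C 0" for j p
    proof (cases "p \<in> K")
      case True then show ?thesis using C[of p j] assms by (auto simp: le_max_iff_disj)
    qed (simp add: that(2))
    moreover have "continuous_on UNIV (F j)" for j
    proof -
      have "continuous_on (- K) (F j) \<longleftrightarrow> continuous_on (- K) (\<lambda>_. 0 :: 'b)"
        using that(2) by (intro continuous_on_cong) auto
      then have "continuous_on (S \<union> - K) (F j)"
        using that assms by (intro continuous_on_open_Un) auto
      then show ?thesis by (simp add: un)
    qed
    ultimately show ?thesis by (auto simp only: bounded_Ck.simps)
  qed
  {
    case 0
    then show ?case using * by blast
  next
    case (Suc k)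
    have 0: "bounded_Ck 0 UNIV F"
      by (intro * bounded_Ck_0[OF Suc.prems(1)] Suc.prems(2))
    show ?case
    proof (rule bounded_Ck_SucI[OF 0])
      fix v
      obtain F' where D: "bounded_Ck k S F'" "\<forall>j. \<forall>p\<in>S. has_dirderiv (F j) v (F' j p) p"
        using bounded_Ck_derivative[OF Suc.prems(1), of v] by blast
      define G where "G j p = (if p \<in> K then F' j p else 0)" for j p
      have zero: "has_dirderiv (F j) v 0 p" if "p \<notin> K" for j p
        by (rule has_dirderiv_cong[of "- K" p "\<lambda>_. 0"]) (use that assms Suc.prems in \<open>auto simp: has_dirderiv_def\<close>)
      \<comment> \<open>On the overlap of \<open>S\<close> and \<open>- K\<close> the supplied
        derivative is forced to be 0, so cutting it off outside \<open>K\<close> changes nothing on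
        \<open>S\<close> and keeps it of order \<open>k\<close>.\<close>
      have eq: "F' j p = G j p" if "p \<in> S" for j p
        using zero[of p j] D(2) that dirderiv_eqI unfolding G_def by metis
      have "bounded_Ck k UNIV G"
        by (rule Suc.IH) (auto simp: G_def[abs_def] intro: bounded_Ck_cong[OF assms(1) D(1)] simp: eq[unfolded G_def])
      moreover have "has_dirderiv (F j) v (G j p) p" for j p
        using zero D(2) assms(3) by (auto simp: G_def)
      ultimately show "\<exists>H. bounded_Ck k UNIV H \<and> (\<forall>j. \<forall>p\<in>UNIV. has_dirderiv (F j) v (H j p) p)"
        by blast
    qed
  }
qed

lemma bdd_smooth_extend_zero:
  fixes F :: "'i \<Rightarrow> 'a::real_normed_vector \<Rightarrow> 'b::real_normed_vector"
  assumes "open S" "closed K" "K \<subseteq> S" "bdd_smooth S F" "\<And>j p. p \<notin> K \<Longrightarrow> F j p = 0"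
  shows "bdd_smooth UNIV F"
  unfolding bdd_smooth_iff[OF open_UNIV]
  using bounded_Ck_extend_zero[OF assms(1-3)] assms(4,5) unfolding bdd_smooth_iff[OF assms(1)] by blast

section \<open>Symmetry, linearity and series of directional derivatives\<close>

lemma smooth_on_has_vderiv_line:
  assumes "smooth_on S f" "p + s *\<^sub>R v \<in> S"
  shows "((\<lambda>t. iterdir vs f (p + t *\<^sub>R v)) has_vector_derivative iterdir (v # vs) f (p + s *\<^sub>R v)) (at s)"
  using has_dirderiv_line[OF smooth_on_has_dirderiv[OF assms]] .

lemma small_parallelogram:
  fixes p :: "'a::real_normed_vector"
  assumes "open S" "p \<in> S"
  obtains e where "e > 0" "\<And>s t. \<bar>s\<bar> \<le> e \<Longrightarrow> \<bar>t\<bar> \<le> e \<Longrightarrow> p + s *\<^sub>R v + t *\<^sub>R w \<in> S"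
proof -
  obtain d where d: "d > 0" "ball p d \<subseteq> S" using assms open_contains_ball by blast
  define N where "N = norm v + norm w + 1"
  define e where "e = d / (2 * N)"
  have pos: "N > 0" unfolding N_def by (smt (verit) norm_ge_zero)
  have e: "e > 0" using d pos by (simp add: e_def)
  have "p + s *\<^sub>R v + t *\<^sub>R w \<in> S" if "\<bar>s\<bar> \<le> e" "\<bar>t\<bar> \<le> e" for s t
  proof -
    have "norm (s *\<^sub>R v + t *\<^sub>R w) \<le> \<bar>s\<bar> * norm v + \<bar>t\<bar> * norm w"
      by (metis norm_scaleR norm_triangle_ineq)
    also have "\<dots> \<le> e * norm v + e * norm w"
      using that by (intro add_mono mult_right_mono) auto
    also have "\<dots> \<le> e * N" using e by (simp add: N_def algebra_simps)
    also have "\<dots> = d / 2" using pos by (simp add: e_def)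
    also have "\<dots> < d" using d by simp
    finally have "dist p (p + s *\<^sub>R v + t *\<^sub>R w) < d"
      by (simp add: dist_norm algebra_simps) (metis add.commute minus_add_distrib norm_minus_cancel uminus_add_conv_diff)
    then show ?thesis using d by (auto simp: subset_iff)
  qed
  with e that show ?thesis by blast
qed

lemma smooth_on_FTC_line:
  fixes f :: "'a::real_normed_vector \<Rightarrow> 'b::banach"
  assumes "smooth_on S f" "\<And>t. t \<in> {a..b} \<Longrightarrow> p + t *\<^sub>R v \<in> S" "a \<le> b"
  shows "((\<lambda>t. iterdir (v # vs) f (p + t *\<^sub>R v)) has_integral iterdir vs f (p + b *\<^sub>R v) - iterdir vs f (p + a *\<^sub>R v)) {a..b}"
  by (rule fundamental_theorem_of_calculus[OF assms(3)])
     (rule has_vector_derivative_at_within, rule smooth_on_has_vderiv_line[OF assms(1) assms(2)])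

text \<open>Symmetry of second derivatives: differentiate
  \<open>f (p + s v + t w) - f (p + t w) = \<integral> \<partial>\<^sub>v f (p + \<sigma> v + t w) d\<sigma>\<close> first in \<open>t\<close> and then in \<open>s\<close>.\<close>

lemma dirderiv_commute:
  fixes f :: "'a::real_normed_vector \<Rightarrow> 'b::banach"
  assumes S: "open S" and f: "smooth_on S f" and p: "p \<in> S"
  shows "iterdir (v # w # vs) f p = iterdir (w # v # vs) f p"
proof -
  define F where "F = iterdir vs f"
  have F: "smooth_on S F" unfolding F_def by (rule smooth_on_iterdir[OF f])
  obtain e where e: "e > 0" "\<And>s t. \<bar>s\<bar> \<le> e \<Longrightarrow> \<bar>t\<bar> \<le> e \<Longrightarrow> p + s *\<^sub>R v + t *\<^sub>R w \<in> S"
    using small_parallelogram[OF S p] by blast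
  have "dirderiv w F (p + s *\<^sub>R v) - dirderiv w F p = integral {0..s} (\<lambda>\<sigma>. dirderiv w (dirderiv v F) (p + \<sigma> *\<^sub>R v))"
    if s: "s \<in> {0..e}" for s
  proof -
    have 1: "((\<lambda>t. integral (cbox 0 s) (\<lambda>\<sigma>. dirderiv v F (p + \<sigma> *\<^sub>R v + t *\<^sub>R w))) has_vector_derivative
        integral (cbox 0 s) (\<lambda>\<sigma>. dirderiv w (dirderiv v F) (p + \<sigma> *\<^sub>R v + 0 *\<^sub>R w))) (at 0 within {-e..e})"
    proof (rule leibniz_rule_vector_derivative)
      fix t \<sigma> assume t: "t \<in> {-e..e}" and \<sigma>: "\<sigma> \<in> cbox 0 s"
      then have "p + \<sigma> *\<^sub>R v + t *\<^sub>R w \<in> S" using e s by auto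
      from smooth_on_has_vderiv_line[OF F this, of "[v]"]
      show "((\<lambda>t. dirderiv v F (p + \<sigma> *\<^sub>R v + t *\<^sub>R w)) has_vector_derivative dirderiv w (dirderiv v F) (p + \<sigma> *\<^sub>R v + t *\<^sub>R w)) (at t within {-e..e})"
        by (simp add: has_vector_derivative_at_within)
    next
      fix t assume t: "t \<in> {-e..e}"
      show "(\<lambda>\<sigma>. dirderiv v F (p + \<sigma> *\<^sub>R v + t *\<^sub>R w)) integrable_on cbox 0 s"
        by (rule integrable_continuous, rule continuous_on_compose2[OF smooth_on_continuous[OF F, of "[v]", simplified]])
           (use e s t in \<open>auto intro!: continuous_intros\<close>)
    next
      show "continuous_on ({-e..e} \<times> cbox 0 s) (\<lambda>(x, t). dirderiv w (dirderiv v F) (p + t *\<^sub>R v + x *\<^sub>R w))"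
      proof -
        have "continuous_on ({-e..e} \<times> cbox 0 s) (\<lambda>x. dirderiv w (dirderiv v F) (p + snd x *\<^sub>R v + fst x *\<^sub>R w))"
          by (rule continuous_on_compose2[OF smooth_on_continuous[OF F, of "[w, v]", simplified]])
             (use e s in \<open>auto intro!: continuous_intros\<close>)
        then show ?thesis by (simp add: case_prod_unfold)
      qed
    qed (use e in auto)
    have 2: "((\<lambda>t. F (p + s *\<^sub>R v + t *\<^sub>R w) - F (p + t *\<^sub>R w)) has_vector_derivative
        dirderiv w F (p + s *\<^sub>R v + 0 *\<^sub>R w) - dirderiv w F (p + 0 *\<^sub>R w)) (at 0 within {-e..e})"
    proof (rule has_vector_derivative_at_within, rule has_vector_derivative_diff)
      have "p + s *\<^sub>R v + 0 *\<^sub>R w \<in> S" "p + 0 *\<^sub>R w \<in> S" using e(2)[of s 0] e(1) s p by auto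
      then show "((\<lambda>t. F (p + s *\<^sub>R v + t *\<^sub>R w)) has_vector_derivative dirderiv w F (p + s *\<^sub>R v + 0 *\<^sub>R w)) (at 0)"
        "((\<lambda>t. F (p + t *\<^sub>R w)) has_vector_derivative dirderiv w F (p + 0 *\<^sub>R w)) (at 0)"
        using smooth_on_has_vderiv_line[OF F, of _ 0 w "[]"] by (metis iterdir.simps)+
    qed
    have eq: "F (p + s *\<^sub>R v + t *\<^sub>R w) - F (p + t *\<^sub>R w) = integral (cbox 0 s) (\<lambda>\<sigma>. dirderiv v F (p + \<sigma> *\<^sub>R v + t *\<^sub>R w))"
      if t: "t \<in> {-e..e}" for t
    proof -
      have "p + t *\<^sub>R w + \<sigma> *\<^sub>R v \<in> S" if "\<sigma> \<in> {0..s}" for \<sigma>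
        using e(2)[of \<sigma> t] t s that by (simp add: algebra_simps abs_le_iff)
      from smooth_on_FTC_line[where vs="[]" and a=0 and b=s, OF F this] s
      have "((\<lambda>\<sigma>. dirderiv v F (p + t *\<^sub>R w + \<sigma> *\<^sub>R v)) has_integral F (p + t *\<^sub>R w + s *\<^sub>R v) - F (p + t *\<^sub>R w)) {0..s}"
        by simp
      then show ?thesis by (simp add: integral_unique add.assoc add.commute[of "t *\<^sub>R w"])
    qed
    have "((\<lambda>t. integral (cbox 0 s) (\<lambda>\<sigma>. dirderiv v F (p + \<sigma> *\<^sub>R v + t *\<^sub>R w))) has_vector_derivative
        dirderiv w F (p + s *\<^sub>R v + 0 *\<^sub>R w) - dirderiv w F (p + 0 *\<^sub>R w)) (at 0 within {-e..e})"
      by (rule has_vector_derivative_transform[OF _ _ 2]) (use e eq in auto)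
    from vector_derivative_unique_within[OF _ this 1] e(1)
    show ?thesis by (simp add: trivial_limit_within)
  qed note id = this
  \<comment> \<open>The identity is available only for s >= 0, so both sides are differentiated at 0
    within {0..e}; a one-sided derivative is still unique.\<close>
  have "((\<lambda>s. integral {0..s} (\<lambda>\<sigma>. dirderiv w (dirderiv v F) (p + \<sigma> *\<^sub>R v))) has_vector_derivative
      dirderiv w (dirderiv v F) (p + 0 *\<^sub>R v)) (at 0 within {0..e})"
  proof (rule integral_has_vector_derivative)
    show "continuous_on {0..e} (\<lambda>\<sigma>. dirderiv w (dirderiv v F) (p + \<sigma> *\<^sub>R v))"
      by (rule continuous_on_compose2[OF smooth_on_continuous[OF F, of "[w, v]", simplified]])
         (use e(2)[of _ 0] e(1) in \<open>auto intro!: continuous_intros\<close>)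
  qed (use e in auto)
  then have A: "((\<lambda>s. dirderiv w F (p + s *\<^sub>R v) - dirderiv w F p) has_vector_derivative
      dirderiv w (dirderiv v F) (p + 0 *\<^sub>R v)) (at 0 within {0..e})"
    by (rule has_vector_derivative_transform[rotated 2]) (use e id in auto)
  have B: "((\<lambda>s. dirderiv w F (p + s *\<^sub>R v) - dirderiv w F p) has_vector_derivative
      dirderiv v (dirderiv w F) (p + 0 *\<^sub>R v) - 0) (at 0 within {0..e})"
    using smooth_on_has_vderiv_line[OF F, of p 0 v "[w]"] p
    by (intro has_vector_derivative_at_within[OF has_vector_derivative_diff[OF _ has_vector_derivative_const]]) simp
  have "dirderiv w (dirderiv v F) (p + 0 *\<^sub>R v) = dirderiv v (dirderiv w F) (p + 0 *\<^sub>R v) - 0"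
    by (rule vector_derivative_unique_within[OF _ A B]) (use e(1) in \<open>simp add: trivial_limit_within\<close>)
  then show ?thesis by (simp add: F_def)
qed

text \<open>Adjacent transpositions carry the head of \<open>vs\<close> to its place in
  \<open>ws\<close>. This frees later arguments from the fixed order of coordinates built into
  \<open>mderiv\<close>.\<close>

lemma iterdir_mset_cong:
  fixes f :: "'a::real_normed_vector \<Rightarrow> 'b::banach"
  assumes S: "open S"
  shows "mset vs = mset ws \<Longrightarrow> smooth_on S f \<Longrightarrow> p \<in> S \<Longrightarrow> iterdir vs f p = iterdir ws f p"
proof (induction vs arbitrary: ws p)
  case (Cons v vs)
  from Cons.prems(1) have "v \<in> set ws" by (metis list.set_intros(1) set_mset_mset)
  then obtain xs ys where ws: "ws = xs @ v # ys" by (meson split_list)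
  have eq: "iterdir vs f q = iterdir (xs @ ys) f q" if "q \<in> S" for q
    using Cons ws that by simp
  have "iterdir (v # vs) f p = iterdir (v # xs @ ys) f p"
    using dirderiv_cong[OF S Cons.prems(3) eq, where v=v] by simp
  also have "\<dots> = iterdir (xs @ v # ys) f p"
    using Cons.prems(3)
  proof (induction xs arbitrary: p)
    case (Cons x xs)
    have "iterdir (v # (x # xs) @ ys) f p = iterdir (x # v # xs @ ys) f p"
      using dirderiv_commute[OF S \<open>smooth_on S f\<close> Cons.prems, of v x "xs @ ys"] by simp
    also have "\<dots> = iterdir (x # xs @ v # ys) f p"
      using dirderiv_cong[OF S Cons.prems, of "iterdir (v # xs @ ys) f" "iterdir (xs @ v # ys) f" x]
        Cons.IH by simp
    finally show ?case by simp
  qed simp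
  finally show ?case using ws by simp
qed simp

text \<open>Derivatives along lines need not be additive in the direction in general. Here (s, t) ->
  f(p + s v + t w) is Frechet differentiable at (0, 0), because its partial derivative in t is
  continuous near that point and the one in s exists there; restriction to the diagonal s = t gives
  the sum.\<close>

lemma dirderiv_add:
  fixes f :: "'a::real_normed_vector \<Rightarrow> 'b::banach"
  assumes S: "open S" and f: "smooth_on S f" and p: "p \<in> S"
  shows "dirderiv (v + w) f p = dirderiv v f p + dirderiv w f p"
proof -
  obtain e where e: "e > 0" "\<And>s t. \<bar>s\<bar> \<le> e \<Longrightarrow> \<bar>t\<bar> \<le> e \<Longrightarrow> p + s *\<^sub>R v + t *\<^sub>R w \<in> S"
    using small_parallelogram[OF S p] by blast
  let ?I = "{-e<..<e}"
  have conv: "convex ?I" and op: "open ?I" and 0: "0 \<in> ?I" using e by auto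
  have "((\<lambda>(s, t). f (p + s *\<^sub>R v + t *\<^sub>R w)) has_derivative
     (\<lambda>(ts, tt). ts *\<^sub>R dirderiv v f p + blinfun_scaleR_left (dirderiv w f (p + 0 *\<^sub>R v + 0 *\<^sub>R w)) tt)) (at (0, 0) within ?I \<times> ?I)"
  proof (rule has_derivative_partialsI[where fy="\<lambda>s t. blinfun_scaleR_left (dirderiv w f (p + s *\<^sub>R v + t *\<^sub>R w))"])
    show "((\<lambda>s. f (p + s *\<^sub>R v + 0 *\<^sub>R w)) has_derivative (\<lambda>ts. ts *\<^sub>R dirderiv v f p)) (at 0 within ?I)"
      using smooth_on_has_vderiv_line[OF f, of p 0 v "[]"] p
      by (auto simp: has_vector_derivative_def intro: has_derivative_at_withinI)
    fix s t assume st: "s \<in> ?I" "t \<in> ?I"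
    then show "((\<lambda>t. f (p + s *\<^sub>R v + t *\<^sub>R w)) has_derivative blinfun_scaleR_left (dirderiv w f (p + s *\<^sub>R v + t *\<^sub>R w))) (at t within ?I)"
      using smooth_on_has_vderiv_line[OF f, of "p + s *\<^sub>R v" t w "[]"] e(2)[of s t]
      by (auto simp: has_vector_derivative_def intro: has_derivative_at_withinI)
  next
    have "continuous_on (?I \<times> ?I) (\<lambda>x. blinfun_scaleR_left (dirderiv w f (p + fst x *\<^sub>R v + snd x *\<^sub>R w)))"
      by (intro bounded_linear.continuous_on[OF bounded_linear_blinfun_scaleR_left]
           continuous_on_compose2[OF smooth_on_continuous[OF f, of "[w]", simplified]])
         (use e in \<open>auto intro!: continuous_intros\<close>)
    then show "continuous (at (0, 0) within ?I \<times> ?I) (\<lambda>(x, y). blinfun_scaleR_left (dirderiv w f (p + x *\<^sub>R v + y *\<^sub>R w)))"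
      using e(1) by (auto simp: case_prod_unfold continuous_on_eq_continuous_within)
  qed (use e in auto)
  then have "((\<lambda>(s, t). f (p + s *\<^sub>R v + t *\<^sub>R w)) has_derivative
     (\<lambda>(ts, tt). ts *\<^sub>R dirderiv v f p + tt *\<^sub>R dirderiv w f p)) (at ((\<lambda>t. (t, t)) 0))"
    using 0 at_within_open[OF _ open_Times[OF op op], of "(0, 0)"] by auto
  moreover have "((\<lambda>t::real. (t, t)) has_derivative (\<lambda>t. (t, t))) (at 0)"
    by (auto intro!: derivative_eq_intros)
  ultimately have "((\<lambda>(s, t). f (p + s *\<^sub>R v + t *\<^sub>R w)) \<circ> (\<lambda>t. (t, t)) has_derivative
     (\<lambda>(ts, tt). ts *\<^sub>R dirderiv v f p + tt *\<^sub>R dirderiv w f p) \<circ> (\<lambda>t. (t, t))) (at 0)"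
    by (rule diff_chain_at[rotated])
  then have "has_dirderiv f (v + w) (dirderiv v f p + dirderiv w f p) p"
    by (simp add: o_def has_dirderiv_def has_vector_derivative_def algebra_simps)
  then show ?thesis by (rule dirderiv_eqI)
qed

lemma dirderiv_scale:
  fixes f :: "'a::real_normed_vector \<Rightarrow> 'b::real_normed_vector"
  assumes f: "smooth_on S f" and p: "p \<in> S"
  shows "dirderiv (c *\<^sub>R v) f p = c *\<^sub>R dirderiv v f p"
proof -
  have "((\<lambda>t. f (p + t *\<^sub>R v)) \<circ> (\<lambda>t. c * t) has_vector_derivative c *\<^sub>R dirderiv v f p) (at 0)"
    by (intro vector_diff_chain_at)
       (use smooth_on_has_vderiv_line[OF f, of p 0 v "[]"] p in \<open>auto intro!: derivative_eq_intros\<close>)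
  then show ?thesis
    by (intro dirderiv_eqI) (simp add: has_dirderiv_def o_def mult.commute)
qed

lemma dirderiv_sum:
  fixes f :: "'a::real_normed_vector \<Rightarrow> 'b::banach"
  assumes S: "open S" and f: "smooth_on S f" and p: "p \<in> S" and "finite B"
  shows "dirderiv (\<Sum>b\<in>B. c b *\<^sub>R e b) f p = (\<Sum>b\<in>B. c b *\<^sub>R dirderiv (e b) f p)"
  using \<open>finite B\<close>
proof (induction B)
  case empty
  then show ?case using dirderiv_scale[OF f p, of 0] by simp
next
  case (insert x B)
  then show ?case by (simp add: dirderiv_add[OF S f p] dirderiv_scale[OF f p])
qed

text \<open>Expanding each direction in the spanning system turns \<open>iterdir vs f\<close> into a
  fixed linear combination of derivatives along words in the \<open>e k\<close>. The coefficients
  depend on \<open>vs\<close> alone, hence one constant \<open>C\<close> serves all sets, functions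
  and points.\<close>

lemma iterdir_le_spanning:
  fixes e :: "'k::finite \<Rightarrow> 'a::real_normed_vector"
  assumes span: "\<And>v. \<exists>c. v = (\<Sum>k\<in>UNIV. c k *\<^sub>R e k)"
  shows "\<exists>C\<ge>0. \<forall>S (f :: 'a \<Rightarrow> 'b::banach) p. open S \<longrightarrow> smooth_on S f \<longrightarrow> p \<in> S \<longrightarrow>
     norm (iterdir vs f p) \<le> C * (\<Sum>l | length l = length vs. norm (iterdir (map e l) f p))"
proof -
  have "\<exists>ps :: (real \<times> 'k list) list. (\<forall>(c, l)\<in>set ps. length l = length vs) \<and>
     (\<forall>S (f :: 'a \<Rightarrow> 'b) p. open S \<longrightarrow> smooth_on S f \<longrightarrow> p \<in> S \<longrightarrow>
       iterdir vs f p = (\<Sum>(c, l)\<leftarrow>ps. c *\<^sub>R iterdir (map e l) f p))"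
  proof (induction vs)
    case Nil
    show ?case by (intro exI[of _ "[(1, [])]"]) auto
  next
    case (Cons v vs)
    then obtain ps :: "(real \<times> 'k list) list" where len: "\<forall>(c, l)\<in>set ps. length l = length vs"
      and ps: "\<And>S (f :: 'a \<Rightarrow> 'b) p. open S \<Longrightarrow> smooth_on S f \<Longrightarrow> p \<in> S \<Longrightarrow>
       iterdir vs f p = (\<Sum>(c, l)\<leftarrow>ps. c *\<^sub>R iterdir (map e l) f p)" by blast
    obtain c where c: "v = (\<Sum>k\<in>UNIV. c k *\<^sub>R e k)" using span by blast
    obtain ks :: "'k list" where ks: "set ks = UNIV" "distinct ks"
      using finite_distinct_list[of "UNIV :: 'k set"] by auto
    have sl: "r *\<^sub>R (\<Sum>(d, l)\<leftarrow>ps. d *\<^sub>R X l) = (\<Sum>(d, l)\<leftarrow>ps. (d * r) *\<^sub>R X l)" for r and X :: "'k list \<Rightarrow> 'b"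
      by (induction ps) (auto simp: scaleR_right_distrib mult.commute)
    \<comment> \<open>Prefixing a letter \<open>k\<close> to a word multiplies its coefficient by
      the \<open>k\<close>-th coefficient of the new direction.\<close>
    define qs where "qs = concat (map (\<lambda>k. map (\<lambda>(d, l). (d * c k, k # l)) ps) ks)"
    show ?case
    proof (intro exI[of _ qs] conjI allI impI)
      show "\<forall>(c, l)\<in>set qs. length l = length (v # vs)" using len by (auto simp: qs_def)
      fix S and f :: "'a \<Rightarrow> 'b" and p assume S: "open S" and f: "smooth_on S f" and p: "p \<in> S"
      have "iterdir (v # vs) f p = (\<Sum>k\<in>UNIV. c k *\<^sub>R dirderiv (e k) (iterdir vs f) p)"
        unfolding c using dirderiv_sum[OF S smooth_on_iterdir[OF f] p, of UNIV c e vs] by simp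
      also have "\<dots> = (\<Sum>k\<in>UNIV. (\<Sum>(d, l)\<leftarrow>ps. (d * c k) *\<^sub>R iterdir (map e (k # l)) f p))"
      proof (rule sum.cong[OF refl])
        fix k
        have *: "has_dirderiv (\<lambda>q. \<Sum>(d, l)\<leftarrow>ps. d *\<^sub>R iterdir (map e l) f q) (e k) (\<Sum>(d, l)\<leftarrow>ps. d *\<^sub>R iterdir (map e (k # l)) f p) p"
        proof (induction ps)
          case (Cons a ps)
          then show ?case using smooth_on_has_dirderiv[OF f p, of "map e (snd a)" "e k"]
            by (cases a) (auto simp: has_dirderiv_def intro!: has_vector_derivative_add bounded_linear.has_vector_derivative[OF bounded_linear_scaleR_right])
        qed (simp add: has_dirderiv_def)
        have "dirderiv (e k) (iterdir vs f) p = (\<Sum>(d, l)\<leftarrow>ps. d *\<^sub>R iterdir (map e (k # l)) f p)"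
          by (rule trans[OF dirderiv_cong[OF S p ps[OF S f]] dirderiv_eqI[OF *]])
        then show "c k *\<^sub>R dirderiv (e k) (iterdir vs f) p = (\<Sum>(d, l)\<leftarrow>ps. (d * c k) *\<^sub>R iterdir (map e (k # l)) f p)"
          by (simp only: sl[of "c k" "\<lambda>l. iterdir (map e (k # l)) f p"])
      qed
      also have "\<dots> = (\<Sum>(c, l)\<leftarrow>qs. c *\<^sub>R iterdir (map e l) f p)"
        unfolding qs_def sum.distinct_set_conv_list[OF ks(2), unfolded ks(1)]
        by (induct ks) (simp_all add: o_def case_prod_unfold)
      finally show "iterdir (v # vs) f p = (\<Sum>(c, l)\<leftarrow>qs. c *\<^sub>R iterdir (map e l) f p)" .
    qed
  qed
  then obtain ps :: "(real \<times> 'k list) list" where len: "\<forall>(c, l)\<in>set ps. length l = length vs"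
      and ps: "\<And>S (f :: 'a \<Rightarrow> 'b) p. open S \<Longrightarrow> smooth_on S f \<Longrightarrow> p \<in> S \<Longrightarrow>
       iterdir vs f p = (\<Sum>(c, l)\<leftarrow>ps. c *\<^sub>R iterdir (map e l) f p)" by blast
  have fin: "finite {l :: 'k list. length l = length vs}"
    using finite_lists_length_eq[OF finite[of "UNIV :: 'k set"], of "length vs"] by simp
  show ?thesis
  proof (intro exI[of _ "\<Sum>(c, l)\<leftarrow>ps. \<bar>c\<bar>"] conjI allI impI)
    show "(\<Sum>(c, l)\<leftarrow>ps. \<bar>c\<bar>) \<ge> 0" by (rule sum_list_nonneg) auto
    fix S and f :: "'a \<Rightarrow> 'b" and p assume S: "open S" and f: "smooth_on S f" and p: "p \<in> S"
    let ?B = "\<Sum>l | length l = length vs. norm (iterdir (map e l) f p)"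
    have "norm (\<Sum>(c, l)\<leftarrow>ps. c *\<^sub>R iterdir (map e l) f p) \<le> (\<Sum>(c, l)\<leftarrow>ps. \<bar>c\<bar>) * ?B"
      using len
    proof (induction ps)
      case (Cons a ps)
      obtain c l where a: "a = (c, l)" by (cases a)
      have "norm (iterdir (map e l) f p) \<le> ?B"
        by (rule member_le_sum) (use Cons.prems fin a in auto)
      then have "norm (c *\<^sub>R iterdir (map e l) f p) \<le> \<bar>c\<bar> * ?B" by (simp add: mult_left_mono)
      then show ?case using Cons a by (simp add: distrib_right norm_triangle_le)
    qed simp
    then show "norm (iterdir vs f p) \<le> (\<Sum>(c, l)\<leftarrow>ps. \<bar>c\<bar>) * ?B" using ps[OF S f p] by simp
  qed
qed

text \<open>Termwise differentiation by the Weierstrass test. The neighbourhood and the majorant may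
  depend on the point and on the word of directions, which is all that is available near a
  singularity.\<close>

lemma smooth_on_suminf:
  fixes g :: "nat \<Rightarrow> 'a::real_normed_vector \<Rightarrow> 'b::banach"
  assumes S: "open S" and g: "\<And>j. smooth_on S (g j)"
    and bound: "\<And>vs p. p \<in> S \<Longrightarrow> \<exists>U M. open U \<and> p \<in> U \<and> U \<subseteq> S \<and> summable M \<and> (\<forall>j. \<forall>q\<in>U. norm (iterdir vs (g j) q) \<le> M j)"
  shows "smooth_on S (\<lambda>p. \<Sum>j. g j p)" "\<And>p vs. p \<in> S \<Longrightarrow> iterdir vs (\<lambda>p. \<Sum>j. g j p) p = (\<Sum>j. iterdir vs (g j) p)"
proof -
  have summ: "summable (\<lambda>j. iterdir vs (g j) p)" if "p \<in> S" for vs p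
    using bound[OF that, of vs] by (metis summable_comparison_test')
  have hd: "has_dirderiv (\<lambda>p. \<Sum>j. iterdir vs (g j) p) v (\<Sum>j. iterdir (v # vs) (g j) p) p" if p: "p \<in> S" for vs v p
  proof -
    obtain U M where U: "open U" "p \<in> U" "U \<subseteq> S" "summable M" "\<forall>j. \<forall>q\<in>U. norm (iterdir (v # vs) (g j) q) \<le> M j"
      using bound[OF p] by meson
    obtain e where e: "e > 0" "\<And>s t. \<bar>s\<bar> \<le> e \<Longrightarrow> \<bar>t\<bar> \<le> e \<Longrightarrow> p + s *\<^sub>R v + t *\<^sub>R v \<in> U"
      using small_parallelogram[OF U(1,2), of v v] by blast
    have eU: "p + t *\<^sub>R v \<in> U" if "\<bar>t\<bar> \<le> e" for t using e(2)[of t 0] e(1) that by simp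
    let ?I = "{-e<..<e}"
    have unif: "uniform_limit U (\<lambda>n q. \<Sum>j<n. iterdir (v # vs) (g j) q) (\<lambda>q. \<Sum>j. iterdir (v # vs) (g j) q) sequentially"
      by (rule Weierstrass_m_test[OF _ U(4)]) (use U(5) in auto)
    have "\<exists>h. \<forall>t\<in>?I. (\<lambda>j. iterdir vs (g j) (p + t *\<^sub>R v)) sums h t \<and>
       (h has_derivative (\<lambda>s. s *\<^sub>R (\<Sum>j. iterdir (v # vs) (g j) (p + t *\<^sub>R v)))) (at t within ?I)"
    proof (rule has_derivative_series)
      show "0 \<in> ?I" using e by simp
      show "(\<lambda>j. iterdir vs (g j) (p + 0 *\<^sub>R v)) sums (\<Sum>j. iterdir vs (g j) (p + 0 *\<^sub>R v))"
        using summ[OF p] by (simp add: summable_sums)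
      fix j t assume "t \<in> ?I"
      then have "p + t *\<^sub>R v \<in> S" using eU[of t] U(3) by auto
      then show "((\<lambda>t. iterdir vs (g j) (p + t *\<^sub>R v)) has_derivative (\<lambda>s. s *\<^sub>R iterdir (v # vs) (g j) (p + t *\<^sub>R v))) (at t within ?I)"
        using smooth_on_has_vderiv_line[OF g[of j], of p t v vs] by (auto simp: has_vector_derivative_def intro: has_derivative_at_withinI)
    next
      fix \<epsilon> :: real assume "\<epsilon> > 0"
      from uniform_limitD[OF unif this]
      show "\<forall>\<^sub>F n in sequentially. \<forall>t\<in>?I. \<forall>h. norm ((\<Sum>j<n. h *\<^sub>R iterdir (v # vs) (g j) (p + t *\<^sub>R v)) - h *\<^sub>R (\<Sum>j. iterdir (v # vs) (g j) (p + t *\<^sub>R v))) \<le> \<epsilon> * norm h"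
      proof eventually_elim
        case (elim n)
        show ?case
        proof (intro ballI allI)
          fix t and h :: real assume "t \<in> ?I"
          then have "p + t *\<^sub>R v \<in> U" using eU by auto
          then have "norm ((\<Sum>j<n. iterdir (v # vs) (g j) (p + t *\<^sub>R v)) - (\<Sum>j. iterdir (v # vs) (g j) (p + t *\<^sub>R v))) \<le> \<epsilon>"
            using elim by (force simp: dist_norm)
          then show "norm ((\<Sum>j<n. h *\<^sub>R iterdir (v # vs) (g j) (p + t *\<^sub>R v)) - h *\<^sub>R (\<Sum>j. iterdir (v # vs) (g j) (p + t *\<^sub>R v))) \<le> \<epsilon> * norm h"
            by (simp add: scaleR_sum_right[symmetric] scaleR_diff_right[symmetric] mult.commute[of \<epsilon>] mult_left_mono del: iterdir.simps)
        qed
      qed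
    qed simp
    then obtain h where h: "\<And>t. t \<in> ?I \<Longrightarrow> (\<lambda>j. iterdir vs (g j) (p + t *\<^sub>R v)) sums h t"
      "\<And>t. t \<in> ?I \<Longrightarrow> (h has_derivative (\<lambda>s. s *\<^sub>R (\<Sum>j. iterdir (v # vs) (g j) (p + t *\<^sub>R v)))) (at t within ?I)"
      by blast
    have "(h has_vector_derivative (\<Sum>j. iterdir (v # vs) (g j) p)) (at 0)"
      using h(2)[of 0] e at_within_open[of 0 ?I] by (simp add: has_vector_derivative_def)
    then show ?thesis unfolding has_dirderiv_def
      by (rule has_vector_derivative_transform_within_open[of _ _ _ ?I]) (use e h(1) in \<open>auto simp: sums_iff\<close>)
  qed
  show it: "iterdir vs (\<lambda>p. \<Sum>j. g j p) p = (\<Sum>j. iterdir vs (g j) p)" if "p \<in> S" for vs p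
    using that
  proof (induction vs arbitrary: p)
    case (Cons v vs)
    have "iterdir (v # vs) (\<lambda>p. \<Sum>j. g j p) p = dirderiv v (\<lambda>p. \<Sum>j. iterdir vs (g j) p) p"
      using dirderiv_cong[OF S Cons.prems Cons.IH] by simp
    also have "\<dots> = (\<Sum>j. iterdir (v # vs) (g j) p)" using dirderiv_eqI[OF hd[OF Cons.prems]] .
    finally show ?case .
  qed simp
  show "smooth_on S (\<lambda>p. \<Sum>j. g j p)"
  proof (rule smooth_onI)
    fix vs v p assume "p \<in> S"
    then show "\<exists>D. has_dirderiv (iterdir vs (\<lambda>p. \<Sum>j. g j p)) v D p"
      using has_dirderiv_cong[OF S _ it[symmetric] hd] by blast
  next
    fix vs
    have "continuous_on S (\<lambda>p. \<Sum>j. iterdir vs (g j) p)"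
    \<comment> \<open>Continuity is local: each point is given, by choice, a neighbourhood with
      uniform convergence, and these neighbourhoods cover \<open>S\<close>.\<close>
    proof (rule continuous_on_open_UN[of S "\<lambda>p. SOME U. open U \<and> p \<in> U \<and> U \<subseteq> S \<and> continuous_on U (\<lambda>p. \<Sum>j. iterdir vs (g j) p)", THEN continuous_on_subset])
      have ex: "\<exists>U. open U \<and> p \<in> U \<and> U \<subseteq> S \<and> continuous_on U (\<lambda>p. \<Sum>j. iterdir vs (g j) p)" if p: "p \<in> S" for p
      proof -
        obtain U M where U: "open U" "p \<in> U" "U \<subseteq> S" "summable M" "\<forall>j. \<forall>q\<in>U. norm (iterdir vs (g j) q) \<le> M j"
          using bound[OF p] by meson
        have unif: "uniform_limit U (\<lambda>n q. \<Sum>j<n. iterdir vs (g j) q) (\<lambda>q. \<Sum>j. iterdir vs (g j) q) sequentially"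
          by (rule Weierstrass_m_test[OF _ U(4)]) (use U(5) in auto)
        have "continuous_on U (\<lambda>p. \<Sum>j. iterdir vs (g j) p)"
          by (rule uniform_limit_theorem[OF _ unif])
             (auto intro!: always_eventually continuous_intros continuous_on_subset[OF smooth_on_continuous[OF g] U(3)])
        with U show ?thesis by blast
      qed
      note sm = someI_ex[OF ex]
      show "open (SOME U. open U \<and> p \<in> U \<and> U \<subseteq> S \<and> continuous_on U (\<lambda>p. \<Sum>j. iterdir vs (g j) p))"
        "continuous_on (SOME U. open U \<and> p \<in> U \<and> U \<subseteq> S \<and> continuous_on U (\<lambda>p. \<Sum>j. iterdir vs (g j) p)) (\<lambda>p. \<Sum>j. iterdir vs (g j) p)"
        if "p \<in> S" for p using sm[OF that] by blast+
      show "S \<subseteq> (\<Union>p\<in>S. SOME U. open U \<and> p \<in> U \<and> U \<subseteq> S \<and> continuous_on U (\<lambda>p. \<Sum>j. iterdir vs (g j) p))"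
        using sm by blast
    qed
    then show "continuous_on S (iterdir vs (\<lambda>p. \<Sum>j. g j p))"
      using it by (simp cong: continuous_on_cong)
  qed
qed

section \<open>Integration tools\<close>

interpretation lborel_family: product_sigma_finite "\<lambda>_. lborel :: real measure"
  by standard

text \<open>Lebesgue measure is the image of the product of one-dimensional measures under the
  coordinate map, so Fubini factors the integral. Both \<open>decay_weight\<close> and
  \<open>gaussian\<close> have this product form.\<close>

lemma
  fixes g :: "'a::euclidean_space \<Rightarrow> real \<Rightarrow> 'b::{real_normed_field,banach,second_countable_topology}"
  assumes g: "\<And>b. b \<in> Basis \<Longrightarrow> integrable lborel (g b)"
  shows integrable_lborel_prod_Basis: "integrable lborel (\<lambda>x. \<Prod>b\<in>Basis. g b (x \<bullet> b))" (is ?A)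
    and integral_lborel_prod_Basis: "(LINT x|lborel. (\<Prod>b\<in>Basis. g b (x \<bullet> b))) = (\<Prod>b\<in>Basis. LINT x|lborel. g b x)" (is ?B)
proof -
  let ?P = "\<Pi>\<^sub>M b\<in>(Basis :: 'a set). (lborel :: real measure)"
  let ?T = "\<lambda>f. \<Sum>b\<in>Basis. f b *\<^sub>R (b :: 'a)"
  have [measurable]: "g b \<in> borel_measurable borel" if "b \<in> Basis" for b
    using borel_measurable_integrable[OF g[OF that]] by simp
  have T: "?T \<in> measurable ?P borel"
    by measurable
  have m: "(\<lambda>x. \<Prod>b\<in>Basis. g b (x \<bullet> b)) \<in> borel_measurable (borel :: 'a measure)"
    by measurable
  have eq: "(\<Prod>b\<in>Basis. g b (?T f \<bullet> b)) = (\<Prod>b\<in>Basis. g b (f b))" for f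
    by (intro prod.cong refl arg_cong2[where f=g]) (simp add: inner_sum_left_Basis)
  show ?A
    by (subst lborel_eq, subst integrable_distr_eq[OF T m])
       (unfold eq, rule lborel_family.product_integrable_prod[OF finite_Basis g])
  show ?B
    by (subst lborel_eq, subst integral_distr[OF T m])
       (unfold eq, rule lborel_family.product_integral_prod[OF finite_Basis g])
qed

lemma
  fixes f :: "'a::euclidean_space \<Rightarrow> 'b::{banach,second_countable_topology}"
  assumes [measurable]: "f \<in> borel_measurable borel"
  shows integral_lborel_shift: "(LINT x|lborel. f (c + x)) = (LINT x|lborel. f x)"
    and integrable_lborel_shift: "integrable lborel (\<lambda>x. f (c + x)) \<longleftrightarrow> integrable lborel f"
proof -
  have "(LINT x|lborel. f x) = (LINT x|distr lborel borel ((+) c). f x)" by (simp only: lborel_distr_plus)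
  also have "\<dots> = (LINT x|lborel. f (c + x))" by (rule integral_distr) simp_all
  finally show "(LINT x|lborel. f (c + x)) = (LINT x|lborel. f x)" ..
  have "integrable lborel f \<longleftrightarrow> integrable (distr lborel borel ((+) c)) f" by (simp only: lborel_distr_plus)
  also have "\<dots> \<longleftrightarrow> integrable lborel (\<lambda>x. f (c + x))" by (rule integrable_distr_eq) simp_all
  finally show "integrable lborel (\<lambda>x. f (c + x)) \<longleftrightarrow> integrable lborel f" ..
qed

text \<open>A product over the coordinates, so that its integrability reduces to that of 1/(1 + t^2)
  on the line.\<close>

definition decay_weight :: "'a::euclidean_space \<Rightarrow> real" where
  "decay_weight x = (\<Prod>b\<in>Basis. inverse (1 + (x \<bullet> b)\<^sup>2))"

lemma decay_weight_pos: "decay_weight x > 0"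
  unfolding decay_weight_def by (intro prod_pos) (simp add: add_pos_nonneg)

lemma borel_measurable_decay_weight [measurable]: "decay_weight \<in> borel_measurable borel"
  unfolding decay_weight_def[abs_def] by measurable

lemma integrable_decay_weight: "integrable lborel (decay_weight :: 'a::euclidean_space \<Rightarrow> real)"
proof -
  have "integrable lborel (\<lambda>x::real. inverse (1 + x\<^sup>2))"
    using integrable_inverse_1_plus_square by (simp add: set_integrable_def einterval_def)
  then show ?thesis
    unfolding decay_weight_def[abs_def] by (intro integrable_lborel_prod_Basis) auto
qed

text \<open>With \<open>m\<close> the coordinate of largest modulus, each factor 1 + x_b^2 is at
  most 2 max(1, |x_m|)^2. Hence bounding powers of one coordinate at a time is enough, and no mixed
  monomials have to be controlled.\<close>

lemma norm_le_decay_weight: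
  fixes x :: "'a::euclidean_space" and z :: "'b::real_normed_vector"
  assumes "norm z \<le> C" "\<And>b. b \<in> Basis \<Longrightarrow> \<bar>x \<bullet> b\<bar> ^ (2 * DIM('a)) * norm z \<le> C"
  shows "norm z \<le> 2 ^ DIM('a) * C * decay_weight x"
proof -
  obtain m :: 'a where m: "m \<in> Basis" "\<And>b. b \<in> Basis \<Longrightarrow> \<bar>x \<bullet> b\<bar> \<le> \<bar>x \<bullet> m\<bar>"
  proof -
    have "Max ((\<lambda>b. \<bar>x \<bullet> b\<bar>) ` Basis) \<in> (\<lambda>b. \<bar>x \<bullet> b\<bar>) ` (Basis :: 'a set)" by (rule Max_in) auto
    then obtain m :: 'a where "m \<in> Basis" "Max ((\<lambda>b. \<bar>x \<bullet> b\<bar>) ` Basis) = \<bar>x \<bullet> m\<bar>" by (rule imageE) blast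
    then show ?thesis using that[of m] Max_ge[of "(\<lambda>b. \<bar>x \<bullet> b\<bar>) ` (Basis :: 'a set)"] by auto
  qed
  let ?M = "max 1 \<bar>x \<bullet> m\<bar>"
  have "(\<Prod>b\<in>Basis. 1 + (x \<bullet> b)\<^sup>2) \<le> (\<Prod>b\<in>(Basis :: 'a set). 2 * ?M\<^sup>2)"
  proof (rule prod_mono)
    fix b :: 'a assume b: "b \<in> Basis"
    have "(x \<bullet> b)\<^sup>2 \<le> ?M\<^sup>2" using m(2)[OF b] by (metis abs_le_square_iff abs_of_pos le_max_iff_disj less_max_iff_disj zero_less_one)
    moreover have "1 \<le> ?M\<^sup>2" by (simp add: one_le_power)
    ultimately have "1 + (x \<bullet> b)\<^sup>2 \<le> ?M\<^sup>2 + ?M\<^sup>2" by (rule add_mono[rotated])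
    then show "0 \<le> 1 + (x \<bullet> b)\<^sup>2 \<and> 1 + (x \<bullet> b)\<^sup>2 \<le> 2 * ?M\<^sup>2" by simp
  qed
  also have "\<dots> = 2 ^ DIM('a) * ?M ^ (2 * DIM('a))" by (simp add: power_mult_distrib power_mult)
  finally have le: "(\<Prod>b\<in>Basis. 1 + (x \<bullet> b)\<^sup>2) \<le> 2 ^ DIM('a) * ?M ^ (2 * DIM('a))" .
  have "?M ^ (2 * DIM('a)) * norm z \<le> C"
    using assms(1) assms(2)[OF m(1)] by (simp add: max_def)
  then have "2 ^ DIM('a) * ?M ^ (2 * DIM('a)) * norm z \<le> 2 ^ DIM('a) * C" by simp
  moreover have "(\<Prod>b\<in>Basis. 1 + (x \<bullet> b)\<^sup>2) * norm z \<le> 2 ^ DIM('a) * ?M ^ (2 * DIM('a)) * norm z"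
    using le by (rule mult_right_mono) simp
  ultimately have "(\<Prod>b\<in>Basis. 1 + (x \<bullet> b)\<^sup>2) * norm z \<le> 2 ^ DIM('a) * C" by (rule order_trans[rotated])
  moreover have "decay_weight x * (\<Prod>b\<in>Basis. 1 + (x \<bullet> b)\<^sup>2) = 1"
    unfolding decay_weight_def prod.distrib[symmetric]
    by (intro prod.neutral ballI left_inverse) (smt (verit) zero_le_power2)
  ultimately show ?thesis
    using decay_weight_pos[of x] mult_left_mono[of "(\<Prod>b\<in>Basis. 1 + (x \<bullet> b)\<^sup>2) * norm z" "2 ^ DIM('a) * C" "decay_weight x"]
    by (simp add: mult.assoc[symmetric]) (simp add: mult_ac)
qed

text \<open>Dominated convergence is applied to the remainder \<open>r\<close> of the difference
  quotient instead of the quotient itself, which matches the definition of the derivative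
  directly.\<close>

lemma has_vector_derivative_lborel_integral:
  fixes h h' :: "real \<Rightarrow> 'a::euclidean_space \<Rightarrow> 'b::{banach,second_countable_topology}"
  assumes der: "\<And>t x. ((\<lambda>t. h t x) has_vector_derivative h' t x) (at t)"
    and int: "\<And>t. integrable lborel (h t)"
    and meas: "h' 0 \<in> borel_measurable borel"
    and bound: "\<And>t x. norm (h' t x) \<le> g x" and g: "integrable lborel g"
  shows "((\<lambda>t. LINT x|lborel. h t x) has_vector_derivative (LINT x|lborel. h' 0 x)) (at 0)"
proof -
  have int': "integrable lborel (h' 0)"
    by (rule Bochner_Integration.integrable_bound[OF g]) (use meas bound in \<open>auto intro!: AE_I2 order_trans[OF _ abs_ge_self]\<close>)
  define r where "r s x = norm (h s x - h 0 x - s *\<^sub>R h' 0 x) / \<bar>s\<bar>" for s x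
  \<comment> \<open>The mean value inequality for the function minus its linear part: its derivative
    \<open>h' t x - h' 0 x\<close> has norm at most \<open>2 * g x\<close>.\<close>
  have rle: "r s x \<le> 2 * g x" for s x
  proof -
    have "norm (h s x - h 0 x - (s - 0) *\<^sub>R h' 0 x) \<le> norm (s - 0) * (2 * g x)"
    proof (rule vector_differentiable_bound_linearization[where S=UNIV])
      fix t show "norm (h' t x - h' 0 x) \<le> 2 * g x"
        using norm_triangle_ineq4[of "h' t x" "h' 0 x"] bound[of t x] bound[of 0 x] by linarith
    qed (use der in auto)
    then show ?thesis
      using order_trans[OF norm_ge_zero bound[of 0 x]] by (cases "s = 0") (auto simp: r_def divide_le_eq mult.commute)
  qed
  have hm [measurable]: "h t \<in> borel_measurable borel" for t
    using borel_measurable_integrable[OF int] by simp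
  note meas[measurable]
  have rm [measurable]: "r s \<in> borel_measurable borel" for s
    unfolding r_def[abs_def] by measurable
  have lim: "((\<lambda>s. LINT x|lborel. r s x) \<longlongrightarrow> 0) (at (0::real))"
    unfolding tendsto_at_iff_sequentially
  proof (intro allI impI)
    fix X :: "nat \<Rightarrow> real" assume X: "\<forall>i. X i \<in> UNIV - {0}" "X \<longlonglongrightarrow> 0"
    have "(\<lambda>i. LINT x|lborel. r (X i) x) \<longlonglongrightarrow> (LINT x|(lborel :: 'a measure). (0 :: real))"
    proof (rule integral_dominated_convergence[where w="\<lambda>x. 2 * g x"])
      show "AE x in lborel. (\<lambda>i. r (X i) x) \<longlonglongrightarrow> 0"
      proof (rule AE_I2)
        fix x
        have "((\<lambda>s. r s x) \<longlongrightarrow> 0) (at 0)"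
          using der[of x 0] unfolding has_vector_derivative_def has_derivative_at r_def by (auto simp: mult.commute)
        then show "(\<lambda>i. r (X i) x) \<longlonglongrightarrow> 0"
          using X unfolding tendsto_at_iff_sequentially by (auto simp: o_def)
      qed
      show "AE x in lborel. norm (r (X i) x) \<le> 2 * g x" for i
        using rle by (auto simp: r_def)
    qed (use g in auto)
    then show "((\<lambda>s. LINT x|lborel. r s x) \<circ> X) \<longlonglongrightarrow> 0" by (simp add: o_def)
  qed
  have "(\<lambda>s. norm ((LINT x|lborel. h (0 + s) x) - (LINT x|lborel. h 0 x) - s *\<^sub>R (LINT x|lborel. h' 0 x)) / norm s) \<midarrow>0\<rightarrow> 0"
  proof (rule tendsto_sandwich[OF _ _ tendsto_const])
    show "(\<lambda>s. LINT x|lborel. r s x) \<midarrow>0\<rightarrow> 0" by (rule lim)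
    show "\<forall>\<^sub>F s in at 0. 0 \<le> norm ((LINT x|lborel. h (0 + s) x) - (LINT x|lborel. h 0 x) - s *\<^sub>R (LINT x|lborel. h' 0 x)) / norm s"
      by simp
    show "\<forall>\<^sub>F s in at 0. norm ((LINT x|lborel. h (0 + s) x) - (LINT x|lborel. h 0 x) - s *\<^sub>R (LINT x|lborel. h' 0 x)) / norm s \<le> (LINT x|lborel. r s x)"
    proof (rule always_eventually, rule allI)
      fix s
      have "(LINT x|lborel. h (0 + s) x) - (LINT x|lborel. h 0 x) - s *\<^sub>R (LINT x|lborel. h' 0 x)
          = (LINT x|lborel. h s x - h 0 x - s *\<^sub>R h' 0 x)"
        using int int' by simp
      moreover have "norm \<dots> \<le> (LINT x|lborel. norm (h s x - h 0 x - s *\<^sub>R h' 0 x))"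
        by (rule integral_norm_bound)
      moreover have "(LINT x|lborel. r s x) = (LINT x|lborel. norm (h s x - h 0 x - s *\<^sub>R h' 0 x)) / \<bar>s\<bar>"
        unfolding r_def by simp
      ultimately show "norm ((LINT x|lborel. h (0 + s) x) - (LINT x|lborel. h 0 x) - s *\<^sub>R (LINT x|lborel. h' 0 x)) / norm s \<le> (LINT x|lborel. r s x)"
        by (simp add: divide_right_mono)
    qed
  qed
  then show ?thesis
    unfolding has_vector_derivative_def has_derivative_at by (simp add: bounded_linear_scaleR_left)
qed

text \<open>The integral of \<open>g (x + v) - g x\<close> vanishes by translation invariance; it is the integral of
  the derivative over the unit segment.\<close>

lemma integral_dirderiv_eq_0:
  fixes g g' :: "'a::euclidean_space \<Rightarrow> complex"
  assumes der: "\<And>x. has_dirderiv g v (g' x) x" and cont: "continuous_on UNIV g'"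
    and g: "integrable lborel g" and g': "integrable lborel g'"
  shows "(LINT x|lborel. g' x) = 0"
proof -
  have [measurable]: "g \<in> borel_measurable borel" "g' \<in> borel_measurable borel"
    using borel_measurable_integrable[OF g] borel_measurable_integrable[OF g'] by auto
  define f where "f s x = indicator {0..1::real} s *\<^sub>R g' (s *\<^sub>R v + x)" for s x
  have [measurable]: "case_prod f \<in> borel_measurable (lborel \<Otimes>\<^sub>M lborel)"
    unfolding f_def[abs_def] by measurable
  have nint: "(LINT x|lborel. norm (f s x)) = indicator {0..1} s * (LINT x|lborel. norm (g' x))" for s
    using integral_lborel_shift[of "\<lambda>x. norm (g' x)" "s *\<^sub>R v"] by (simp add: f_def)
  have "integrable (lborel \<Otimes>\<^sub>M lborel) (case_prod f)"
  proof (rule lborel_pair.Fubini_integrable)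
    show "integrable lborel (\<lambda>s. LINT x|lborel. norm (case (s, x) of (s, x) \<Rightarrow> f s x))"
      unfolding prod.case nint by (intro integrable_mult_left) simp
    show "AE s in lborel. integrable lborel (\<lambda>x. case (s, x) of (s, x) \<Rightarrow> f s x)"
      using g' by (simp add: f_def integrable_lborel_shift)
  qed simp
  note lborel_pair.Fubini_integral[OF this]
  also have "(LINT s|lborel. LINT x|lborel. f s x) = (LINT s|lborel. indicator {0..1::real} s *\<^sub>R (LINT x|lborel. g' x))"
    by (simp add: f_def integral_lborel_shift)
  also have "\<dots> = (LINT x|lborel. g' x)"
    by simp
  finally have *: "(LINT x|lborel. LINT s|lborel. f s x) = (LINT x|lborel. g' x)" .
  have "(LINT s|lborel. f s x) = g (v + x) - g x" for x
  proof -
    have "((\<lambda>s. g' (x + s *\<^sub>R v)) has_integral g (x + 1 *\<^sub>R v) - g (x + 0 *\<^sub>R v)) {0..1}"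
      by (rule fundamental_theorem_of_calculus) (auto intro!: has_vector_derivative_at_within has_dirderiv_line der)
    moreover have "set_integrable lborel {0..1} (\<lambda>s. g' (x + s *\<^sub>R v))"
      by (rule borel_integrable_atLeastAtMost'[unfolded set_integrable_def[symmetric]])
         (auto intro!: continuous_on_compose2[OF cont] continuous_intros)
    ultimately have "(LINT s:{0..1}|lborel. g' (x + s *\<^sub>R v)) = g (x + 1 *\<^sub>R v) - g (x + 0 *\<^sub>R v)"
      by (metis set_borel_integral_eq_integral(2) integral_unique)
    then show ?thesis by (simp add: f_def set_lebesgue_integral_def add.commute)
  qed
  then have "(LINT x|lborel. g' x) = (LINT x|lborel. g (v + x) - g x)" using * by simp
  also have "\<dots> = (LINT x|lborel. g (v + x)) - (LINT x|lborel. g x)"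
    by (intro Bochner_Integration.integral_diff g) (simp add: integrable_lborel_shift g)
  also have "\<dots> = 0" by (simp add: integral_lborel_shift)
  finally show ?thesis .
qed

text \<open>One oscillating factor for both transforms: \<tau> = 2 pi and \<tau> = -2 pi. It depends
  only on the inner product, so its two arguments may be exchanged.\<close>

definition osc :: "real \<Rightarrow> 'a::real_inner \<Rightarrow> 'a \<Rightarrow> complex" where
  "osc \<tau> u x = cis (\<tau> * (u \<bullet> x))"

lemma norm_osc [simp]: "norm (osc \<tau> u x) = 1"
  by (simp add: osc_def)

lemma osc_has_dirderiv: "has_dirderiv (osc \<tau> u) v (\<i> * of_real (\<tau> * (u \<bullet> v)) * osc \<tau> u x) x"
proof -
  have "((\<lambda>t. cis (\<tau> * (u \<bullet> x) + t * (\<tau> * (u \<bullet> v)))) has_vector_derivative (\<tau> * (u \<bullet> v)) *\<^sub>R (\<i> * cis (\<tau> * (u \<bullet> x) + 0 * (\<tau> * (u \<bullet> v))))) (at 0)"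
  proof -
    define a b where "a = \<tau> * (u \<bullet> x)" and "b = \<tau> * (u \<bullet> v)"
    have "((\<lambda>z. exp (\<i> * (of_real a + z * of_real b))) has_field_derivative b *\<^sub>R (\<i> * exp (\<i> * (of_real a + of_real 0 * of_real b)))) (at (of_real 0))"
      by (auto intro!: derivative_eq_intros simp: scaleR_conv_of_real)
    from has_vector_derivative_real_field[OF this] show ?thesis
      by (simp add: cis_conv_exp a_def b_def)
  qed
  then show ?thesis
    unfolding has_dirderiv_def osc_def
    by (simp add: inner_add_right algebra_simps scaleR_conv_of_real)
qed

lemma continuous_osc [continuous_intros]:
  "continuous_on S f \<Longrightarrow> continuous_on S g \<Longrightarrow> continuous_on S (\<lambda>x. osc \<tau> (f x) (g x))"
  unfolding osc_def by (intro continuous_intros)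

lemma borel_measurable_osc [measurable]:
  fixes f g :: "'b \<Rightarrow> 'a::euclidean_space"
  assumes [measurable]: "f \<in> borel_measurable M" "g \<in> borel_measurable M"
  shows "(\<lambda>x. osc \<tau> (f x) (g x)) \<in> borel_measurable M"
  unfolding osc_def cis_conv_exp by measurable

section \<open>Linear substitutions and Fourier inversion\<close>

lemma Basis_cart: "(Basis :: (real^'n) set) = range (\<lambda>i. axis i 1)"
  by (auto simp: Basis_vec_def)

lemma inj_axis_1: "inj (\<lambda>i. axis i (1::real))"
  by (auto simp: inj_def axis_eq_axis)

lemma sum_Basis_cart: "(\<Sum>b\<in>(Basis :: (real^'n) set). h b) = (\<Sum>i\<in>UNIV. h (axis i 1))"
  by (simp add: Basis_cart sum.reindex[OF inj_axis_1])

lemma prod_Basis_cart: "(\<Prod>b\<in>(Basis :: (real^'n) set). h b) = (\<Prod>i\<in>UNIV. h (axis i 1))"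
  by (simp add: Basis_cart prod.reindex[OF inj_axis_1])

lemma borel_measurable_vec_lambda:
  fixes f :: "'a \<Rightarrow> 'n::finite \<Rightarrow> real"
  assumes "\<And>i. (\<lambda>x. f x i) \<in> borel_measurable M"
  shows "(\<lambda>x. \<chi> i. f x i) \<in> borel_measurable M"
  using assms by (subst borel_measurable_euclidean_space) (auto simp: Basis_cart inner_axis)

lemma integrable_scaleR_right_iff:
  fixes f :: "'a \<Rightarrow> 'b::{banach,second_countable_topology}"
  assumes "c \<noteq> 0"
  shows "integrable M (\<lambda>x. c *\<^sub>R f x) \<longleftrightarrow> integrable M f"
  using integrable_scaleR_right[of "inverse c" M "\<lambda>x. c *\<^sub>R f x"] assms by auto

text \<open>Indexes the product by the coordinates themselves rather than by basis vectors, so that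
  a single coordinate can be split off for Fubini.\<close>

lemma lborel_cart: "(lborel :: (real^'n) measure) = distr (\<Pi>\<^sub>M i\<in>UNIV. lborel) borel (\<lambda>f. \<chi> i. f i)"
proof (rule lborel_eqI)
  have [measurable]: "(\<lambda>f. \<chi> i. f i) \<in> measurable (\<Pi>\<^sub>M i\<in>(UNIV :: 'n set). lborel) (borel :: (real^'n) measure)"
    by (rule borel_measurable_vec_lambda) measurable
  fix l u :: "real^'n" assume le: "\<And>b. b \<in> Basis \<Longrightarrow> l \<bullet> b \<le> u \<bullet> b"
  then have le': "l $ i \<le> u $ i" for i using le[of "axis i 1"] by (auto simp: Basis_cart inner_axis)
  have vim: "(\<lambda>f. \<chi> i. f i) -` box l u \<inter> space (\<Pi>\<^sub>M i\<in>(UNIV :: 'n set). lborel) = (\<Pi>\<^sub>E i\<in>UNIV. {l $ i<..<u $ i})"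
    by (auto simp: mem_box_cart space_PiM PiE_iff)
  have "emeasure (distr (\<Pi>\<^sub>M i\<in>UNIV. lborel) borel (\<lambda>f. \<chi> i. f i)) (box l u) = (\<Prod>i\<in>UNIV. emeasure lborel {l $ i<..<u $ i})"
    by (subst emeasure_distr) (auto simp: vim intro!: lborel_family.emeasure_PiM)
  also have "\<dots> = (\<Prod>b\<in>Basis. (u - l) \<bullet> b)"
    using le' by (simp add: prod_Basis_cart inner_axis prod_ennreal)
  finally show "emeasure (distr (\<Pi>\<^sub>M i\<in>UNIV. lborel) borel (\<lambda>f. \<chi> i. f i)) (box l u) = (\<Prod>b\<in>Basis. (u - l) \<bullet> b)" .
qed simp

text \<open>With all coordinates other than \<open>m\<close> fixed, the shear is a translation in
  coordinate \<open>m\<close>, which preserves one-dimensional Lebesgue measure.\<close>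

lemma nn_integral_shear:
  fixes g :: "real^'n \<Rightarrow> ennreal"
  assumes "m \<noteq> n" and [measurable]: "g \<in> borel_measurable borel"
  shows "(\<integral>\<^sup>+x. g (\<chi> i. if i = m then x $ m + x $ n else x $ i) \<partial>lborel) = (\<integral>\<^sup>+x. g x \<partial>lborel)"
proof -
  let ?h = "\<lambda>x::real^'n. \<chi> i. if i = m then x $ m + x $ n else x $ i"
  let ?I = "UNIV - {m}"
  have U: "(UNIV :: 'n set) = insert m ?I" by auto
  have v [measurable]: "(\<lambda>f. \<chi> i. f i) \<in> measurable (\<Pi>\<^sub>M i\<in>(UNIV :: 'n set). lborel) (borel :: (real^'n) measure)"
    by (rule borel_measurable_vec_lambda) measurable
  have h [measurable]: "?h \<in> borel_measurable borel"
    by (rule borel_measurable_vec_lambda) measurable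
  have ins: "(\<integral>\<^sup>+f. G f \<partial>(\<Pi>\<^sub>M i\<in>(UNIV :: 'n set). lborel)) = (\<integral>\<^sup>+x. (\<integral>\<^sup>+y. G (x(m := y)) \<partial>lborel) \<partial>(\<Pi>\<^sub>M i\<in>?I. lborel))"
    if "G \<in> borel_measurable (\<Pi>\<^sub>M i\<in>(UNIV :: 'n set). lborel)" for G :: "('n \<Rightarrow> real) \<Rightarrow> ennreal"
    using lborel_family.product_nn_integral_insert[of ?I m G] that U by simp
  have "(\<integral>\<^sup>+x. g (?h x) \<partial>lborel) = (\<integral>\<^sup>+f. g (?h (\<chi> i. f i)) \<partial>(\<Pi>\<^sub>M i\<in>UNIV. lborel))"
    by (subst lborel_cart, subst nn_integral_distr) auto
  also have "\<dots> = (\<integral>\<^sup>+x. (\<integral>\<^sup>+y. g (?h (\<chi> i. (x(m := y)) i)) \<partial>lborel) \<partial>(\<Pi>\<^sub>M i\<in>?I. lborel))"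
    by (rule ins) measurable
  also have "\<dots> = (\<integral>\<^sup>+x. (\<integral>\<^sup>+y. g (\<chi> i. (x(m := y)) i) \<partial>lborel) \<partial>(\<Pi>\<^sub>M i\<in>?I. lborel))"
  proof (rule nn_integral_cong)
    fix x assume "x \<in> space (\<Pi>\<^sub>M i\<in>?I. (lborel :: real measure))"
    then have x: "x \<in> space (\<Pi>\<^sub>M i\<in>?I. (lborel :: real measure))" .
    have m1: "(\<lambda>y. g (\<chi> i. (x(m := y)) i)) \<in> borel_measurable borel"
    proof -
      have "(\<lambda>y. \<chi> i. (x(m := y)) i) \<in> borel_measurable (borel :: real measure)"
        by (rule borel_measurable_vec_lambda) (auto simp: fun_upd_def)
      then show ?thesis by measurable
    qed
    have eq: "?h (\<chi> i. (x(m := y)) i) = (\<chi> i. (x(m := x n + 1 * y)) i)" for y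
      using \<open>m \<noteq> n\<close> by (auto simp: vec_eq_iff)
    show "(\<integral>\<^sup>+y. g (?h (\<chi> i. (x(m := y)) i)) \<partial>lborel) = (\<integral>\<^sup>+y. g (\<chi> i. (x(m := y)) i) \<partial>lborel)"
      unfolding eq using nn_integral_real_affine[OF m1, of 1 "x n"] by (simp add: fun_upd_def)
  qed
  also have "\<dots> = (\<integral>\<^sup>+f. g (\<chi> i. f i) \<partial>(\<Pi>\<^sub>M i\<in>UNIV. lborel))"
    by (rule ins[symmetric]) measurable
  also have "\<dots> = (\<integral>\<^sup>+x. g x \<partial>lborel)"
    by (subst lborel_cart, subst nn_integral_distr) auto
  finally show ?thesis .
qed

lemma nn_integral_permute_coords:
  fixes g :: "real^'n \<Rightarrow> ennreal"
  assumes p: "p permutes UNIV" and [measurable]: "g \<in> borel_measurable borel"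
  shows "(\<integral>\<^sup>+x. g (\<chi> i. x $ p i) \<partial>lborel) = (\<integral>\<^sup>+x. g x \<partial>lborel)"
proof -
  let ?h = "\<lambda>x::real^'n. \<chi> i. x $ p i"
  have h [measurable]: "?h \<in> borel_measurable borel"
    by (rule borel_measurable_vec_lambda) measurable
  have "lborel = distr lborel borel ?h"
  proof (rule lborel_eqI)
    fix l u :: "real^'n" assume le: "\<And>b. b \<in> Basis \<Longrightarrow> l \<bullet> b \<le> u \<bullet> b"
    then have le': "l $ i \<le> u $ i" for i using le[of "axis i 1"] by (auto simp: Basis_cart inner_axis)
    let ?q = "inv p"
    have pq: "p (?q i) = i" "?q (p i) = i" for i using permutes_inverses[OF p] by auto
    have vim: "?h -` box l u = box (\<chi> i. l $ ?q i) (\<chi> i. u $ ?q i)"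
      by (auto simp: mem_box_cart) (metis pq)+
    have "emeasure lborel (box (\<chi> i. l $ ?q i) (\<chi> i. u $ ?q i)) = (\<Prod>b\<in>Basis. ((\<chi> i. u $ ?q i) - (\<chi> i. l $ ?q i)) \<bullet> b)"
      by (rule emeasure_lborel_box) (use le' in \<open>auto simp: Basis_cart inner_axis\<close>)
    then have "emeasure (distr lborel borel ?h) (box l u) = (\<Prod>i\<in>UNIV. u $ ?q i - l $ ?q i)"
      by (subst emeasure_distr) (simp_all add: vim prod_Basis_cart inner_axis)
    also have "(\<Prod>i\<in>UNIV. u $ ?q i - l $ ?q i) = (\<Prod>i\<in>UNIV. u $ i - l $ i)"
      using prod.permute[OF permutes_inv[OF p], of "\<lambda>i. u $ i - l $ i"] by (simp add: o_def)
    finally show "emeasure (distr lborel borel ?h) (box l u) = (\<Prod>b\<in>Basis. (u - l) \<bullet> b)"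
      by (simp add: prod_Basis_cart inner_axis)
  qed simp
  then have "(\<integral>\<^sup>+x. g x \<partial>lborel) = (\<integral>\<^sup>+x. g x \<partial>distr lborel borel ?h)" by simp
  then show ?thesis by (simp add: nn_integral_distr)
qed

lemma nn_integral_stretch_coords:
  fixes g :: "real^'n \<Rightarrow> ennreal"
  assumes c: "\<And>i. c i \<noteq> 0" and [measurable]: "g \<in> borel_measurable borel"
  shows "ennreal \<bar>\<Prod>i\<in>UNIV. c i\<bar> * (\<integral>\<^sup>+x. g (\<chi> i. c i * x $ i) \<partial>lborel) = (\<integral>\<^sup>+x. g x \<partial>lborel)"
proof -
  define d where "d b = (\<chi> i. c i) \<bullet> b" for b :: "real^'n"
  have d: "d (axis i 1) = c i" for i by (simp add: d_def inner_axis)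
  have T: "(0 + (\<Sum>j\<in>Basis. (d j * (x \<bullet> j)) *\<^sub>R j)) = (\<chi> i. c i * x $ i)" for x
  proof -
    have "(\<Sum>j\<in>Basis. (d j * (x \<bullet> j)) *\<^sub>R j) = (\<Sum>i\<in>UNIV. (c i * x $ i) *\<^sub>R axis i 1)"
      by (simp add: sum_Basis_cart d inner_axis)
    then show ?thesis by (simp add: vec_eq_iff axis_def if_distrib cong: if_cong)
  qed
  have h [measurable]: "(\<lambda>x::real^'n. \<chi> i. c i * x $ i) \<in> borel_measurable borel"
    by (rule borel_measurable_vec_lambda) measurable
  have lb: "lborel = density (distr lborel borel (\<lambda>x. \<chi> i. c i * x $ i)) (\<lambda>_. \<bar>\<Prod>i\<in>UNIV. c i\<bar>)"
  proof -
    have "lborel = density (distr lborel borel (\<lambda>x. 0 + (\<Sum>j\<in>Basis. (d j * (x \<bullet> j)) *\<^sub>R j))) (\<lambda>_. (\<Prod>j\<in>Basis. \<bar>d j\<bar>))"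
      by (rule lborel_affine_euclidean) (auto simp: Basis_cart d c)
    then show ?thesis unfolding T by (simp add: prod_Basis_cart d abs_prod)
  qed
  show ?thesis
    by (subst (2) lb) (simp add: nn_integral_density nn_integral_distr nn_integral_cmult)
qed

text \<open>Both the determinant and the scaling factor are multiplicative under composition, so
  only elementary maps need to be checked. Nonnegative integrals keep integrability out of the
  induction.\<close>

lemma nn_integral_lborel_linear:
  fixes f :: "real^'n \<Rightarrow> real^'n" and g :: "real^'n \<Rightarrow> ennreal"
  assumes "linear f" "det (matrix f) \<noteq> 0" "g \<in> borel_measurable borel"
  shows "ennreal \<bar>det (matrix f)\<bar> * (\<integral>\<^sup>+x. g (f x) \<partial>lborel) = (\<integral>\<^sup>+x. g x \<partial>lborel)"
proof -
  have "det (matrix f) \<noteq> 0 \<longrightarrow> (\<forall>g\<in>borel_measurable borel. ennreal \<bar>det (matrix f)\<bar> * (\<integral>\<^sup>+x. g (f x) \<partial>lborel) = (\<integral>\<^sup>+x. g x \<partial>lborel))"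
  proof (rule induct_linear_elementary[OF assms(1)]; intro impI ballI)
    fix f h :: "real^'n \<Rightarrow> real^'n" and g :: "real^'n \<Rightarrow> ennreal"
    assume lin: "linear f" "linear h"
      and f: "det (matrix f) \<noteq> 0 \<longrightarrow> (\<forall>g\<in>borel_measurable borel. ennreal \<bar>det (matrix f)\<bar> * (\<integral>\<^sup>+x. g (f x) \<partial>lborel) = (\<integral>\<^sup>+x. g x \<partial>lborel))"
      and h: "det (matrix h) \<noteq> 0 \<longrightarrow> (\<forall>g\<in>borel_measurable borel. ennreal \<bar>det (matrix h)\<bar> * (\<integral>\<^sup>+x. g (h x) \<partial>lborel) = (\<integral>\<^sup>+x. g x \<partial>lborel))"
      and nz: "det (matrix (f \<circ> h)) \<noteq> 0" and [measurable]: "g \<in> borel_measurable borel"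
    have det: "det (matrix (f \<circ> h)) = det (matrix f) * det (matrix h)"
      using matrix_compose[OF lin(2,1)] by (simp add: det_mul)
    have [measurable]: "f \<in> borel_measurable borel"
      using lin by (intro borel_measurable_continuous_onI linear_continuous_on linear_conv_bounded_linear[THEN iffD1])
    have "(\<lambda>x. g (f x)) \<in> borel_measurable borel" by measurable
    from h[rule_format, OF _ this] f[rule_format, OF _ \<open>g \<in> borel_measurable borel\<close>] nz det show "ennreal \<bar>det (matrix (f \<circ> h))\<bar> * (\<integral>\<^sup>+x. g ((f \<circ> h) x) \<partial>lborel) = (\<integral>\<^sup>+x. g x \<partial>lborel)"
      by (simp add: abs_mult ennreal_mult mult.assoc)
  next
    fix f :: "real^'n \<Rightarrow> real^'n" and i and g :: "real^'n \<Rightarrow> ennreal"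
    assume lin: "linear f" and 0: "\<And>x. f x $ i = 0" and "det (matrix f) \<noteq> 0"
    \<comment> \<open>A map with one coordinate identically 0 is not onto, so this elementary case
      contradicts the nonzero determinant.\<close>
    then have "surj f"
      using det_nz_iff_inj linear_injective_imp_surjective by blast
    then obtain x where "f x = axis i 1" by (metis surjD)
    with 0[of x] have False by (simp add: axis_def)
    then show "ennreal \<bar>det (matrix f)\<bar> * (\<integral>\<^sup>+x. g (f x) \<partial>lborel) = (\<integral>\<^sup>+x. g x \<partial>lborel)" ..
  next
    fix c :: "'n \<Rightarrow> real" and g :: "real^'n \<Rightarrow> ennreal"
    let ?h = "\<lambda>x::real^'n. \<chi> i. c i * x $ i"
    assume nz: "det (matrix ?h) \<noteq> 0" and g: "g \<in> borel_measurable borel"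
    have det: "det (matrix ?h) = (\<Prod>i\<in>UNIV. c i)"
      by (subst det_diagonal) (auto simp: matrix_def axis_def)
    with nz have "c i \<noteq> 0" for i by auto
    from nn_integral_stretch_coords[OF this g] det
    show "ennreal \<bar>det (matrix ?h)\<bar> * (\<integral>\<^sup>+x. g (?h x) \<partial>lborel) = (\<integral>\<^sup>+x. g x \<partial>lborel)" by simp
  next
    fix m n :: 'n and g :: "real^'n \<Rightarrow> ennreal"
    let ?p = "Transposition.transpose m n"
    let ?h = "\<lambda>x::real^'n. \<chi> i. x $ ?p i"
    assume g: "g \<in> borel_measurable borel"
    have p: "?p permutes UNIV" by (rule permutes_swap_id) auto
    have "matrix ?h = (\<chi> i. (mat 1 :: real^'n^'n) $ ?p i)"
      by (auto simp: vec_eq_iff matrix_def axis_def mat_def)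
    then have "\<bar>det (matrix ?h)\<bar> = 1"
      using det_permute_rows[OF p, of "mat 1 :: real^'n^'n"] by (simp add: sign_def)
    then show "ennreal \<bar>det (matrix ?h)\<bar> * (\<integral>\<^sup>+x. g (?h x) \<partial>lborel) = (\<integral>\<^sup>+x. g x \<partial>lborel)"
      using nn_integral_permute_coords[OF p g] by simp
  next
    fix m n :: 'n and g :: "real^'n \<Rightarrow> ennreal"
    let ?h = "\<lambda>x::real^'n. \<chi> i. if i = m then x $ m + x $ n else x $ i"
    assume mn: "m \<noteq> n" and g: "g \<in> borel_measurable borel"
    have "matrix ?h = (\<chi> k. if k = m then row m (mat 1) + 1 *s row n (mat 1) else row k (mat 1))"
      by (auto simp: vec_eq_iff matrix_def axis_def mat_def row_def)
    then have "det (matrix ?h) = 1"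
      using det_row_operation[OF mn, of "mat 1 :: real^'n^'n" 1] by simp
    then show "ennreal \<bar>det (matrix ?h)\<bar> * (\<integral>\<^sup>+x. g (?h x) \<partial>lborel) = (\<integral>\<^sup>+x. g x \<partial>lborel)"
      using nn_integral_shear[OF mn g] by simp
  qed
  with assms show ?thesis by blast
qed

text \<open>The nonnegative formula, applied to indicators, identifies Lebesgue measure with a
  constant multiple of its image under \<open>A\<close>; vector-valued integrals then follow from
  this equality of measures.\<close>

lemma
  fixes A :: "real^'n^'n" and g :: "real^'n \<Rightarrow> 'b::{banach,second_countable_topology}"
  assumes A: "det A \<noteq> 0" and g [measurable]: "g \<in> borel_measurable borel"
  shows integral_lborel_matrix: "\<bar>det A\<bar> *\<^sub>R (LINT x|lborel. g (A *v x)) = (LINT x|lborel. g x)"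
    and integrable_lborel_matrix: "integrable lborel (\<lambda>x. g (A *v x)) \<longleftrightarrow> integrable lborel g"
proof -
  have lin: "linear ((*v) A)" by simp
  have [measurable]: "(*v) A \<in> borel_measurable borel"
    by (intro borel_measurable_continuous_onI linear_continuous_on linear_conv_bounded_linear[THEN iffD1] lin)
  have lb: "density (distr lborel borel ((*v) A)) (\<lambda>_. ennreal \<bar>det A\<bar>) = lborel"
  proof (rule measure_eqI)
    fix X assume "X \<in> sets (density (distr lborel borel ((*v) A)) (\<lambda>_. ennreal \<bar>det A\<bar>))"
    then have [measurable]: "X \<in> sets borel" by simp
    have "emeasure (density (distr lborel borel ((*v) A)) (\<lambda>_. ennreal \<bar>det A\<bar>)) X = ennreal \<bar>det A\<bar> * (\<integral>\<^sup>+x. indicator X (A *v x) \<partial>lborel)"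
    proof -
      have "(\<integral>\<^sup>+x. indicator X (A *v x) \<partial>lborel) = (\<integral>\<^sup>+x. indicator X x \<partial>distr lborel borel ((*v) A))"
        by (subst nn_integral_distr) auto
      then show ?thesis by (subst emeasure_density) (simp_all add: nn_integral_cmult_indicator)
    qed
    also have "\<dots> = (\<integral>\<^sup>+x. indicator X x \<partial>lborel)"
      using nn_integral_lborel_linear[OF lin, of "indicator X"] A by (simp add: matrix_of_matrix_vector_mul)
    finally show "emeasure (density (distr lborel borel ((*v) A)) (\<lambda>_. ennreal \<bar>det A\<bar>)) X = emeasure lborel X" by simp
  qed simp
  have "(LINT x|lborel. g x) = (LINT x|density (distr lborel borel ((*v) A)) (\<lambda>_. ennreal \<bar>det A\<bar>). g x)" by (simp only: lb)
  also have "\<dots> = \<bar>det A\<bar> *\<^sub>R (LINT x|lborel. g (A *v x))"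
    by (subst integral_density) (simp_all add: integral_distr)
  finally show "\<bar>det A\<bar> *\<^sub>R (LINT x|lborel. g (A *v x)) = (LINT x|lborel. g x)" ..
  have "integrable lborel g \<longleftrightarrow> integrable (density (distr lborel borel ((*v) A)) (\<lambda>_. ennreal \<bar>det A\<bar>)) g" by (simp only: lb)
  also have "\<dots> \<longleftrightarrow> integrable lborel (\<lambda>x. g (A *v x))"
    by (subst integrable_density) (use A in \<open>simp_all add: integrable_distr_eq integrable_scaleR_right_iff\<close>)
  finally show "integrable lborel (\<lambda>x. g (A *v x)) \<longleftrightarrow> integrable lborel g" ..
qed

lemma
  fixes g :: "'a::euclidean_space \<Rightarrow> 'b::{banach,second_countable_topology}"
  assumes c: "c \<noteq> 0" and g [measurable]: "g \<in> borel_measurable borel"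
  shows integral_lborel_scaleR: "\<bar>c\<bar> ^ DIM('a) *\<^sub>R (LINT x|lborel. g (c *\<^sub>R x)) = (LINT x|lborel. g x)"
    and integrable_lborel_scaleR: "integrable lborel (\<lambda>x. g (c *\<^sub>R x)) \<longleftrightarrow> integrable lborel g"
proof -
  have lb: "density (distr lborel borel (\<lambda>x. c *\<^sub>R x :: 'a)) (\<lambda>_. ennreal (\<bar>c\<bar> ^ DIM('a))) = lborel"
    using lborel_affine[OF c, of "0 :: 'a"] by simp
  have "(LINT x|lborel. g x) = (LINT x|density (distr lborel borel (\<lambda>x. c *\<^sub>R x)) (\<lambda>_. ennreal (\<bar>c\<bar> ^ DIM('a))). g x)" by (simp only: lb)
  also have "\<dots> = \<bar>c\<bar> ^ DIM('a) *\<^sub>R (LINT x|lborel. g (c *\<^sub>R x))"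
    by (subst integral_density) (simp_all add: integral_distr)
  finally show "\<bar>c\<bar> ^ DIM('a) *\<^sub>R (LINT x|lborel. g (c *\<^sub>R x)) = (LINT x|lborel. g x)" ..
  have "integrable lborel g \<longleftrightarrow> integrable (density (distr lborel borel (\<lambda>x. c *\<^sub>R x)) (\<lambda>_. ennreal (\<bar>c\<bar> ^ DIM('a)))) g" by (simp only: lb)
  also have "\<dots> \<longleftrightarrow> integrable lborel (\<lambda>x. g (c *\<^sub>R x))"
    by (subst integrable_density) (use c in \<open>simp_all add: integrable_distr_eq integrable_scaleR_right_iff\<close>)
  finally show "integrable lborel (\<lambda>x. g (c *\<^sub>R x)) \<longleftrightarrow> integrable lborel g" ..
qed

text \<open>The form in which Fubini is applied throughout: two integrable functions of separate
  variables and an oscillating factor of modulus at most 1.\<close>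

lemma integrable_lborel_tensor:
  fixes f :: "'a::euclidean_space \<Rightarrow> complex" and g :: "'b::euclidean_space \<Rightarrow> complex"
  assumes f: "integrable lborel f" and g: "integrable lborel g"
    and h: "case_prod h \<in> borel_measurable (lborel \<Otimes>\<^sub>M lborel)" "\<And>x y. norm (h x y) \<le> 1"
  shows "integrable (lborel \<Otimes>\<^sub>M lborel) (\<lambda>(x, y). f x * g y * h x y)"
proof -
  have [measurable]: "f \<in> borel_measurable borel" "g \<in> borel_measurable borel"
    using borel_measurable_integrable[OF f] borel_measurable_integrable[OF g] by auto
  note h(1)[measurable]
  have fg: "integrable (lborel \<Otimes>\<^sub>M lborel) (\<lambda>(x, y). f x * g y)"
  proof (rule lborel_pair.Fubini_integrable)
    show "integrable lborel (\<lambda>x. LINT y|lborel. norm (case (x, y) of (x, y) \<Rightarrow> f x * g y))"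
      using f by (simp add: norm_mult)
    show "AE x in lborel. integrable lborel (\<lambda>y. case (x, y) of (x, y) \<Rightarrow> f x * g y)"
      using g by simp
  qed measurable
  show ?thesis
  proof (rule Bochner_Integration.integrable_bound[OF fg])
    show "AE z in lborel \<Otimes>\<^sub>M lborel. norm (case z of (x, y) \<Rightarrow> f x * g y * h x y) \<le> norm (case z of (x, y) \<Rightarrow> f x * g y)"
    proof (rule AE_I2)
      fix z :: "'a \<times> 'b"
      show "norm (case z of (x, y) \<Rightarrow> f x * g y * h x y) \<le> norm (case z of (x, y) \<Rightarrow> f x * g y)"
        using h(2)[of "fst z" "snd z"] by (simp add: case_prod_unfold norm_mult mult_left_le)
    qed
  qed measurable
qed

section \<open>Gaussians and Fourier inversion\<close>

definition gaussian :: "'a::euclidean_space \<Rightarrow> real" where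
  "gaussian x = (\<Prod>b\<in>Basis. std_normal_density (x \<bullet> b))"

lemma gaussian_eq: "gaussian (x :: 'a::euclidean_space) = gaussian (0 :: 'a) * exp (- (norm x)\<^sup>2 / 2)"
proof -
  have "(\<Prod>b\<in>Basis. exp (- (x \<bullet> b)\<^sup>2 / 2)) = exp (\<Sum>b\<in>Basis. - (x \<bullet> b)\<^sup>2 / 2)"
    by (simp add: exp_sum)
  also have "(\<Sum>b\<in>Basis. - (x \<bullet> b)\<^sup>2 / 2) = - (norm x)\<^sup>2 / 2"
    unfolding power2_norm_eq_inner by (subst euclidean_inner) (simp add: sum_negf sum_divide_distrib power2_eq_square)
  finally show ?thesis
    by (simp add: gaussian_def std_normal_density_def prod.distrib prod_dividef power_divide)
qed

lemma gaussian_0_pos: "gaussian (0 :: 'a::euclidean_space) > 0"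
  unfolding gaussian_def by (intro prod_pos) (simp add: normal_density_pos)

lemma gaussian_pos: "gaussian x > 0"
  unfolding gaussian_def by (intro prod_pos) (simp add: normal_density_pos)

lemma continuous_on_gaussian: "continuous_on UNIV (gaussian :: 'a::euclidean_space \<Rightarrow> real)"
  by (subst gaussian_eq[abs_def]) (intro continuous_intros, auto)

lemma borel_measurable_gaussian [measurable]: "(gaussian :: 'a::euclidean_space \<Rightarrow> real) \<in> borel_measurable borel"
  using continuous_on_gaussian by (rule borel_measurable_continuous_onI)

lemma integrable_gaussian: "integrable lborel (gaussian :: 'a::euclidean_space \<Rightarrow> real)"
  unfolding gaussian_def[abs_def] by (intro integrable_lborel_prod_Basis) (simp add: integrable_normal_density)

lemma integral_gaussian: "(LINT x|lborel. gaussian (x :: 'a::euclidean_space)) = 1"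
  unfolding gaussian_def[abs_def] by (subst integral_lborel_prod_Basis) (simp_all add: integrable_normal_density integral_normal_density)

text \<open>The integral factors over the coordinates, and each factor is the characteristic
  function of the standard normal distribution.\<close>

lemma fourier_gaussian:
  fixes t :: "'a::euclidean_space"
  shows "(LINT x|lborel. of_real (gaussian x) * cis (t \<bullet> x)) = of_real (exp (- (norm t)\<^sup>2 / 2))"
proof -
  have 1: "of_real (gaussian x) * cis (t \<bullet> x) = (\<Prod>b\<in>Basis. of_real (std_normal_density (x \<bullet> b)) * cis ((t \<bullet> b) * (x \<bullet> b)))" for x
  proof -
    have "cis (t \<bullet> x) = (\<Prod>b\<in>Basis. cis ((t \<bullet> b) * (x \<bullet> b)))"
      unfolding cis_conv_exp by (subst euclidean_inner) (simp add: exp_sum[symmetric] sum_distrib_left)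
    then show ?thesis by (simp add: gaussian_def prod.distrib)
  qed
  have 2: "integrable lborel (\<lambda>x. complex_of_real (std_normal_density x) * cis (s * x))" for s
    by (rule Bochner_Integration.integrable_bound[of _ std_normal_density])
       (auto simp: norm_mult cis_conv_exp integrable_normal_density)
  have 3: "(LINT x|lborel. of_real (std_normal_density x) * cis (s * x)) = complex_of_real (exp (- s\<^sup>2 / 2))" for s
  proof -
    have "(LINT x|lborel. of_real (std_normal_density x) * cis (s * x)) = char std_normal_distribution s"
      unfolding char_def by (subst integral_density) (auto simp: cis_conv_exp scaleR_conv_of_real normal_density_nonneg)
    then show ?thesis by (simp add: char_std_normal_distribution)
  qed
  have "(LINT x|lborel. of_real (gaussian x) * cis (t \<bullet> x)) = (\<Prod>b\<in>Basis. complex_of_real (exp (- (t \<bullet> b)\<^sup>2 / 2)))"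
    unfolding 1 by (subst integral_lborel_prod_Basis[where g="\<lambda>b y. of_real (std_normal_density y) * cis ((t \<bullet> b) * y)", OF 2]) (simp add: 3)
  also have "\<dots> = of_real (exp (\<Sum>b\<in>Basis. - (t \<bullet> b)\<^sup>2 / 2))"
    by (simp add: exp_sum)
  also have "(\<Sum>b\<in>Basis. - (t \<bullet> b)\<^sup>2 / 2) = - (norm t)\<^sup>2 / 2"
    unfolding power2_norm_eq_inner by (subst (2) euclidean_inner) (simp add: sum_negf sum_divide_distrib power2_eq_square)
  finally show ?thesis .
qed

text \<open>Both sides are limits, as \<open>\<epsilon>\<close> tends to 0, of the integral of \<open>f^(\<xi>) e(y\<xi>) gaussian (\<epsilon> \<xi>)\<close>.\<close>

lemma fourier_inversion:
  fixes f :: "'a::euclidean_space \<Rightarrow> complex"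
  assumes f: "integrable lborel f" and cont: "continuous_on UNIV f" and bound: "\<And>x. norm (f x) \<le> B"
    and ft: "integrable lborel (\<lambda>\<xi>. LINT x|lborel. f x * osc (-2 * pi) x \<xi>)"
  shows "(LINT \<xi>|lborel. (LINT x|lborel. f x * osc (-2 * pi) x \<xi>) * osc (2 * pi) y \<xi>) = f y"
proof -
  define F where "F \<xi> = (LINT x|lborel. f x * osc (-2 * pi) x \<xi>)" for \<xi>
  have fm [measurable]: "f \<in> borel_measurable borel"
    using cont by (rule borel_measurable_continuous_onI)
  have Fm [measurable]: "F \<in> borel_measurable borel"
    using borel_measurable_integrable[OF ft] by (simp add: F_def[abs_def])
  define c where "c = (2 * pi) ^ DIM('a)"
  have c: "c > 0" by (simp add: c_def)
  define I where "I \<epsilon> = (LINT \<xi>|lborel. F \<xi> * osc (2 * pi) y \<xi> * of_real (gaussian (\<epsilon> *\<^sub>R \<xi>)))" for \<epsilon>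
  have g0: "gaussian (\<epsilon> *\<^sub>R \<xi>) \<le> gaussian (0 :: 'a)" for \<epsilon> and \<xi> :: 'a
    using gaussian_eq[of "\<epsilon> *\<^sub>R \<xi>"] gaussian_0_pos[where 'a='a] by (simp add: mult_left_le)
  \<comment> \<open>Fubini and the transform of the Gaussian turn the regularised inversion integral
    into an average of \<open>f\<close> around \<open>y\<close>, at a width proportional to
    \<epsilon>. The constant \<open>c\<close> comes from the 2 pi in that width.\<close>
  have I: "c *\<^sub>R I \<epsilon> = (LINT v|lborel. f (y + (\<epsilon> / (2 * pi)) *\<^sub>R v) * of_real (exp (- (norm v)\<^sup>2 / 2)))" if \<epsilon>: "\<epsilon> > 0" for \<epsilon>
  proof -
    have "integrable lborel (\<lambda>\<xi>::'a. gaussian (\<epsilon> *\<^sub>R \<xi>))"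
      using \<epsilon> integrable_gaussian by (simp add: integrable_lborel_scaleR[of \<epsilon> gaussian])
    then have gi: "integrable lborel (\<lambda>\<xi>::'a. complex_of_real (gaussian (\<epsilon> *\<^sub>R \<xi>)))"
      by (rule integrable_of_real)
    have "I \<epsilon> = (LINT \<xi>|lborel. LINT x|lborel. f x * of_real (gaussian (\<epsilon> *\<^sub>R \<xi>)) * (osc (-2 * pi) x \<xi> * osc (2 * pi) y \<xi>))"
      unfolding I_def F_def
      by (subst integral_mult_left_zero[symmetric], subst integral_mult_left_zero[symmetric]) (simp add: mult_ac)
    also have "\<dots> = (LINT x|lborel. LINT \<xi>|lborel. f x * of_real (gaussian (\<epsilon> *\<^sub>R \<xi>)) * (osc (-2 * pi) x \<xi> * osc (2 * pi) y \<xi>))"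
      by (rule lborel_pair.Fubini_integral, rule integrable_lborel_tensor[OF f gi])
         (auto simp: norm_mult)
    also have "\<dots> = (LINT x|lborel. f x * (LINT \<xi>|lborel. of_real (gaussian (\<epsilon> *\<^sub>R \<xi>)) * cis ((2 * pi) *\<^sub>R (y - x) \<bullet> \<xi>)))"
      by (simp add: osc_def cis_mult inner_diff_left algebra_simps)
    also have "\<dots> = (LINT x|lborel. f (y + x) * (LINT \<xi>|lborel. of_real (gaussian (\<epsilon> *\<^sub>R \<xi>)) * cis ((2 * pi) *\<^sub>R (y - (y + x)) \<bullet> \<xi>)))"
      by (subst integral_lborel_shift[of _ y, symmetric]) (simp_all add: cis_conv_exp)
    also have "\<dots> = (LINT x|lborel. f (y + x) * ((1 / \<epsilon> ^ DIM('a)) *\<^sub>R of_real (exp (- (norm ((2 * pi / \<epsilon>) *\<^sub>R x))\<^sup>2 / 2))))"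
    proof (intro Bochner_Integration.integral_cong refl arg_cong2[where f="(*)"])
      fix x :: 'a
      have "\<epsilon> ^ DIM('a) *\<^sub>R (LINT \<xi>|lborel. of_real (gaussian (\<epsilon> *\<^sub>R \<xi>)) * cis ((-(2 * pi / \<epsilon>)) *\<^sub>R x \<bullet> (\<epsilon> *\<^sub>R \<xi>)))
         = (LINT \<xi>|lborel. of_real (gaussian \<xi>) * cis ((-(2 * pi / \<epsilon>)) *\<^sub>R x \<bullet> \<xi>))"
        using integral_lborel_scaleR[of \<epsilon> "\<lambda>\<xi>. of_real (gaussian \<xi>) * cis ((-(2 * pi / \<epsilon>)) *\<^sub>R x \<bullet> \<xi>)"] \<epsilon>
        by (simp add: cis_conv_exp)
      also have "\<dots> = of_real (exp (- (norm ((2 * pi / \<epsilon>) *\<^sub>R x))\<^sup>2 / 2))"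
        unfolding fourier_gaussian by simp
      finally show "(LINT \<xi>|lborel. of_real (gaussian (\<epsilon> *\<^sub>R \<xi>)) * cis ((2 * pi) *\<^sub>R (y - (y + x)) \<bullet> \<xi>))
         = (1 / \<epsilon> ^ DIM('a)) *\<^sub>R of_real (exp (- (norm ((2 * pi / \<epsilon>) *\<^sub>R x))\<^sup>2 / 2))"
        using \<epsilon> by (auto simp: field_simps scaleR_conv_of_real)
    qed
    also have "\<dots> = (1 / \<epsilon> ^ DIM('a)) *\<^sub>R (LINT x|lborel. f (y + x) * of_real (exp (- (norm ((2 * pi / \<epsilon>) *\<^sub>R x))\<^sup>2 / 2)))"
      by simp
    also have "(LINT x|lborel. f (y + x) * of_real (exp (- (norm ((2 * pi / \<epsilon>) *\<^sub>R x))\<^sup>2 / 2)))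
      = (\<epsilon> / (2 * pi)) ^ DIM('a) *\<^sub>R (LINT v|lborel. f (y + (\<epsilon> / (2 * pi)) *\<^sub>R v) * of_real (exp (- (norm v)\<^sup>2 / 2)))"
      using integral_lborel_scaleR[of "\<epsilon> / (2 * pi)" "\<lambda>x. f (y + x) * of_real (exp (- (norm ((2 * pi / \<epsilon>) *\<^sub>R x))\<^sup>2 / 2))"] \<epsilon>
      by simp
    finally show ?thesis using \<epsilon> by (simp add: c_def power_divide)
  qed
  \<comment> \<open>Dominated convergence is a statement about sequences, so \<epsilon> runs through
    1/(k + 1).\<close>
  define X where "X k = inverse (real (Suc k))" for k
  have X: "X k > 0" "X \<longlonglongrightarrow> 0" for k
    unfolding X_def using LIMSEQ_inverse_real_of_nat by auto
  have L1: "(\<lambda>k. I (X k)) \<longlonglongrightarrow> (LINT \<xi>|lborel. F \<xi> * osc (2 * pi) y \<xi> * of_real (gaussian (0 :: 'a)))"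
    unfolding I_def
  proof (rule integral_dominated_convergence[where w="\<lambda>\<xi>. norm (F \<xi>) * gaussian (0 :: 'a)"])
    show "integrable lborel (\<lambda>\<xi>. norm (F \<xi>) * gaussian (0 :: 'a))"
      using ft by (simp add: F_def)
    have "(\<lambda>k. gaussian (X k *\<^sub>R \<xi>)) \<longlonglongrightarrow> gaussian (0 *\<^sub>R \<xi>)" for \<xi> :: 'a
      by (rule continuous_on_tendsto_compose[OF continuous_on_gaussian tendsto_scaleR[OF X(2) tendsto_const]]) auto
    then show "AE \<xi> in lborel. (\<lambda>k. F \<xi> * osc (2 * pi) y \<xi> * of_real (gaussian (X k *\<^sub>R \<xi>))) \<longlonglongrightarrow> F \<xi> * osc (2 * pi) y \<xi> * of_real (gaussian (0 :: 'a))"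
      by (auto intro!: tendsto_intros)
    show "AE \<xi> in lborel. norm (F \<xi> * osc (2 * pi) y \<xi> * of_real (gaussian (X k *\<^sub>R \<xi>))) \<le> norm (F \<xi>) * gaussian (0 :: 'a)" for k
      using g0 by (auto simp: norm_mult gaussian_pos less_imp_le intro!: mult_left_mono)
  qed measurable
  have gexp: "exp (- (norm v)\<^sup>2 / 2) = gaussian v / gaussian (0 :: 'a)" for v :: 'a
    using gaussian_eq[of v] gaussian_0_pos[where 'a='a] by simp
  have L2: "(\<lambda>k. c *\<^sub>R I (X k)) \<longlonglongrightarrow> (LINT v|lborel. f (y + (0 / (2 * pi)) *\<^sub>R v) * of_real (exp (- (norm v)\<^sup>2 / 2)))"
    unfolding I[OF X(1)]
  proof (rule integral_dominated_convergence[where w="\<lambda>v. B * (gaussian v / gaussian (0 :: 'a))"])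
    show "integrable lborel (\<lambda>v::'a. B * (gaussian v / gaussian (0 :: 'a)))"
    proof -
      have "integrable lborel (\<lambda>v::'a. (B / gaussian (0 :: 'a)) * gaussian v)"
        by (intro integrable_mult_right integrable_gaussian)
      then show ?thesis by simp
    qed
    have "(\<lambda>k. f (y + (X k / (2 * pi)) *\<^sub>R v)) \<longlonglongrightarrow> f (y + (0 / (2 * pi)) *\<^sub>R v)" for v :: 'a
      by (rule continuous_on_tendsto_compose[OF cont tendsto_add[OF tendsto_const tendsto_scaleR[OF tendsto_divide[OF X(2) tendsto_const] tendsto_const]]]) auto
    then show "AE v in lborel. (\<lambda>k. f (y + (X k / (2 * pi)) *\<^sub>R v) * of_real (exp (- (norm v)\<^sup>2 / 2))) \<longlonglongrightarrow> f (y + (0 / (2 * pi)) *\<^sub>R v) * of_real (exp (- (norm v)\<^sup>2 / 2))"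
      by (auto intro!: tendsto_intros)
    show "AE v in lborel. norm (f (y + (X k / (2 * pi)) *\<^sub>R v) * complex_of_real (exp (- (norm v)\<^sup>2 / 2))) \<le> B * (gaussian v / gaussian (0 :: 'a))" for k
      unfolding gexp[symmetric] using bound by (auto simp: norm_mult intro!: mult_right_mono)
  qed measurable
  have "(LINT v|lborel. f (y + (0 / (2 * pi)) *\<^sub>R v) * of_real (exp (- (norm v)\<^sup>2 / 2))) = f y / of_real (gaussian (0 :: 'a))"
    unfolding gexp using integral_gaussian[where 'a='a] by simp
  with L2 have "(\<lambda>k. c *\<^sub>R I (X k)) \<longlonglongrightarrow> f y / of_real (gaussian (0 :: 'a))" by simp
  from LIMSEQ_unique[OF this tendsto_scaleR[OF tendsto_const L1]]
  have "f y / of_real (gaussian (0 :: 'a)) = c *\<^sub>R ((LINT \<xi>|lborel. F \<xi> * osc (2 * pi) y \<xi>) * of_real (gaussian (0 :: 'a)))"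
    by (simp only: integral_mult_left_zero)
  moreover define J where "J = (LINT \<xi>|lborel. F \<xi> * osc (2 * pi) y \<xi>)"
  moreover define g where "g = gaussian (0 :: 'a)"
  ultimately have E: "f y / of_real g = c *\<^sub>R (J * of_real g)" by simp
  have "g > 0" unfolding g_def by (rule gaussian_0_pos)
  with E have "f y = c *\<^sub>R (J * of_real g) * of_real g"
    by (simp only: nonzero_divide_eq_eq of_real_eq_0_iff)
  then have "f y = of_real (c * g\<^sup>2) * J"
    by (simp only: scaleR_conv_of_real power2_eq_square of_real_mult mult_ac)
  \<comment> \<open>The two limits carry the factors \<open>g\<close> and \<open>1 / g\<close>. They
    balance because the Gaussian at 0 is (2 pi)^(-N/2) in dimension N, while \<open>c\<close> is (2
    pi)^N.\<close>
  moreover have "c * g\<^sup>2 = 1"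
  proof -
    have "g = (1 / sqrt (2 * pi)) ^ DIM('a)"
      by (simp add: g_def gaussian_def std_normal_density_def)
    then have "g\<^sup>2 = ((1 / sqrt (2 * pi))\<^sup>2) ^ DIM('a)"
      by (simp only: power_mult[symmetric] mult.commute)
    moreover have "(1 / sqrt (2 * pi))\<^sup>2 = 1 / (2 * pi)"
      by (simp add: power_divide)
    ultimately have "c * g\<^sup>2 = (2 * pi * (1 / (2 * pi))) ^ DIM('a)"
      by (simp only: c_def power_mult_distrib)
    then show ?thesis by simp
  qed
  ultimately show ?thesis by (simp add: J_def F_def)
qed

section \<open>Fourier transforms of compactly supported families\<close>

text \<open>The first variable runs over the whole space with uniform bounds; only the second is
  confined to \<open>K\<close>. This is the source of uniformity in the base point in all later
  estimates.\<close>

definition compact_family :: "'b::euclidean_space set \<Rightarrow> ('i \<Rightarrow> 'a::euclidean_space \<times> 'b \<Rightarrow> complex) \<Rightarrow> bool" where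
  "compact_family K c \<longleftrightarrow> bdd_smooth UNIV c \<and> (\<forall>j x \<eta>. \<eta> \<notin> K \<longrightarrow> c j (x, \<eta>) = 0)"

text \<open>A partial transform: the first component of the point is carried along as a parameter,
  and the frequency is its second component.\<close>

definition FT :: "real \<Rightarrow> ('a::euclidean_space \<times> 'b::euclidean_space \<Rightarrow> complex) \<Rightarrow> 'a \<times> 'b \<Rightarrow> complex" where
  "FT \<tau> c p = (LINT \<eta>|lborel. c (fst p, \<eta>) * osc \<tau> (snd p) \<eta>)"

lemma compact_family_smooth: "compact_family K c \<Longrightarrow> smooth_on UNIV (c j)"
  by (simp add: compact_family_def bdd_smooth_def)

lemma compact_family_zero: "compact_family K c \<Longrightarrow> \<eta> \<notin> K \<Longrightarrow> c j (x, \<eta>) = 0"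
  by (simp add: compact_family_def)

lemma compact_family_continuous: "compact_family K c \<Longrightarrow> continuous_on UNIV (c j)"
  using smooth_on_continuous[of UNIV "c j" "[]"] compact_family_smooth[of K c j] by simp

lemma compact_family_measurable:
  assumes "compact_family K c"
  shows "(\<lambda>\<eta>. c j (x, \<eta>)) \<in> borel_measurable borel"
  by (rule borel_measurable_continuous_onI, rule continuous_on_compose2[OF compact_family_continuous[OF assms]])
     (auto intro!: continuous_intros)

lemma compact_family_bound:
  assumes "compact_family K c"
  obtains C where "C \<ge> 0" "\<And>j x \<eta>. norm (c j (x, \<eta>)) \<le> C * indicator K \<eta>"
proof -
  obtain C where C: "\<forall>j. \<forall>p\<in>UNIV. norm (iterdir [] (c j) p) \<le> C"
    using assms unfolding compact_family_def bdd_smooth_def by meson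
  have "norm (c j (x, \<eta>)) \<le> max C 0 * indicator K \<eta>" for j x \<eta>
    using C compact_family_zero[OF assms, of \<eta> j x] by (auto simp: le_max_iff_disj split: split_indicator)
  then show ?thesis using that[of "max C 0"] by auto
qed

lemma compact_family_add:
  "compact_family K c \<Longrightarrow> compact_family K d \<Longrightarrow> compact_family K (\<lambda>j p. c j p + d j p)"
  by (auto simp: compact_family_def intro!: bdd_smooth_add)

lemma compact_family_cmult: "compact_family K c \<Longrightarrow> compact_family K (\<lambda>j p. z * c j p)"
  by (auto simp: compact_family_def intro!: bdd_smooth_mult bdd_smooth_const)

lemma compact_family_dirderiv:
  assumes K: "closed K" and c: "compact_family K c"
  shows "compact_family K (\<lambda>j. dirderiv v (c j))"
  unfolding compact_family_def
proof (intro conjI allI impI)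
  show "bdd_smooth UNIV (\<lambda>j. dirderiv v (c j))"
    using c by (intro bdd_smooth_dirderiv) (auto simp: compact_family_def)
  fix j x \<eta> assume "\<eta> \<notin> K"
  then have "dirderiv v (c j) (x, \<eta>) = dirderiv v (\<lambda>_. 0) (x, \<eta>)"
    by (intro dirderiv_cong[of "UNIV \<times> - K"]) (use K c in \<open>auto simp: compact_family_def intro: open_Times\<close>)
  then show "dirderiv v (c j) (x, \<eta>) = 0"
    by (simp add: dirderiv_eqI has_dirderiv_def)
qed

lemma bdd_smooth_snd_inner:
  fixes w :: "'b::euclidean_space"
  assumes "open B" "bounded B"
  shows "bdd_smooth (UNIV \<times> B) (\<lambda>j (p :: 'a::euclidean_space \<times> 'b). w \<bullet> snd p)"
  using bdd_smooth_precompose[OF bounded_linear_snd, of B "UNIV \<times> B" "\<lambda>j y. w \<bullet> y"]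
    bdd_smooth_linear_fun[OF bounded_linear_inner_right assms, of w] assms
  by (auto simp: open_Times)

text \<open>A linear function has no uniform bound on the whole space. The product is formed on a
  ball containing \<open>K\<close> and then extended by zero.\<close>

lemma compact_family_inner:
  fixes c :: "'i \<Rightarrow> 'a::euclidean_space \<times> 'b::euclidean_space \<Rightarrow> complex"
  assumes K: "compact K" and c: "compact_family K c"
  shows "compact_family K (\<lambda>j p. of_real (w \<bullet> snd p) * c j p)"
  unfolding compact_family_def
proof
  obtain r where r: "K \<subseteq> ball 0 r" using K compact_imp_bounded bounded_subset_ballD[of K 0] by blast
  let ?S = "UNIV \<times> ball 0 r :: ('a \<times> 'b) set"
  have "bdd_smooth ?S c"
    using c unfolding compact_family_def bdd_smooth_def by (blast intro: smooth_on_subset)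
  then have "bdd_smooth ?S (\<lambda>j p. (w \<bullet> snd p) *\<^sub>R c j p)"
    by (intro bdd_smooth_scaleR bdd_smooth_snd_inner) (auto intro: open_Times)
  then have "bdd_smooth UNIV (\<lambda>j p. (w \<bullet> snd p) *\<^sub>R c j p)"
    by (rule bdd_smooth_extend_zero[of ?S "UNIV \<times> K", rotated 3])
       (use r K c in \<open>auto intro: open_Times closed_Times compact_imp_closed simp: compact_family_def\<close>)
  then show "bdd_smooth UNIV (\<lambda>j p. of_real (w \<bullet> snd p) * c j p)"
    by (simp add: scaleR_conv_of_real)
qed (use c in \<open>auto simp: compact_family_def\<close>)

lemma integrable_indicator_compact: "compact K \<Longrightarrow> integrable lborel (\<lambda>x::'a::euclidean_space. (C :: real) * indicator K x)"
  using emeasure_compact_finite[of K] by (auto intro!: integrable_mult_right integrable_real_indicator borel_compact)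

lemma compact_family_integrable:
  assumes K: "compact K" and c: "compact_family K c"
  shows "integrable lborel (\<lambda>\<eta>. c j (x, \<eta>) * osc \<tau> u \<eta>)" "integrable lborel (\<lambda>\<eta>. c j (x, \<eta>))"
proof -
  obtain C where C: "C \<ge> 0" "\<And>j x \<eta>. norm (c j (x, \<eta>)) \<le> C * indicator K \<eta>"
    using compact_family_bound[OF c] by blast
  note [measurable] = compact_family_measurable[OF c]
  show "integrable lborel (\<lambda>\<eta>. c j (x, \<eta>) * osc \<tau> u \<eta>)"
    by (rule Bochner_Integration.integrable_bound[OF integrable_indicator_compact[OF K, of C]])
       (use C in \<open>auto simp: norm_mult intro!: AE_I2\<close>)
  show "integrable lborel (\<lambda>\<eta>. c j (x, \<eta>))"
    by (rule Bochner_Integration.integrable_bound[OF integrable_indicator_compact[OF K, of C]])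
       (use C in \<open>auto intro!: AE_I2\<close>)
qed

lemma FT_continuous:
  assumes K: "compact K" and c: "compact_family K c"
  shows "continuous_on UNIV (FT \<tau> (c j))"
proof -
  obtain C where C: "C \<ge> 0" "\<And>j x \<eta>. norm (c j (x, \<eta>)) \<le> C * indicator K \<eta>"
    using compact_family_bound[OF c] by blast
  note [measurable] = compact_family_measurable[OF c]
  have "(FT \<tau> (c j) \<circ> X) \<longlonglongrightarrow> FT \<tau> (c j) p" if X: "X \<longlonglongrightarrow> p" for X :: "nat \<Rightarrow> _" and p
    unfolding FT_def o_def
  proof (rule integral_dominated_convergence[OF _ _ integrable_indicator_compact[OF K, of C]])
    have "(\<lambda>i. c j (fst (X i), \<eta>) * osc \<tau> (snd (X i)) \<eta>) \<longlonglongrightarrow> c j (fst p, \<eta>) * osc \<tau> (snd p) \<eta>" for \<eta>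
    proof -
      have "continuous_on UNIV (\<lambda>p. c j (fst p, \<eta>) * osc \<tau> (snd p) \<eta>)"
        by (intro continuous_intros continuous_on_compose2[OF compact_family_continuous[OF c, of j]]) auto
      from continuous_on_tendsto_compose[OF this X] show ?thesis by simp
    qed
    then show "AE \<eta> in lborel. (\<lambda>i. c j (fst (X i), \<eta>) * osc \<tau> (snd (X i)) \<eta>) \<longlonglongrightarrow> c j (fst p, \<eta>) * osc \<tau> (snd p) \<eta>"
      by simp
  qed (use C in \<open>auto simp: norm_mult intro!: AE_I2\<close>)
  then show ?thesis
    by (auto simp: continuous_on_sequentially)
qed

text \<open>A derivative in the base point falls on \<open>c\<close>, and one in the frequency
  brings down a linear factor. Either way the result is the transform of another compact family,
  which is why all derivatives are controlled by one boundedness statement.\<close>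

lemma FT_has_dirderiv:
  assumes K: "compact K" and c: "compact_family K c"
  shows "has_dirderiv (FT \<tau> (c j)) v
    (FT \<tau> (\<lambda>p. dirderiv (fst v, 0) (c j) p + \<i> * of_real \<tau> * (of_real (snd v \<bullet> snd p) * c j p)) p) p"
proof -
  obtain x u where p: "p = (x, u)" by (cases p)
  obtain v1 w where v: "v = (v1, w)" by (cases v)
  define d where "d j p = dirderiv (v1, 0) (c j) p + \<i> * of_real \<tau> * (of_real (w \<bullet> snd p) * c j p)" for j p
  have d: "compact_family K d"
    unfolding d_def[abs_def]
    by (intro compact_family_add compact_family_cmult compact_family_inner compact_family_dirderiv K c compact_imp_closed)
  obtain C where C: "C \<ge> 0" "\<And>j x \<eta>. norm (d j (x, \<eta>)) \<le> C * indicator K \<eta>"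
    using compact_family_bound[OF d] by blast
  have "((\<lambda>t. LINT \<eta>|lborel. c j (x + t *\<^sub>R v1, \<eta>) * osc \<tau> (u + t *\<^sub>R w) \<eta>) has_vector_derivative
     (LINT \<eta>|lborel. d j (x + 0 *\<^sub>R v1, \<eta>) * osc \<tau> (u + 0 *\<^sub>R w) \<eta>)) (at 0)"
  proof (rule has_vector_derivative_lborel_integral[OF _ _ _ _ integrable_indicator_compact[OF K, of C]])
    fix t \<eta>
    show "integrable lborel (\<lambda>\<eta>. c j (x + t *\<^sub>R v1, \<eta>) * osc \<tau> (u + t *\<^sub>R w) \<eta>)"
      by (rule compact_family_integrable[OF K c])
    show "norm (d j (x + t *\<^sub>R v1, \<eta>) * osc \<tau> (u + t *\<^sub>R w) \<eta>) \<le> C * indicator K \<eta>"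
      using C by (simp add: norm_mult)
    have "((\<lambda>t. c j ((x, \<eta>) + t *\<^sub>R (v1, 0))) has_vector_derivative iterdir [(v1, 0)] (c j) ((x, \<eta>) + t *\<^sub>R (v1, 0))) (at t)"
      using smooth_on_has_vderiv_line[OF compact_family_smooth[OF c], of "(x, \<eta>)" t "(v1, 0)" "[]"] by simp
    then have 1: "((\<lambda>t. c j (x + t *\<^sub>R v1, \<eta>)) has_vector_derivative dirderiv (v1, 0) (c j) (x + t *\<^sub>R v1, \<eta>)) (at t)"
      by simp
    have "((\<lambda>t. osc \<tau> \<eta> (u + t *\<^sub>R w)) has_vector_derivative \<i> * of_real (\<tau> * (\<eta> \<bullet> w)) * osc \<tau> \<eta> (u + t *\<^sub>R w)) (at t)"
      by (rule has_dirderiv_line, rule osc_has_dirderiv)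
    then have 2: "((\<lambda>t. osc \<tau> (u + t *\<^sub>R w) \<eta>) has_vector_derivative \<i> * of_real (\<tau> * (w \<bullet> \<eta>)) * osc \<tau> (u + t *\<^sub>R w) \<eta>) (at t)"
      by (simp add: osc_def inner_commute)
    show "((\<lambda>t. c j (x + t *\<^sub>R v1, \<eta>) * osc \<tau> (u + t *\<^sub>R w) \<eta>) has_vector_derivative d j (x + t *\<^sub>R v1, \<eta>) * osc \<tau> (u + t *\<^sub>R w) \<eta>) (at t)"
      by (rule has_vector_derivative_eq_rhs[OF has_vector_derivative_mult[OF 1 2]]) (simp add: d_def algebra_simps)
  next
    note [measurable] = compact_family_measurable[OF d]
    show "(\<lambda>\<eta>. d j (x + 0 *\<^sub>R v1, \<eta>) * osc \<tau> (u + 0 *\<^sub>R w) \<eta>) \<in> borel_measurable borel" by measurable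
  qed
  then show ?thesis
    unfolding has_dirderiv_def FT_def p v d_def by simp
qed

lemma FT_iterdir:
  assumes K: "compact K" and c: "compact_family K c"
  shows "\<exists>d. compact_family K d \<and> (\<forall>j. iterdir vs (FT \<tau> (c j)) = FT \<tau> (d j))"
proof (induction vs)
  case Nil
  then show ?case using c by auto
next
  case (Cons v vs)
  then obtain d where d: "compact_family K d" "\<forall>j. iterdir vs (FT \<tau> (c j)) = FT \<tau> (d j)" by blast
  define e where "e j p = dirderiv (fst v, 0) (d j) p + \<i> * of_real \<tau> * (of_real (snd v \<bullet> snd p) * d j p)" for j p
  have "compact_family K e"
    unfolding e_def[abs_def]
    by (intro compact_family_add compact_family_cmult compact_family_inner compact_family_dirderiv K d compact_imp_closed)
  moreover have "iterdir (v # vs) (FT \<tau> (c j)) = FT \<tau> (e j)" for j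
    unfolding iterdir.simps d(2)[rule_format] e_def by (rule ext, rule dirderiv_eqI[OF FT_has_dirderiv[OF K d(1)]])
  ultimately show ?case by blast
qed

lemma FT_smooth:
  assumes K: "compact K" and c: "compact_family K c"
  shows "smooth_on UNIV (FT \<tau> (c j))"
proof (rule smooth_onI)
  fix vs
  obtain d where d: "compact_family K d" "\<forall>j. iterdir vs (FT \<tau> (c j)) = FT \<tau> (d j)"
    using FT_iterdir[OF assms] by blast
  show "continuous_on UNIV (iterdir vs (FT \<tau> (c j)))" using d FT_continuous[OF K d(1)] by simp
  show "\<exists>D. has_dirderiv (iterdir vs (FT \<tau> (c j))) v D p" for v p
    using FT_has_dirderiv[OF K d(1), of \<tau> j v p] d(2) by metis
qed

lemma FT_bound:
  assumes K: "compact K" and c: "compact_family K c"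
  shows "\<exists>C. \<forall>j p. norm (FT \<tau> (c j) p) \<le> C"
proof -
  obtain C where C: "C \<ge> 0" "\<And>j x \<eta>. norm (c j (x, \<eta>)) \<le> C * indicator K \<eta>"
    using compact_family_bound[OF c] by blast
  have "norm (FT \<tau> (c j) p) \<le> (LINT \<eta>|lborel. C * indicator K \<eta>)" for j p
    unfolding FT_def
    by (rule Bochner_Integration.integral_norm_bound_integral[OF compact_family_integrable(1)[OF K c] integrable_indicator_compact[OF K]])
       (use C in \<open>simp add: norm_mult\<close>)
  then show ?thesis by blast
qed

text \<open>The derivative of \<open>c\<close> times the oscillating factor integrates to 0, so
  multiplying the transform by a linear function amounts to differentiating
  \<open>c\<close>.\<close>

lemma FT_by_parts:
  assumes K: "compact K" and c: "compact_family K c" and \<tau>: "\<tau> \<noteq> 0"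
  shows "of_real (w \<bullet> u) * FT \<tau> (c j) (x, u) = FT \<tau> (\<lambda>p. (\<i> / of_real \<tau>) * dirderiv (0, w) (c j) p) (x, u)"
proof -
  let ?d = "\<lambda>j. dirderiv (0, w) (c j)"
  have d: "compact_family K ?d" by (intro compact_family_dirderiv c compact_imp_closed K)
  have cont: "continuous_on UNIV (\<lambda>\<eta>. F j (x, \<eta>))" if "compact_family K F" for F
    by (rule continuous_on_compose2[OF compact_family_continuous[OF that]]) (auto intro!: continuous_intros)
  have "(LINT \<eta>|lborel. ?d j (x, \<eta>) * osc \<tau> u \<eta> + \<i> * of_real (\<tau> * (u \<bullet> w)) * (c j (x, \<eta>) * osc \<tau> u \<eta>)) = 0"
  proof (rule integral_dirderiv_eq_0[of "\<lambda>\<eta>. c j (x, \<eta>) * osc \<tau> u \<eta>" w])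
    fix \<eta>
    have "((\<lambda>t. c j ((x, \<eta>) + t *\<^sub>R (0, w))) has_vector_derivative iterdir [(0, w)] (c j) ((x, \<eta>) + 0 *\<^sub>R (0, w))) (at 0)"
      using smooth_on_has_vderiv_line[OF compact_family_smooth[OF c], of "(x, \<eta>)" 0 "(0, w)" "[]"] by simp
    then have 1: "((\<lambda>t. c j (x, \<eta> + t *\<^sub>R w)) has_vector_derivative ?d j (x, \<eta>)) (at 0)" by simp
    have 2: "((\<lambda>t. osc \<tau> u (\<eta> + t *\<^sub>R w)) has_vector_derivative \<i> * of_real (\<tau> * (u \<bullet> w)) * osc \<tau> u \<eta>) (at 0)"
      using osc_has_dirderiv[of \<tau> u w \<eta>] by (simp add: has_dirderiv_def)
    show "has_dirderiv (\<lambda>\<eta>. c j (x, \<eta>) * osc \<tau> u \<eta>) w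
       (?d j (x, \<eta>) * osc \<tau> u \<eta> + \<i> * of_real (\<tau> * (u \<bullet> w)) * (c j (x, \<eta>) * osc \<tau> u \<eta>)) \<eta>"
      unfolding has_dirderiv_def
      by (rule has_vector_derivative_eq_rhs[OF has_vector_derivative_mult[OF 1 2]]) (simp add: algebra_simps)
  next
    show "continuous_on UNIV (\<lambda>\<eta>. ?d j (x, \<eta>) * osc \<tau> u \<eta> + \<i> * of_real (\<tau> * (u \<bullet> w)) * (c j (x, \<eta>) * osc \<tau> u \<eta>))"
      by (intro continuous_intros cont c d)
  qed (auto intro!: compact_family_integrable[OF K c] compact_family_integrable[OF K d])
  moreover have "(LINT \<eta>|lborel. ?d j (x, \<eta>) * osc \<tau> u \<eta> + \<i> * of_real (\<tau> * (u \<bullet> w)) * (c j (x, \<eta>) * osc \<tau> u \<eta>))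
      = FT \<tau> (?d j) (x, u) + \<i> * of_real (\<tau> * (u \<bullet> w)) * FT \<tau> (c j) (x, u)"
    unfolding FT_def using compact_family_integrable(1)[OF K c, of j x \<tau> u] compact_family_integrable(1)[OF K d, of j x \<tau> u] by simp
  moreover have "FT \<tau> (\<lambda>p. (\<i> / of_real \<tau>) * dirderiv (0, w) (c j) p) (x, u) = (\<i> / of_real \<tau>) * FT \<tau> (?d j) (x, u)"
    unfolding FT_def by (simp add: mult.assoc)
  ultimately have "FT \<tau> (\<lambda>p. (\<i> / of_real \<tau>) * dirderiv (0, w) (c j) p) (x, u) = (\<i> / of_real \<tau>) * (- \<i> * of_real (\<tau> * (u \<bullet> w)) * FT \<tau> (c j) (x, u))"
    by (simp add: add_eq_0_iff2)
  then show ?thesis using \<tau> by (simp add: inner_commute)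
qed

text \<open>Differentiation and repeated integration by parts both stay within compact families, and
  each such family has a transform bounded uniformly in the index and the point.\<close>

lemma FT_decay:
  assumes K: "compact K" and c: "compact_family K c" and \<tau>: "\<tau> \<noteq> 0"
  shows "\<exists>C. \<forall>j x u. \<bar>w \<bullet> u\<bar> ^ k * norm (iterdir vs (FT \<tau> (c j)) (x, u)) \<le> C"
proof -
  obtain d where d: "compact_family K d" "\<forall>j. iterdir vs (FT \<tau> (c j)) = FT \<tau> (d j)"
    using FT_iterdir[OF assms(1,2)] by blast
  have "\<exists>e. compact_family K e \<and> (\<forall>j x u. of_real ((w \<bullet> u) ^ k) * FT \<tau> (d j) (x, u) = FT \<tau> (e j) (x, u))"
  proof (induction k)
    case 0
    show ?case using d(1) by auto
  next
    case (Suc k)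
    then obtain e where e: "compact_family K e" "\<forall>j x u. of_real ((w \<bullet> u) ^ k) * FT \<tau> (d j) (x, u) = FT \<tau> (e j) (x, u)"
      by blast
    show ?case
    proof (intro exI conjI allI)
      show "compact_family K (\<lambda>j p. (\<i> / of_real \<tau>) * dirderiv (0, w) (e j) p)"
        by (intro compact_family_cmult compact_family_dirderiv e compact_imp_closed K)
      fix j x u
      show "of_real ((w \<bullet> u) ^ Suc k) * FT \<tau> (d j) (x, u) = FT \<tau> (\<lambda>p. (\<i> / of_real \<tau>) * dirderiv (0, w) (e j) p) (x, u)"
        using FT_by_parts[OF K e(1) \<tau>, of w u j x] e(2) by (metis mult.assoc of_real_mult power_Suc)
    qed
  qed
  then obtain e where e: "compact_family K e" "\<And>j x u. of_real ((w \<bullet> u) ^ k) * FT \<tau> (d j) (x, u) = FT \<tau> (e j) (x, u)"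
    by blast
  obtain C where C: "\<And>j p. norm (FT \<tau> (e j) p) \<le> C" using FT_bound[OF K e(1)] by blast
  have "\<bar>w \<bullet> u\<bar> ^ k * norm (iterdir vs (FT \<tau> (c j)) (x, u)) \<le> C" for j x u
    using C[of j "(x, u)"] unfolding e(2)[symmetric] d(2)[rule_format] by (simp add: norm_mult norm_power)
  then show ?thesis by blast
qed

section \<open>Decay, transforms and inversion for Schwartz functions\<close>

lemma concat_replicate_single:
  fixes i :: "'n::{finite,linorder}"
  shows "concat (map (\<lambda>j. replicate (((\<lambda>_. 0)(i := k)) j) (e j)) (sorted_list_of_set UNIV)) = replicate k (e i)"
proof -
  have "concat (map (\<lambda>j. replicate (((\<lambda>_. 0)(i := k)) j) (e j)) xs) = (if i \<in> set xs then replicate k (e i) else [])"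
    if "distinct xs" for xs
    using that by (induction xs) auto
  from this[of "sorted_list_of_set UNIV"] show ?thesis by simp
qed

lemma schwartz_axis_bound:
  fixes f :: "real^'n::{finite,linorder} \<Rightarrow> complex"
  assumes "schwartz f"
  shows "\<exists>C. \<forall>x. \<bar>x $ l\<bar> ^ m * norm (iterdir (replicate k (axis i 1)) f x) \<le> C"
proof -
  have "mderiv ((\<lambda>_. 0)(i := k)) f = iterdir (replicate k (axis i 1)) f"
    unfolding mderiv_def by (subst concat_replicate_single) simp
  moreover have "(\<Prod>j\<in>UNIV. \<bar>x $ j\<bar> ^ (((\<lambda>_. 0)(l := m)) j)) = \<bar>x $ l\<bar> ^ m" for x :: "(real, 'n) vec"
    by (subst prod.remove[of _ l]) auto
  ultimately show ?thesis
    using assms unfolding schwartz_def by metis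
qed

text \<open>The index \<open>j\<close> serves for uniformity: it is \<open>unit\<close> for a single
  Schwartz function and a pair of index and base point for the transforms of a compact
  family.\<close>

lemma decay_weight_le_cart:
  fixes g :: "'i \<Rightarrow> (real^'n) \<Rightarrow> 'b::real_normed_vector"
  assumes "\<exists>C. \<forall>j x. norm (g j x) \<le> C" "\<And>l. \<exists>C. \<forall>j x. \<bar>x $ l\<bar> ^ (2 * CARD('n)) * norm (g j x) \<le> C"
  shows "\<exists>C\<ge>0. \<forall>j x. norm (g j x) \<le> C * decay_weight x"
proof -
  obtain C0 where C0: "\<And>j x. norm (g j x) \<le> C0" using assms(1) by blast
  obtain C where C: "\<And>l j x. \<bar>x $ l\<bar> ^ (2 * CARD('n)) * norm (g j x) \<le> C l" using assms(2) by metis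
  let ?C = "Max (insert 0 (insert C0 (range C)))"
  have ge: "0 \<le> ?C" "C0 \<le> ?C" "C l \<le> ?C" for l by (rule Max_ge; simp)+
  have "norm (g j x) \<le> 2 ^ CARD('n) * ?C * decay_weight x" for j x
  proof -
    have "norm (g j x) \<le> 2 ^ DIM(real^'n) * ?C * decay_weight x"
    proof (rule norm_le_decay_weight)
      show "norm (g j x) \<le> ?C" using C0 ge(2) by (rule order_trans)
      fix b :: "real^'n" assume "b \<in> Basis"
      then obtain l where "b = axis l 1" by (auto simp: Basis_cart)
      then show "\<bar>x \<bullet> b\<bar> ^ (2 * DIM(real^'n)) * norm (g j x) \<le> ?C"
        using order_trans[OF C[of x l j] ge(3)[of l]] by (simp add: inner_axis)
    qed
    then show ?thesis by simp
  qed
  moreover have "2 ^ CARD('n) * ?C \<ge> 0" using ge(1) by simp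
  ultimately show ?thesis by blast
qed

lemma schwartz_decay:
  fixes f :: "real^'n::{finite,linorder} \<Rightarrow> complex"
  assumes "schwartz f"
  shows "\<exists>C\<ge>0. \<forall>x. norm (iterdir (replicate k (axis i 1)) f x) \<le> C * decay_weight x"
proof -
  have "\<exists>C\<ge>0. \<forall>(j::unit) x. norm (iterdir (replicate k (axis i 1)) f x) \<le> C * decay_weight x"
    by (rule decay_weight_le_cart) (use schwartz_axis_bound[OF assms, of _ 0 k i] schwartz_axis_bound[OF assms] in auto)
  then show ?thesis by simp
qed

lemma schwartz_continuous: "schwartz f \<Longrightarrow> continuous_on UNIV (iterdir vs f)"
  by (simp add: schwartz_def smooth_on_def)

lemma schwartz_integrable:
  fixes f :: "real^'n::{finite,linorder} \<Rightarrow> complex"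
  assumes "schwartz f"
  shows "integrable lborel (iterdir (replicate k (axis i 1)) f)"
proof -
  obtain C where C: "C \<ge> 0" "\<And>x. norm (iterdir (replicate k (axis i 1)) f x) \<le> C * decay_weight x"
    using schwartz_decay[OF assms] by blast
  show ?thesis
    by (rule Bochner_Integration.integrable_bound[OF integrable_mult_right[OF integrable_decay_weight, of C]])
       (use C schwartz_continuous[OF assms] in \<open>auto intro!: AE_I2 borel_measurable_continuous_onI order_trans[OF _ abs_ge_self]\<close>)
qed

lemma fourier_osc: "fourier f \<xi> = (LINT x|lborel. f x * osc (- 2 * pi) x \<xi>)"
  by (simp add: fourier_def osc_def)

text \<open>Pure derivatives along one axis suffice, since the comparison with
  \<open>decay_weight\<close> asks only for powers of single coordinates. With it the transform is
  shown to be integrable.\<close>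

lemma schwartz_fourier_by_parts:
  fixes f :: "real^'n::{finite,linorder} \<Rightarrow> complex"
  assumes f: "schwartz f"
  shows "(\<i> * of_real (2 * pi * \<xi> $ i)) ^ k * fourier f \<xi> = fourier (iterdir (replicate k (axis i 1)) f) \<xi>"
proof (induction k)
  case (Suc k)
  let ?F = "\<lambda>k. iterdir (replicate k (axis i 1)) f"
  have int: "integrable lborel (\<lambda>x. ?F k x * osc (- 2 * pi) x \<xi>)" for k
    by (rule Bochner_Integration.integrable_bound[OF schwartz_integrable[OF f, of k i]])
       (use borel_measurable_integrable[OF schwartz_integrable[OF f, of k i]] in \<open>auto simp: norm_mult\<close>)
  have sm: "smooth_on UNIV f" using f by (simp add: schwartz_def)
  have "(LINT x|lborel. ?F (Suc k) x * osc (- 2 * pi) x \<xi> + \<i> * of_real (- 2 * pi * (\<xi> $ i)) * (?F k x * osc (- 2 * pi) x \<xi>)) = 0"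
  proof (rule integral_dirderiv_eq_0[of "\<lambda>x. ?F k x * osc (- 2 * pi) x \<xi>" "axis i 1"])
    fix x
    have 1: "((\<lambda>t. ?F k (x + t *\<^sub>R axis i 1)) has_vector_derivative ?F (Suc k) x) (at 0)"
      using smooth_on_has_vderiv_line[OF sm, of x 0 "axis i 1" "replicate k (axis i 1)"] by simp
    have 2: "((\<lambda>t. osc (- 2 * pi) (x + t *\<^sub>R axis i 1) \<xi>) has_vector_derivative \<i> * of_real (- 2 * pi * (\<xi> $ i)) * osc (- 2 * pi) x \<xi>) (at 0)"
      using osc_has_dirderiv[of "- 2 * pi" \<xi> "axis i 1" x] by (simp add: has_dirderiv_def inner_axis osc_def inner_commute)
    show "has_dirderiv (\<lambda>x. ?F k x * osc (- 2 * pi) x \<xi>) (axis i 1)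
       (?F (Suc k) x * osc (- 2 * pi) x \<xi> + \<i> * of_real (- 2 * pi * (\<xi> $ i)) * (?F k x * osc (- 2 * pi) x \<xi>)) x"
      unfolding has_dirderiv_def
      by (rule has_vector_derivative_eq_rhs[OF has_vector_derivative_mult[OF 1 2]]) (simp add: algebra_simps)
  next
    show "continuous_on UNIV (\<lambda>x. ?F (Suc k) x * osc (- 2 * pi) x \<xi> + \<i> * of_real (- 2 * pi * (\<xi> $ i)) * (?F k x * osc (- 2 * pi) x \<xi>))"
      by (intro continuous_intros schwartz_continuous f)
  next
    show "integrable lborel (\<lambda>x. ?F k x * osc (- 2 * pi) x \<xi>)" by (rule int)
    show "integrable lborel (\<lambda>x. ?F (Suc k) x * osc (- 2 * pi) x \<xi> + \<i> * of_real (- 2 * pi * (\<xi> $ i)) * (?F k x * osc (- 2 * pi) x \<xi>))"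
      by (intro Bochner_Integration.integrable_add integrable_mult_right int)
  qed
  then have "fourier (?F (Suc k)) \<xi> + \<i> * of_real (- 2 * pi * (\<xi> $ i)) * fourier (?F k) \<xi> = 0"
    unfolding fourier_osc using int[of k] int[of "Suc k"] by (simp del: iterdir.simps replicate.simps of_real_mult)
  then show ?case using Suc by (simp add: mult.assoc del: iterdir.simps replicate.simps)
qed simp

lemma schwartz_fourier_integrable:
  fixes f :: "real^'n::{finite,linorder} \<Rightarrow> complex"
  assumes f: "schwartz f"
  shows "integrable lborel (fourier f)"
proof -
  have b: "\<exists>C. \<forall>(j::unit) \<xi>. \<bar>\<xi> $ i\<bar> ^ k * norm (fourier f \<xi>) \<le> C" for i k
  proof -
    let ?F = "iterdir (replicate k (axis i 1)) f"
    have "\<bar>\<xi> $ i\<bar> ^ k * norm (fourier f \<xi>) \<le> (LINT x|lborel. norm (?F x))" for \<xi>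
    proof -
      have "norm (fourier ?F \<xi>) \<le> (LINT x|lborel. norm (?F x * osc (- 2 * pi) x \<xi>))"
        unfolding fourier_osc by (rule integral_norm_bound)
      then have "(2 * pi * \<bar>\<xi> $ i\<bar>) ^ k * norm (fourier f \<xi>) \<le> (LINT x|lborel. norm (?F x))"
        unfolding schwartz_fourier_by_parts[OF f, symmetric] by (simp add: norm_mult norm_power abs_mult)
      moreover have "\<bar>\<xi> $ i\<bar> ^ k \<le> (2 * pi * \<bar>\<xi> $ i\<bar>) ^ k"
        using pi_ge_two by (intro power_mono mult_right_mono[of 1 "2 * pi", simplified]) auto
      ultimately show ?thesis by (meson mult_right_mono norm_ge_zero order_trans)
    qed
    then show ?thesis by blast
  qed
  have "\<exists>C\<ge>0. \<forall>(j::unit) \<xi>. norm (fourier f \<xi>) \<le> C * decay_weight \<xi>"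
    by (rule decay_weight_le_cart) (use b[of _ 0] b in auto)
  then obtain C where C: "C \<ge> 0" "\<And>\<xi>. norm (fourier f \<xi>) \<le> C * decay_weight \<xi>" by auto
  have [measurable]: "f \<in> borel_measurable borel"
    using schwartz_continuous[OF f, of "[]"] by (simp add: borel_measurable_continuous_onI)
  have "(\<lambda>\<xi>. LINT x|lborel. f x * osc (- 2 * pi) x \<xi>) \<in> borel_measurable lborel"
    by (rule lborel.borel_measurable_lebesgue_integral) measurable
  then have "fourier f \<in> borel_measurable lborel"
    unfolding fourier_osc[abs_def] .
  then show ?thesis
    by (intro Bochner_Integration.integrable_bound[OF integrable_mult_right[OF integrable_decay_weight, of C]])
       (use C in \<open>auto intro!: AE_I2 order_trans[OF _ abs_ge_self]\<close>)
qed

lemma schwartz_bounded: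
  fixes f :: "real^'n::{finite,linorder} \<Rightarrow> complex"
  assumes f: "schwartz f"
  shows "\<exists>B. \<forall>x. norm (f x) \<le> B"
  using schwartz_axis_bound[OF f, of _ 0 0] by simp

lemma schwartz_fourier_inversion:
  fixes f :: "real^'n::{finite,linorder} \<Rightarrow> complex"
  assumes f: "schwartz f"
  shows "(LINT \<xi>|lborel. fourier f \<xi> * osc (2 * pi) y \<xi>) = f y"
proof -
  obtain B where B: "\<And>x. norm (f x) \<le> B" using schwartz_bounded[OF f] by blast
  show ?thesis unfolding fourier_osc
    by (rule fourier_inversion[OF _ _ B])
       (use schwartz_integrable[OF f, of 0] schwartz_continuous[OF f, of "[]"] schwartz_fourier_integrable[OF f]
        in \<open>auto simp: fourier_osc[abs_def]\<close>)
qed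

section \<open>Dilations, cutoffs and weighted directions\<close>

lemma smooth_on_linear_comp:
  assumes L: "bounded_linear L" and f: "smooth_on T f" and sub: "L ` S \<subseteq> T"
  shows "smooth_on S (\<lambda>p. f (L p))"
proof (rule smooth_onI)
  note lin = bounded_linear.linear[OF L]
  fix vs
  show "continuous_on S (iterdir vs (\<lambda>p. f (L p)))"
    unfolding iterdir_linear_comp[OF lin]
    by (rule continuous_on_compose2[OF smooth_on_continuous[OF f] linear_continuous_on[OF L] sub])
  fix v p assume "p \<in> S"
  then have "L p \<in> T" using sub by auto
  then show "\<exists>D. has_dirderiv (iterdir vs (\<lambda>p. f (L p))) v D p"
    unfolding iterdir_linear_comp[OF lin] has_dirderiv_linear_comp[OF lin]
    using smooth_on_has_dirderiv[OF f] by blast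
qed

lemma iterdir_scaleR:
  assumes S: "open S" and f: "smooth_on S f" and p: "p \<in> S"
  shows "iterdir vs (\<lambda>p. c *\<^sub>R f p) p = c *\<^sub>R iterdir vs f p"
  using p
proof (induction vs arbitrary: p)
  case (Cons v vs)
  have "dirderiv v (iterdir vs (\<lambda>p. c *\<^sub>R f p)) p = dirderiv v (\<lambda>p. c *\<^sub>R iterdir vs f p) p"
    by (rule dirderiv_cong[OF S Cons.prems Cons.IH])
  also have "\<dots> = c *\<^sub>R iterdir (v # vs) f p"
    using smooth_on_has_dirderiv[OF f Cons.prems, of vs v]
    by (intro dirderiv_eqI) (auto simp: has_dirderiv_def intro: bounded_linear.has_vector_derivative[OF bounded_linear_scaleR_right])
  finally show ?case by simp
qed simp

lemma smooth_on_scaleR: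
  assumes S: "open S" and f: "smooth_on S f"
  shows "smooth_on S (\<lambda>p. c *\<^sub>R f p)"
proof (rule smooth_onI)
  fix vs
  show "continuous_on S (iterdir vs (\<lambda>p. c *\<^sub>R f p))"
    using iterdir_scaleR[OF S f, of _ vs c] smooth_on_continuous[OF f, of vs]
    by (simp cong: continuous_on_cong add: continuous_intros)
  fix v p assume p: "p \<in> S"
  show "\<exists>D. has_dirderiv (iterdir vs (\<lambda>p. c *\<^sub>R f p)) v D p"
    by (intro exI, rule has_dirderiv_cong[OF S p iterdir_scaleR[OF S f, symmetric]], assumption)
       (use smooth_on_has_dirderiv[OF f p, of vs v] in
         \<open>auto simp: has_dirderiv_def intro: bounded_linear.has_vector_derivative[OF bounded_linear_scaleR_right]\<close>)
qed

lemma iterdir_scaled_directions: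
  fixes f :: "'a::real_normed_vector \<Rightarrow> 'b::banach"
  assumes S: "open S" and f: "smooth_on S f" and p: "p \<in> S"
  shows "iterdir (map (\<lambda>k. c k *\<^sub>R e k) l) f p = prod_list (map c l) *\<^sub>R iterdir (map e l) f p"
  using p
proof (induction l arbitrary: p)
  case (Cons k l)
  have "dirderiv (c k *\<^sub>R e k) (iterdir (map (\<lambda>k. c k *\<^sub>R e k) l) f) p = dirderiv (c k *\<^sub>R e k) (\<lambda>p. prod_list (map c l) *\<^sub>R iterdir (map e l) f p) p"
    by (rule dirderiv_cong[OF S Cons.prems Cons.IH])
  also have "\<dots> = c k *\<^sub>R dirderiv (e k) (\<lambda>p. prod_list (map c l) *\<^sub>R iterdir (map e l) f p) p"
    by (rule dirderiv_scale[OF smooth_on_scaleR[OF S smooth_on_iterdir[OF f]] Cons.prems])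
  also have "dirderiv (e k) (\<lambda>p. prod_list (map c l) *\<^sub>R iterdir (map e l) f p) p = prod_list (map c l) *\<^sub>R dirderiv (e k) (iterdir (map e l) f) p"
    using iterdir_scaleR[OF S smooth_on_iterdir[OF f] Cons.prems, of "[e k]" "prod_list (map c l)" "map e l"] by simp
  finally show ?case by simp
qed simp

subsection \<open>A smooth step function\<close>

text \<open>The powers of 1/t are included so that the family is closed under
  differentiation.\<close>

definition eflat :: "nat \<Rightarrow> real \<Rightarrow> real" where
  "eflat n t = (if t > 0 then inverse t ^ n * exp (- inverse t) else 0)"

text \<open>Away from 0 this is the product rule. At 0 the right difference quotient is y^(n+1)
  exp(-y) with y = 1/h tending to infinity, so the derivative is 0.\<close>

lemma flat_has_derivative: "(eflat n has_real_derivative eflat (n + 2) t - real n * eflat (n + 1) t) (at t)"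
proof -
  consider "t < 0" | "t > 0" | "t = 0" by linarith
  then show ?thesis
  proof cases
    case 1
    have "(eflat n has_real_derivative 0) (at t)"
      by (rule has_field_derivative_transform_within_open[of "\<lambda>_. 0" 0 t "{..<0}"]) (use 1 in \<open>auto simp: eflat_def\<close>)
    then show ?thesis using 1 by (simp add: eflat_def)
  next
    case 2
    have "((\<lambda>t. inverse t ^ n * exp (- inverse t)) has_real_derivative
       inverse t ^ n * (exp (- inverse t) * (inverse t * inverse t)) + (real n * (- (inverse t * inverse t) * inverse t ^ (n - Suc 0))) * exp (- inverse t)) (at t)"
      using 2 by (auto intro!: derivative_eq_intros simp: power2_eq_square)
    then have "(eflat n has_real_derivative
       inverse t ^ n * (exp (- inverse t) * (inverse t * inverse t)) + (real n * (- (inverse t * inverse t) * inverse t ^ (n - Suc 0))) * exp (- inverse t)) (at t)"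
      by (rule has_field_derivative_transform_within_open[of _ _ _ "{0<..}"]) (use 2 in \<open>auto simp: eflat_def\<close>)
    then show ?thesis
      by (rule DERIV_cong) (use 2 in \<open>cases n; simp add: eflat_def algebra_simps\<close>)
  next
    case 3
    have "((\<lambda>h. eflat n h / h) \<longlongrightarrow> 0) (at_left 0)"
      by (rule tendsto_eventually) (auto simp: eflat_def eventually_at_filter)
    moreover have "((\<lambda>h. eflat n h / h) \<longlongrightarrow> 0) (at_right 0)"
    proof -
      have "((\<lambda>h::real. inverse h ^ Suc n / exp (inverse h)) \<longlongrightarrow> 0) (at_right 0)"
        by (rule filterlim_compose[OF tendsto_power_div_exp_0 filterlim_inverse_at_top_right])
      then show ?thesis
        by (rule Lim_transform_eventually)
           (auto simp: eflat_def eventually_at_filter exp_minus field_simps)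
    qed
    ultimately have "((\<lambda>h. eflat n h / h) \<longlongrightarrow> 0) (at 0)" by (simp add: filterlim_at_split)
    then have "(eflat n has_real_derivative 0) (at 0)"
      by (simp add: DERIV_def eflat_def)
    then show ?thesis using 3 by (simp add: eflat_def)
  qed
qed

lemma continuous_on_flat: "continuous_on S (eflat n)"
  using flat_has_derivative by (intro continuous_at_imp_continuous_on) (auto intro: DERIV_isCont)

lemma bounded_Ck_flat: "bounded_Ck k {a<..<b} (\<lambda>_::unit. eflat n)"
proof (induction k arbitrary: n)
  have *: "bounded_Ck 0 {a<..<b} (\<lambda>_::unit. eflat n)" for n
  proof -
    have "bounded (eflat n ` {a..b})"
      by (intro compact_imp_bounded compact_continuous_image continuous_on_flat compact_Icc)
    then show ?thesis using continuous_on_flat by (force simp: bounded_iff)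
  qed
  {
    case 0
    show ?case by (rule *)
  next
    case (Suc k)
    show ?case
    proof (rule bounded_Ck_SucI[OF *])
      fix v
      have "bounded_Ck k {a<..<b} (\<lambda>_::unit. \<lambda>t. v * (eflat (n + 2) t + (- real n) * eflat (n + 1) t))"
        by (intro bounded_Ck_bilinear[OF bounded_bilinear_mult] bounded_Ck_add bounded_Ck_const Suc)
      moreover have "has_dirderiv (eflat n) v (v * (eflat (n + 2) t + (- real n) * eflat (n + 1) t)) t" for t
      proof -
        have "((\<lambda>s. eflat n (t + s * v)) has_real_derivative (eflat (n + 2) (t + 0 * v) - real n * eflat (n + 1) (t + 0 * v)) * v) (at 0)"
          by (rule DERIV_chain2[OF flat_has_derivative]) (auto intro!: derivative_eq_intros)
        then show ?thesis
          by (simp add: has_dirderiv_def has_real_derivative_iff_has_vector_derivative mult.commute)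
      qed
      ultimately show "\<exists>G. bounded_Ck k {a<..<b} G \<and> (\<forall>j::unit. \<forall>p\<in>{a<..<b}. has_dirderiv (eflat n) v (G j p) p)"
        by blast
    qed
  }
qed

text \<open>The usual quotient of flat functions; 2 - t and t - 1 are never both nonpositive, so the
  denominator is positive.\<close>

definition step :: "real \<Rightarrow> real" where
  "step t = eflat 0 (2 - t) * inverse (eflat 0 (2 - t) + eflat 0 (t - 1))"

lemma step_1: "t \<le> 1 \<Longrightarrow> step t = 1"
  by (simp add: step_def eflat_def)

lemma step_0: "t \<ge> 2 \<Longrightarrow> step t = 0"
  by (simp add: step_def eflat_def)

text \<open>A bounded interval is used so that, by compactness of its closure, the denominator has a
  positive lower bound and its reciprocal is uniformly smooth.\<close>

lemma bdd_smooth_step: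
  fixes b :: real
  shows "bdd_smooth {-1<..<b} (\<lambda>_::unit. step)"
proof -
  let ?T = "{-1<..<b}"
  have eflat: "bdd_smooth {c<..<d} (\<lambda>_::unit. eflat 0)" for c d
    by (simp add: bdd_smooth_iff bounded_Ck_flat del: bounded_Ck.simps)
  have id: "bdd_smooth ?T (\<lambda>_::unit. \<lambda>t. t)"
    by (rule bdd_smooth_linear_fun) (auto intro: bounded_linear_ident)
  have "bdd_smooth ?T (\<lambda>_::unit. \<lambda>t. t + (-1))"
    by (intro bdd_smooth_add id bdd_smooth_const) auto
  then have A: "bdd_smooth ?T (\<lambda>_::unit. \<lambda>t. eflat 0 (t + (-1)))"
    by (intro bdd_smooth_compose_real[OF _ _ _ eflat[of "-2" "b - 1"]]) auto
  have "bdd_smooth ?T (\<lambda>_::unit. \<lambda>t. 2 + (-1) * t)"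
    by (intro bdd_smooth_add bdd_smooth_mult id bdd_smooth_const) auto
  then have B: "bdd_smooth ?T (\<lambda>_::unit. \<lambda>t. eflat 0 (2 + (-1) * t))"
    by (intro bdd_smooth_compose_real[OF _ _ _ eflat[of "2 - b" "3"]]) auto
  let ?d = "\<lambda>t. eflat 0 (2 - t) + eflat 0 (t - 1)"
  have pos: "?d t > 0" for t
    by (auto simp: eflat_def intro: add_pos_nonneg add_nonneg_pos)
  have "\<exists>c>0. \<forall>t\<in>?T. \<bar>?d t\<bar> \<ge> c"
  proof (cases "b > -1")
    case True
    have "continuous_on {-1..b} ?d"
      by (intro continuous_intros continuous_on_compose2[OF continuous_on_flat[of UNIV]]) auto
    then obtain t0 where "t0 \<in> {-1..b}" "\<forall>t\<in>{-1..b}. ?d t0 \<le> ?d t"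
      using continuous_attains_inf[of "{-1..b}" ?d] True by auto
    then show ?thesis using pos by (intro exI[of _ "?d t0"]) (auto intro: order_trans[OF _ abs_ge_self])
  qed (auto intro!: exI[of _ 1])
  then obtain c where c: "c > 0" "\<forall>t\<in>?T. \<bar>?d t\<bar> \<ge> c" by blast
  have "bdd_smooth ?T (\<lambda>_::unit. \<lambda>t. eflat 0 (2 + (-1) * t) * inverse (eflat 0 (2 + (-1) * t) + eflat 0 (t + (-1))))"
    by (intro bdd_smooth_mult B bdd_smooth_inverse[OF _ c(1)] bdd_smooth_add A) (use c in auto)
  then show ?thesis by (simp add: step_def[abs_def])
qed

subsection \<open>Anisotropic dilations\<close>

definition wt :: "'n::{finite,linorder} \<Rightarrow> nat" where
  "wt i = (if i = lastc then 2 else 1)"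

definition dil :: "real \<Rightarrow> (real, 'n::{finite,linorder}) vec \<Rightarrow> (real, 'n) vec" where
  "dil R \<eta> = (\<chi> i. R ^ wt i * \<eta> $ i)"

lemma sum_wt: "(\<Sum>i\<in>(UNIV :: 'n::{finite,linorder} set). wt i) = Qdim TYPE('n)"
proof -
  have "(\<Sum>i\<in>(UNIV :: 'n set). wt i) = wt (lastc :: 'n) + (\<Sum>i\<in>UNIV - {lastc :: 'n}. wt i)"
    by (rule sum.remove) auto
  also have "(\<Sum>i\<in>UNIV - {lastc :: 'n}. wt i) = card (UNIV - {lastc :: 'n})"
    by (simp add: wt_def)
  also have "wt (lastc :: 'n) + card (UNIV - {lastc :: 'n}) = Qdim TYPE('n)"
    by (simp add: wt_def Qdim_def card_Diff_singleton Suc_le_eq card_gt_0_iff)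
  finally show ?thesis .
qed

lemma dil_1 [simp]: "dil 1 \<eta> = \<eta>"
  by (simp add: dil_def vec_eq_iff)

lemma dil_dil: "dil R (dil R' \<eta>) = dil (R * R') \<eta>"
  by (simp add: dil_def vec_eq_iff power_mult_distrib mult_ac)

lemma dil_eq_0_iff: "R \<noteq> 0 \<Longrightarrow> dil R \<eta> = 0 \<longleftrightarrow> \<eta> = 0"
  by (simp add: dil_def vec_eq_iff)

lemma bounded_linear_dil: "bounded_linear (dil R)"
  unfolding linear_conv_bounded_linear[symmetric]
  by (rule linearI) (simp_all add: dil_def vec_eq_iff algebra_simps)

lemma inner_dil: "dil R u \<bullet> \<eta> = u \<bullet> dil R \<eta>"
  by (simp add: dil_def inner_vec_def mult_ac)

lemma hnorm_nonneg: "hnorm \<eta> \<ge> 0"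
  by (simp add: hnorm_def sum_nonneg)

lemma hnorm_eq_0_iff: "hnorm \<eta> = 0 \<longleftrightarrow> \<eta> = 0"
proof
  assume "hnorm \<eta> = 0"
  then have 1: "(\<Sum>i\<in>UNIV - {lastc}. (\<eta> $ i)\<^sup>2) = 0" and 2: "\<eta> $ lastc = 0"
    using sum_nonneg[of "UNIV - {lastc}" "\<lambda>i. (\<eta> $ i)\<^sup>2"] unfolding hnorm_def
    by (auto simp: add_nonneg_eq_0_iff)
  from 1 have "\<forall>i\<in>UNIV - {lastc}. \<eta> $ i = 0" by (subst (asm) sum_nonneg_eq_0_iff) auto
  with 2 show "\<eta> = 0" by (auto simp: vec_eq_iff)
qed (simp add: hnorm_def)

lemma hnorm_pos: "\<eta> \<noteq> 0 \<Longrightarrow> hnorm \<eta> > 0"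
  using hnorm_nonneg[of \<eta>] hnorm_eq_0_iff[of \<eta>] by linarith

lemma hnorm_dil:
  assumes "R > 0"
  shows "hnorm (dil R \<eta>) = R * hnorm \<eta>"
proof -
  have "(\<Sum>i\<in>UNIV - {lastc}. (dil R \<eta> $ i)\<^sup>2) = R\<^sup>2 * (\<Sum>i\<in>UNIV - {lastc}. (\<eta> $ i)\<^sup>2)"
    by (simp add: dil_def wt_def power_mult_distrib sum_distrib_left)
  moreover have "\<bar>dil R \<eta> $ lastc\<bar> = R\<^sup>2 * \<bar>\<eta> $ lastc\<bar>"
    by (simp add: dil_def wt_def abs_mult)
  ultimately show ?thesis using assms
    by (simp add: hnorm_def real_sqrt_mult algebra_simps)
qed

lemma continuous_on_hnorm: "continuous_on S hnorm"
  unfolding hnorm_def[abs_def] by (intro continuous_intros)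

text \<open>A polynomial substitute for the fourth power of \<open>hnorm\<close>, which is not
  smooth: homogeneous of degree 4 under the dilations and positive away from 0.\<close>

definition rho :: "(real, 'n::{finite,linorder}) vec \<Rightarrow> real" where
  "rho \<eta> = (\<Sum>i\<in>UNIV - {lastc}. (\<eta> $ i)\<^sup>2)\<^sup>2 + (\<eta> $ lastc)\<^sup>2"

lemma rho_dil: "rho (dil R \<eta>) = R ^ 4 * rho \<eta>"
proof -
  have "(\<Sum>i\<in>UNIV - {lastc}. (dil R \<eta> $ i)\<^sup>2) = R\<^sup>2 * (\<Sum>i\<in>UNIV - {lastc}. (\<eta> $ i)\<^sup>2)"
    by (simp add: dil_def wt_def power_mult_distrib sum_distrib_left)
  then show ?thesis
    by (simp add: rho_def dil_def wt_def power_mult_distrib algebra_simps)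
qed

lemma rho_nonneg: "rho \<eta> \<ge> 0"
  by (simp add: rho_def)

lemma rho_le_hnorm: "rho \<eta> \<le> 2 * hnorm \<eta> ^ 4"
proof -
  let ?a = "\<Sum>i\<in>UNIV - {lastc}. (\<eta> $ i)\<^sup>2"
  have a: "?a \<ge> 0" by (simp add: sum_nonneg)
  have "sqrt ?a \<le> hnorm \<eta>" "sqrt \<bar>\<eta> $ lastc\<bar> \<le> hnorm \<eta>" using a by (auto simp: hnorm_def)
  then have "(sqrt ?a) ^ 4 \<le> hnorm \<eta> ^ 4" "(sqrt \<bar>\<eta> $ lastc\<bar>) ^ 4 \<le> hnorm \<eta> ^ 4"
    using a by (auto intro!: power_mono)
  moreover have "(sqrt ?a) ^ 4 = ?a\<^sup>2" "(sqrt \<bar>\<eta> $ lastc\<bar>) ^ 4 = (\<eta> $ lastc)\<^sup>2"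
    using a power_mult[of "sqrt ?a" 2 2] power_mult[of "sqrt \<bar>\<eta> $ lastc\<bar>" 2 2] by simp_all
  ultimately show ?thesis by (simp add: rho_def)
qed

lemma rho_pos: "\<eta> \<noteq> 0 \<Longrightarrow> rho \<eta> > 0"
proof -
  assume "\<eta> \<noteq> 0"
  then consider "\<eta> $ lastc \<noteq> 0" | i where "i \<noteq> lastc" "\<eta> $ i \<noteq> 0" by (metis vec_eq_iff zero_index)
  then show ?thesis
  proof cases
    case 2
    have "(\<Sum>i\<in>UNIV - {lastc}. (\<eta> $ i)\<^sup>2) > 0" by (rule sum_pos2[of _ i]) (use 2 in auto)
    then show ?thesis by (simp add: rho_def add_pos_nonneg)
  qed (simp add: rho_def add_nonneg_pos)
qed

section \<open>Smooth cutoffs on a box and on an anisotropic annulus\<close>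

definition cut_box :: "((real, 'n::{finite,linorder}) vec) set" where
  "cut_box = {\<eta>. \<forall>i. \<bar>\<eta> $ i\<bar> \<le> 2}"

lemma compact_cut_box: "compact (cut_box :: ((real, 'n::{finite,linorder}) vec) set)"
proof -
  have "(cut_box :: ((real, 'n) vec) set) = cbox (\<chi> i. -2) (\<chi> i. 2)" by (auto simp: cut_box_def mem_box_cart abs_le_iff minus_le_iff)
  then show ?thesis by (metis compact_cbox)
qed

text \<open>The box is large enough to contain the support of \<open>chi\<close>, because
  \<open>step\<close> vanishes from 2 on.\<close>

lemma rho_gt_2:
  assumes "\<eta> \<notin> cut_box"
  shows "rho \<eta> > 2"
proof -
  obtain i where i: "\<bar>\<eta> $ i\<bar> > 2" using assms by (auto simp: cut_box_def not_le)
  then have sq: "(\<eta> $ i)\<^sup>2 > 4" using power_strict_mono[of 2 "\<bar>\<eta> $ i\<bar>" 2] by simp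
  show ?thesis
  proof (cases "i = lastc")
    case True
    have "rho \<eta> \<ge> (\<eta> $ lastc)\<^sup>2" by (simp add: rho_def)
    then show ?thesis using sq True by simp
  next
    case False
    have "(\<Sum>i\<in>UNIV - {lastc}. (\<eta> $ i)\<^sup>2) \<ge> (\<eta> $ i)\<^sup>2" by (rule member_le_sum) (use False in auto)
    then have "(\<Sum>i\<in>UNIV - {lastc}. (\<eta> $ i)\<^sup>2) \<ge> 4" using sq by simp
    then have "(\<Sum>i\<in>UNIV - {lastc}. (\<eta> $ i)\<^sup>2)\<^sup>2 \<ge> 4\<^sup>2" by (intro power_mono) auto
    then show ?thesis by (simp add: rho_def) (smt (verit) zero_le_power2)
  qed
qed

definition chi :: "(real, 'n::{finite,linorder}) vec \<Rightarrow> real" where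
  "chi \<eta> = step (rho \<eta>)"

text \<open>Dilating by 2 multiplies \<open>rho\<close> by 16, so the two terms are both 1 when rho
  is at most 1/16 and both 0 when rho is at least 2.\<close>

definition phi :: "(real, 'n::{finite,linorder}) vec \<Rightarrow> real" where
  "phi \<eta> = chi \<eta> - chi (dil 2 \<eta>)"

lemma chi_1: "rho \<eta> \<le> 1 \<Longrightarrow> chi \<eta> = 1"
  by (simp add: chi_def step_1)

lemma chi_0: "rho \<eta> \<ge> 2 \<Longrightarrow> chi \<eta> = 0"
  by (simp add: chi_def step_0)

definition phi_supp :: "((real, 'n::{finite,linorder}) vec) set" where
  "phi_supp = {\<eta> \<in> cut_box. 1 / 16 \<le> rho \<eta>}"

text \<open>An open neighbourhood of \<open>phi_supp\<close>, the bound 1/16 being relaxed to 1/32,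
  that still keeps away from the origin. It is where a kernel, singular at 0, can be treated as
  smooth with uniform bounds.\<close>

definition annulus :: "((real, 'n::{finite,linorder}) vec) set" where
  "annulus = {\<eta>. 1 / 32 < rho \<eta>}"

lemma phi_0: "\<eta> \<notin> phi_supp \<Longrightarrow> phi \<eta> = 0"
  using rho_gt_2[of \<eta>] by (auto simp: phi_def phi_supp_def chi_1 chi_0 rho_dil)

lemma continuous_on_rho: "continuous_on S rho"
  unfolding rho_def[abs_def] by (intro continuous_intros)

lemma closed_phi_supp: "closed phi_supp"
  unfolding phi_supp_def
  by (intro closed_Collect_conj closed_Collect_le compact_imp_closed[OF compact_cut_box, simplified] continuous_on_rho continuous_intros)
     (use compact_imp_closed[OF compact_cut_box] in simp)

lemma open_annulus: "open annulus"
  unfolding annulus_def by (intro open_Collect_less continuous_on_rho continuous_intros)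

lemma phi_supp_annulus: "phi_supp \<subseteq> annulus" "phi_supp \<subseteq> cut_box" "0 \<notin> annulus"
  by (auto simp: phi_supp_def annulus_def rho_def)

lemma bdd_smooth_sum:
  assumes "open S" "finite I" "\<And>i. i \<in> I \<Longrightarrow> bdd_smooth S (F i)"
  shows "bdd_smooth S (\<lambda>j p. \<Sum>i\<in>I. F i j p)"
  using assms(2,3) by (induction I) (auto intro!: bdd_smooth_add bdd_smooth_const assms(1))

lemma bdd_smooth_prod:
  fixes F :: "'k \<Rightarrow> 'i \<Rightarrow> 'a::real_normed_vector \<Rightarrow> real"
  assumes "open S" "finite I" "\<And>i. i \<in> I \<Longrightarrow> bdd_smooth S (F i)"
  shows "bdd_smooth S (\<lambda>j p. \<Prod>i\<in>I. F i j p)"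
  using assms(2,3) by (induction I) (auto intro!: bdd_smooth_mult bdd_smooth_const assms(1))

text \<open>The polynomial \<open>rho\<close> is bounded with its derivatives only on bounded sets,
  so \<open>chi\<close> is treated on a ball containing the box and then extended by zero.\<close>

lemma bdd_smooth_chi: "bdd_smooth UNIV (\<lambda>_::'i. chi :: (real, 'n::{finite,linorder}) vec \<Rightarrow> real)"
proof -
  obtain r :: real where r: "cut_box \<subseteq> ball (0 :: (real, 'n) vec) r"
    using compact_imp_bounded[OF compact_cut_box] bounded_subset_ballD by blast
  let ?B = "ball (0 :: (real, 'n) vec) r"
  have lin: "bdd_smooth ?B (\<lambda>_::unit. \<lambda>\<eta>. \<eta> $ i)" for i
    by (rule bdd_smooth_linear_fun) (auto intro: bounded_linear_vec_nth)
  have rho: "bdd_smooth ?B (\<lambda>_::unit. rho)"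
    unfolding rho_def[abs_def] power2_eq_square
    by (intro bdd_smooth_add bdd_smooth_mult bdd_smooth_sum lin) auto
  obtain C where "\<forall>_::unit. \<forall>\<eta>\<in>?B. norm (rho \<eta>) \<le> C"
    using bounded_Ck_bound[OF bdd_smooth_imp_bounded_Ck[OF rho, of 0]] by blast
  then have C: "\<bar>rho \<eta>\<bar> \<le> C" if "\<eta> \<in> ?B" for \<eta> using that by auto
  have "bdd_smooth ?B (\<lambda>_::unit. \<lambda>\<eta>. step (rho \<eta>))"
  \<comment> \<open>On the ball the values of \<open>rho\<close> lie in [0, C]; the open interval
    from -1 to C + 1 leaves room at both ends.\<close>
  proof (rule bdd_smooth_compose_real[OF _ _ _ bdd_smooth_step[of "C + 1"] rho])
    fix \<eta> assume "\<eta> \<in> ?B"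
    then show "rho \<eta> \<in> {-1<..<C + 1}" using C[of \<eta>] rho_nonneg[of \<eta>] by auto
  qed auto
  then have "bdd_smooth ?B (\<lambda>_::unit. chi)" by (simp add: chi_def[abs_def])
  then have "bdd_smooth UNIV (\<lambda>_::unit. chi :: (real, 'n) vec \<Rightarrow> real)"
    by (intro bdd_smooth_extend_zero[OF open_ball compact_imp_closed[OF compact_cut_box] r]) (auto simp: chi_0 less_imp_le rho_gt_2)
  from bdd_smooth_reindex[OF this] show ?thesis .
qed

lemma bdd_smooth_phi: "bdd_smooth UNIV (\<lambda>_::'i. phi :: (real, 'n::{finite,linorder}) vec \<Rightarrow> real)"
proof -
  have "bdd_smooth UNIV (\<lambda>(_::'i) \<eta>. chi \<eta> + (-1) * chi (dil 2 \<eta>) :: real)"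
    by (intro bdd_smooth_add bdd_smooth_mult bdd_smooth_const bdd_smooth_chi
       bdd_smooth_precompose[where S=UNIV and F="\<lambda>_. chi", OF bounded_linear_dil]) auto
  then show ?thesis by (simp add: phi_def[abs_def])
qed

subsection \<open>Weighted coordinate directions\<close>

definition cdir :: "'n::{finite,linorder} + 'n \<Rightarrow> (real, 'n) vec \<times> (real, 'n) vec" where
  "cdir k = (case k of Inl i \<Rightarrow> (axis i 1, 0) | Inr i \<Rightarrow> (0, axis i 1))"

text \<open>Directions in the base point are not dilated and have weight 0; those in the second
  variable have weight 1, or 2 for the last coordinate.\<close>

definition cwt :: "'n::{finite,linorder} + 'n \<Rightarrow> nat" where
  "cwt k = (case k of Inl i \<Rightarrow> 0 | Inr i \<Rightarrow> wt i)"

definition lwt :: "('n::{finite,linorder} + 'n) list \<Rightarrow> nat" where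
  "lwt l = sum_list (map cwt l)"

definition cderiv :: "('n::{finite,linorder} + 'n) list \<Rightarrow> ((real, 'n) vec \<times> (real, 'n) vec \<Rightarrow> complex) \<Rightarrow> (real, 'n) vec \<times> (real, 'n) vec \<Rightarrow> complex" where
  "cderiv l f = iterdir (map cdir l) f"

lemma vec_eq_sum_axis: "(v :: real^'n) = (\<Sum>i\<in>UNIV. (v $ i) *\<^sub>R axis i 1)"
  by (simp add: vec_eq_iff axis_def if_distrib cong: if_cong)

lemma cdir_spanning: "\<exists>c. v = (\<Sum>k\<in>UNIV. c k *\<^sub>R cdir k)"
proof (intro exI)
  let ?c = "case_sum (\<lambda>i. fst v $ i) (\<lambda>i. snd v $ i)"
  have "(\<Sum>k\<in>UNIV. ?c k *\<^sub>R cdir k) = (\<Sum>i\<in>UNIV. (fst v $ i) *\<^sub>R (axis i 1, 0)) + (\<Sum>i\<in>UNIV. (snd v $ i) *\<^sub>R (0, axis i 1))"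
    by (subst UNIV_Plus_UNIV[symmetric], subst sum.Plus) (simp_all add: cdir_def)
  also have "\<dots> = (\<Sum>i\<in>UNIV. (fst v $ i) *\<^sub>R axis i 1, \<Sum>i\<in>UNIV. (snd v $ i) *\<^sub>R axis i 1)"
    by (simp add: sum_prod)
  also have "\<dots> = v" by (simp add: vec_eq_sum_axis[symmetric])
  finally show "v = (\<Sum>k\<in>UNIV. ?c k *\<^sub>R cdir k)" ..
qed

lemma iterdir_le_cderiv:
  "\<exists>C\<ge>0. \<forall>S f p. open S \<longrightarrow> smooth_on S f \<longrightarrow> p \<in> S \<longrightarrow>
     norm (iterdir vs f p) \<le> C * (\<Sum>l | length l = length vs. norm (cderiv l f p))"
  unfolding cderiv_def by (rule iterdir_le_spanning[OF cdir_spanning])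

lemma finite_lists_length: "finite {l :: 'k::finite list. length l = n}"
  using finite_lists_length_eq[OF finite[of "UNIV :: 'k set"], of n] by simp

text \<open>Coordinate directions span, so derivatives along arbitrary words are combinations of
  those along coordinate words of the same length, which are finite in number.\<close>

lemma bdd_smooth_cderivI:
  assumes S: "open S" and f: "\<And>j. smooth_on S (F j)"
    and bound: "\<And>l. \<exists>C. \<forall>j. \<forall>p\<in>S. norm (cderiv l (F j) p) \<le> C"
  shows "bdd_smooth S F"
  unfolding bdd_smooth_def
proof (intro conjI allI f)
  fix vs
  obtain C0 where C0: "C0 \<ge> 0" "\<And>j p. p \<in> S \<Longrightarrow> norm (iterdir vs (F j) p) \<le> C0 * (\<Sum>l | length l = length vs. norm (cderiv l (F j) p))"
    using iterdir_le_cderiv[of vs] S f by meson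
  obtain C where C: "\<And>l j p. p \<in> S \<Longrightarrow> norm (cderiv l (F j) p) \<le> C l" using bound by metis
  have "norm (iterdir vs (F j) p) \<le> C0 * (\<Sum>l | length l = length vs. C l)" if "p \<in> S" for j p
    by (rule order_trans[OF C0(2)[OF that]]) (intro mult_left_mono sum_mono C that C0)
  then show "\<exists>C. \<forall>j. \<forall>p\<in>S. norm (iterdir vs (F j) p) \<le> C" by blast
qed

definition dil2 :: "real \<Rightarrow> (real, 'n::{finite,linorder}) vec \<times> (real, 'n) vec \<Rightarrow> (real, 'n) vec \<times> (real, 'n) vec" where
  "dil2 R p = (fst p, dil R (snd p))"

lemma bounded_linear_dil2: "bounded_linear (dil2 R)"
  unfolding dil2_def[abs_def]
  by (intro bounded_linear_Pair bounded_linear_fst bounded_linear_compose[OF bounded_linear_dil bounded_linear_snd])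

lemma dil2_cdir: "dil2 R (cdir k) = R ^ cwt k *\<^sub>R cdir k"
  by (cases k) (auto simp: dil2_def cdir_def cwt_def dil_def vec_eq_iff axis_def)

text \<open>Each coordinate direction is an eigenvector of \<open>dil2 R\<close>, with eigenvalue R
  to the power of its weight; the eigenvalues multiply along the word.\<close>

lemma cderiv_dil2:
  assumes S: "open S" and f: "smooth_on S f" and p: "dil2 R p \<in> S"
  shows "cderiv l (\<lambda>p. f (dil2 R p)) p = R ^ lwt l *\<^sub>R cderiv l f (dil2 R p)"
proof -
  have "cderiv l (\<lambda>p. f (dil2 R p)) p = iterdir (map (\<lambda>k. R ^ cwt k *\<^sub>R cdir k) l) f (dil2 R p)"
    unfolding cderiv_def iterdir_linear_comp[OF bounded_linear.linear[OF bounded_linear_dil2]] by (simp add: o_def dil2_cdir)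
  also have "\<dots> = prod_list (map (\<lambda>k. R ^ cwt k) l) *\<^sub>R cderiv l f (dil2 R p)"
    unfolding cderiv_def by (rule iterdir_scaled_directions[OF S f p])
  also have "prod_list (map (\<lambda>k. R ^ cwt k) l) = R ^ lwt l"
    by (induction l) (simp_all add: lwt_def power_add)
  finally show ?thesis .
qed

text \<open>The factor with \<open>M\<close> makes use of additional decay at infinity in the range \<open>R \<ge> 1\<close>.\<close>

lemma bdd_smooth_rescaled:
  fixes f :: "(real, 'n::{finite,linorder}) vec \<times> (real, 'n) vec \<Rightarrow> complex" and R :: "'i \<Rightarrow> real"
  assumes f: "smooth_on (UNIV \<times> (UNIV - {0})) f" and R: "\<And>j. R j > 0" and m: "m \<le> 0" and M: "M \<ge> 0"
    and b0: "\<And>l. \<exists>C. \<forall>x u. u \<noteq> 0 \<longrightarrow> norm (cderiv l f (x, u)) \<le> C * hnorm u powr (m - real (lwt l))"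
    and bM: "\<And>l. \<exists>C. \<forall>x u. u \<noteq> 0 \<longrightarrow> norm (cderiv l f (x, u)) \<le> C * hnorm u powr (m - real (lwt l) - M)"
  shows "bdd_smooth (UNIV \<times> annulus) (\<lambda>j p. (max 1 (R j) powr M * R j powr (- m)) *\<^sub>R f (dil2 (R j) p))"
proof (rule bdd_smooth_cderivI)
  have oS: "open (UNIV \<times> (UNIV - {0}) :: ((real, 'n) vec \<times> (real, 'n) vec) set)"
    by (intro open_Times) auto
  show oA: "open (UNIV \<times> annulus :: ((real, 'n) vec \<times> (real, 'n) vec) set)"
    by (intro open_Times open_annulus) auto
  have mem: "dil2 (R j) p \<in> UNIV \<times> (UNIV - {0})" if "p \<in> UNIV \<times> annulus" for j p
    using that R[of j] phi_supp_annulus(3) by (auto simp: dil2_def dil_eq_0_iff)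
  have sm: "smooth_on (UNIV \<times> annulus) (\<lambda>p. f (dil2 (R j) p))" for j
    by (rule smooth_on_linear_comp[OF bounded_linear_dil2 f]) (use mem in blast)
  then show "smooth_on (UNIV \<times> annulus) (\<lambda>p. (max 1 (R j) powr M * R j powr (- m)) *\<^sub>R f (dil2 (R j) p))" for j
    by (rule smooth_on_scaleR[OF oA])
  fix l
  obtain C0 where C0: "\<And>x u. u \<noteq> 0 \<Longrightarrow> norm (cderiv l f (x, u)) \<le> C0 * hnorm u powr (m - real (lwt l))"
    using b0 by blast
  obtain CM where CM: "\<And>x u. u \<noteq> 0 \<Longrightarrow> norm (cderiv l f (x, u)) \<le> CM * hnorm u powr (m - real (lwt l) - M)"
    using bM by blast
  define q where "q = m - real (lwt l)"
  have q: "q \<le> 0" using m by (simp add: q_def)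
  let ?C = "max 0 C0 * (1/4) powr q + max 0 CM * (1/4) powr (q - M)"
  have "norm (cderiv l (\<lambda>p. (max 1 (R j) powr M * R j powr (- m)) *\<^sub>R f (dil2 (R j) p)) p) \<le> ?C" if p: "p \<in> UNIV \<times> annulus" for j p
  proof -
    obtain x u where xu: "p = (x, u)" by (cases p)
    have u: "u \<in> annulus" using p xu by auto
    then have u0: "u \<noteq> 0" using phi_supp_annulus(3) by auto
    \<comment> \<open>On the annulus rho exceeds 1/32, and rho is at most twice the fourth power of
      \<open>hnorm\<close>; hence that power exceeds 1/64, which is larger than (1/4)^4.\<close>
    have h: "hnorm u \<ge> 1/4"
    proof (rule ccontr)
      assume "\<not> hnorm u \<ge> 1/4"
      then have "hnorm u ^ 4 \<le> (1/4) ^ 4" using hnorm_nonneg[of u] by (intro power_mono) auto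
      then show False using u rho_le_hnorm[of u] by (simp add: annulus_def power4_eq_xxxx)
    qed
    have Rj: "R j > 0" by (rule R)
    have "cderiv l (\<lambda>p. (max 1 (R j) powr M * R j powr (- m)) *\<^sub>R f (dil2 (R j) p)) p
      = (max 1 (R j) powr M * R j powr (- m)) *\<^sub>R (R j ^ lwt l *\<^sub>R cderiv l f (dil2 (R j) p))"
      using iterdir_scaleR[OF oA sm p, of "map cdir l"] cderiv_dil2[OF oS f mem[OF p], of l j]
      by (simp add: cderiv_def)
    then have eq: "norm (cderiv l (\<lambda>p. (max 1 (R j) powr M * R j powr (- m)) *\<^sub>R f (dil2 (R j) p)) p)
      = max 1 (R j) powr M * R j powr (- q) * norm (cderiv l f (x, dil (R j) u))"
      using Rj by (simp add: abs_mult xu dil2_def q_def powr_add[symmetric] powr_realpow[symmetric])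
    have d0: "dil (R j) u \<noteq> 0" using Rj u0 by (simp add: dil_eq_0_iff)
    \<comment> \<open>For R at most 1 the weight is 1 and the bound without \<open>M\<close> is
      used. For larger R the bound with \<open>M\<close> supplies R^(-M), which cancels the weight.
      In both cases the powers of R cancel exactly and a power of \<open>hnorm u\<close>, bounded on
      the annulus, remains.\<close>
    show ?thesis
    proof (cases "R j \<le> 1")
      case True
      have "R j powr (- q) * norm (cderiv l f (x, dil (R j) u)) \<le> R j powr (- q) * (max 0 C0 * (R j * hnorm u) powr q)"
        using C0[OF d0, of x] Rj by (intro mult_left_mono) (auto simp: hnorm_dil q_def intro: order_trans[OF _ mult_right_mono])
      also have "\<dots> = max 0 C0 * hnorm u powr q"
        using Rj by (simp add: powr_mult hnorm_nonneg powr_minus field_simps)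
      also have "\<dots> \<le> max 0 C0 * (1/4) powr q"
        using h q by (intro mult_left_mono powr_mono2') auto
      also have "\<dots> \<le> ?C" by simp
      finally show ?thesis using eq True by simp
    next
      case False
      have "R j powr M * (R j powr (- q) * norm (cderiv l f (x, dil (R j) u))) \<le> R j powr M * (R j powr (- q) * (max 0 CM * (R j * hnorm u) powr (q - M)))"
        using CM[OF d0, of x] Rj by (intro mult_left_mono) (auto simp: hnorm_dil q_def intro: order_trans[OF _ mult_right_mono])
      also have "\<dots> = max 0 CM * hnorm u powr (q - M) * (R j powr M * R j powr (- q) * R j powr (q - M))"
        using Rj by (simp add: powr_mult hnorm_nonneg)
      also have "R j powr M * R j powr (- q) * R j powr (q - M) = 1"
        using Rj by (simp add: powr_add[symmetric])
      also have "max 0 CM * hnorm u powr (q - M) * 1 \<le> max 0 CM * (1/4) powr (q - M)"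
        using h q M by (simp, intro mult_left_mono powr_mono2') auto
      also have "\<dots> \<le> ?C" by simp
      finally show ?thesis using eq False by (simp add: max_def mult.assoc)
    qed
  qed
  then show "\<exists>C. \<forall>j. \<forall>p\<in>UNIV \<times> annulus. norm (cderiv l (\<lambda>p. (max 1 (R j) powr M * R j powr (- m)) *\<^sub>R f (dil2 (R j) p)) p) \<le> C"
    by blast
qed

section \<open>Dyadic series\<close>

text \<open>For y > 0 this is the minimum of y^\<sigma> and y^(-\<sigma>), that is 2^(-\<sigma>
  |log_2 y|): a profile peaked at y = 1 with geometric decay over dyadic scales on both
  sides.\<close>

definition tent :: "real \<Rightarrow> real \<Rightarrow> real" where
  "tent \<sigma> y = y powr \<sigma> * max 1 y powr (- 2 * \<sigma>)"

lemma tent_powr_2: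
  assumes "\<sigma> > 0"
  shows "tent \<sigma> (2 powr z) = 2 powr (- \<sigma> * \<bar>z\<bar>)"
proof (cases "z \<le> 0")
  case True
  then have "2 powr z \<le> (1 :: real)" using powr_mono[of z 0 "2::real"] by simp
  then show ?thesis using True by (simp add: tent_def max_def powr_powr mult.commute)
next
  case False
  then have "2 powr z \<ge> (1 :: real)" using powr_mono[of 0 z "2::real"] by simp
  then show ?thesis using False
    by (simp add: tent_def max_def powr_powr powr_add[symmetric] algebra_simps)
qed

lemma tent_nonneg: "tent \<sigma> y \<ge> 0"
  by (simp add: tent_def)

lemma sum_geometric_int:
  fixes q :: real
  assumes "0 < q" "q < 1" "finite F"
  shows "(\<Sum>i\<in>F. q powr \<bar>real_of_int i\<bar>) \<le> 2 / (1 - q)"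
proof -
  have geo: "(\<Sum>n\<in>N. q ^ n) \<le> 1 / (1 - q)" if "finite N" for N :: "nat set"
    using sum_le_suminf[of "\<lambda>n. q ^ n" N] suminf_geometric[of q] assms that by (auto simp: summable_geometric)
  let ?A = "F \<inter> {0..}" and ?B = "F \<inter> {..<0}"
  have "(\<Sum>i\<in>F. q powr \<bar>real_of_int i\<bar>) = (\<Sum>i\<in>?A. q powr \<bar>real_of_int i\<bar>) + (\<Sum>i\<in>?B. q powr \<bar>real_of_int i\<bar>)"
    using assms(3) by (subst sum.union_disjoint[symmetric]) (auto intro!: sum.cong)
  moreover have "(\<Sum>i\<in>?A. q powr \<bar>real_of_int i\<bar>) = (\<Sum>n\<in>nat ` ?A. q ^ n)"
    by (subst sum.reindex) (auto simp: inj_on_def powr_realpow[OF assms(1), symmetric] intro!: sum.cong)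
  moreover have "(\<Sum>i\<in>?B. q powr \<bar>real_of_int i\<bar>) = (\<Sum>n\<in>(\<lambda>i. nat (- i)) ` ?B. q ^ n)"
    by (subst sum.reindex) (auto simp: inj_on_def powr_realpow[OF assms(1), symmetric] intro!: sum.cong)
  moreover have "(\<Sum>n\<in>nat ` ?A. q ^ n) \<le> 1 / (1 - q)" "(\<Sum>n\<in>(\<lambda>i. nat (- i)) ` ?B. q ^ n) \<le> 1 / (1 - q)"
    using assms(3) by (auto intro!: geo)
  ultimately show ?thesis by simp
qed

text \<open>In logarithmic scale, multiplying by \<open>t\<close> is a translation. Rounding it to
  an integer costs a factor 2^\<sigma>, and what is left is a two-sided geometric series; hence the
  bound is independent of \<open>t\<close>.\<close>

lemma dyadic_tent_sum:
  assumes \<sigma>: "\<sigma> > 0"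
  shows "\<exists>C\<ge>0. \<forall>t>0. \<forall>F :: int set. finite F \<longrightarrow> (\<Sum>i\<in>F. tent \<sigma> (2 powr of_int i * t)) \<le> C"
proof (intro exI conjI allI impI)
  define q :: real where "q = 2 powr (- \<sigma>)"
  have q: "0 < q" "q < 1" using \<sigma> powr_less_mono[of "- \<sigma>" 0 "2::real"] by (auto simp: q_def)
  show "2 powr \<sigma> * (2 / (1 - q)) \<ge> 0" using q by simp
  fix t :: real and F :: "int set" assume t: "t > 0" and F: "finite F"
  define m where "m = \<lfloor>log 2 t\<rfloor>"
  have "tent \<sigma> (2 powr of_int i * t) \<le> 2 powr \<sigma> * q powr \<bar>real_of_int (i + m)\<bar>" for i
  proof -
    have "2 powr of_int i * t = 2 powr (of_int i + log 2 t)"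
      using t by (simp add: powr_add)
    then have "tent \<sigma> (2 powr of_int i * t) = 2 powr (- \<sigma> * \<bar>of_int i + log 2 t\<bar>)"
      using tent_powr_2[OF \<sigma>] by simp
    also have "\<dots> \<le> 2 powr (- \<sigma> * (\<bar>real_of_int (i + m)\<bar> - 1))"
    proof (intro powr_mono mult_left_mono_neg)
      have "\<bar>log 2 t - real_of_int m\<bar> \<le> 1" unfolding m_def by linarith
      then show "\<bar>real_of_int (i + m)\<bar> - 1 \<le> \<bar>of_int i + log 2 t\<bar>" unfolding of_int_add by linarith
    qed (use \<sigma> in auto)
    also have "\<dots> = 2 powr \<sigma> * q powr \<bar>real_of_int (i + m)\<bar>"
      by (simp add: q_def powr_powr powr_add[symmetric] algebra_simps)
    finally show ?thesis .
  qed
  then have "(\<Sum>i\<in>F. tent \<sigma> (2 powr of_int i * t)) \<le> 2 powr \<sigma> * (\<Sum>i\<in>F. q powr \<bar>real_of_int (i + m)\<bar>)"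
    by (simp add: sum_distrib_left sum_mono)
  also have "(\<Sum>i\<in>F. q powr \<bar>real_of_int (i + m)\<bar>) = (\<Sum>i\<in>(\<lambda>i. i + m) ` F. q powr \<bar>real_of_int i\<bar>)"
    by (subst sum.reindex) (auto simp: inj_on_def)
  also have "2 powr \<sigma> * \<dots> \<le> 2 powr \<sigma> * (2 / (1 - q))"
    by (intro mult_left_mono sum_geometric_int q) (use F in auto)
  finally show "(\<Sum>i\<in>F. tent \<sigma> (2 powr of_int i * t)) \<le> 2 powr \<sigma> * (2 / (1 - q))" .
qed

lemma suminf_norm_le:
  fixes a :: "nat \<Rightarrow> 'a::banach"
  assumes "\<And>J. (\<Sum>j<J. norm (a j)) \<le> B"
  shows "summable (\<lambda>j. norm (a j))" "norm (\<Sum>j. a j) \<le> B"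
proof -
  show s: "summable (\<lambda>j. norm (a j))"
    by (rule summableI_nonneg_bounded[of _ B]) (use assms in auto)
  have "norm (\<Sum>j. a j) \<le> (\<Sum>j. norm (a j))" by (rule summable_norm[OF s])
  also have "\<dots> \<le> B" by (rule suminf_le_const[OF s assms])
  finally show "norm (\<Sum>j. a j) \<le> B" .
qed

text \<open>The Euclidean norm is at most the sum of the moduli, so \<open>hnorm u\<close> is
  bounded by a sum of N terms and thus by N times the largest of them.\<close>

lemma hnorm_le_coordinate:
  fixes u :: "(real, 'n::{finite,linorder}) vec"
  shows "(\<exists>i. hnorm u \<le> CARD('n) * \<bar>u $ i\<bar>) \<or> hnorm u \<le> CARD('n) * sqrt \<bar>u $ lastc\<bar>"
proof -
  define a where "a i = (if i = lastc then sqrt \<bar>u $ i\<bar> else \<bar>u $ i\<bar>)" for i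
  have "sqrt (\<Sum>i\<in>UNIV - {lastc}. (u $ i)\<^sup>2) \<le> (\<Sum>i\<in>UNIV - {lastc}. \<bar>u $ i\<bar>)"
    using L2_set_le_sum_abs[of "\<lambda>i. u $ i" "UNIV - {lastc}"] by (simp add: L2_set_def)
  then have "hnorm u \<le> (\<Sum>i\<in>UNIV - {lastc}. a i) + a lastc"
    by (simp add: hnorm_def a_def)
  also have "\<dots> = (\<Sum>i\<in>UNIV. a i)" by (subst (2) sum.remove[of _ lastc]) auto
  finally have 1: "hnorm u \<le> (\<Sum>i\<in>UNIV. a i)" .
  have "Max (range a) \<in> range a" by (rule Max_in) auto
  then obtain m where m: "Max (range a) = a m" by (metis imageE)
  have "(\<Sum>i\<in>UNIV. a i) \<le> of_nat CARD('n) * a m"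
    by (rule sum_bounded_above) (simp add: m[symmetric])
  with 1 have "hnorm u \<le> CARD('n) * a m" by simp
  then show ?thesis by (auto simp: a_def split: if_splits)
qed

text \<open>Integration by parts yields powers of single coordinates only, so the dominant
  coordinate is used: 2k powers of it in one case, and k powers in the other, since
  \<open>hnorm\<close> then grows like the square root of the last coordinate.\<close>

lemma FT_hnorm_decay:
  fixes c :: "'i \<Rightarrow> (real, 'n::{finite,linorder}) vec \<times> (real, 'n) vec \<Rightarrow> complex"
  assumes K: "compact K" and c: "compact_family K c" and \<tau>: "\<tau> \<noteq> 0" and \<kappa>: "\<kappa> \<ge> 0"
  shows "\<exists>C\<ge>0. \<forall>j x u. norm (cderiv l (FT \<tau> (c j)) (x, u)) \<le> C * max 1 (hnorm u) powr (- \<kappa>)"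
proof -
  define k where "k = nat \<lceil>\<kappa>\<rceil>"
  have k: "real k \<ge> \<kappa>" using \<kappa> by (simp add: k_def)
  let ?n = "\<lambda>j x u. norm (cderiv l (FT \<tau> (c j)) (x, u))"
  obtain C0 where C0: "\<And>j x u. ?n j x u \<le> C0"
    using FT_decay[OF K c \<tau>, of 0 0 "map cdir l"] by (auto simp: cderiv_def)
  have "\<exists>C. \<forall>j x u. \<bar>u $ i\<bar> ^ m * ?n j x u \<le> C" for i m
    using FT_decay[OF K c \<tau>, of "axis i 1" m "map cdir l"] by (simp add: cderiv_def inner_axis')
  then obtain D where D: "\<And>i m j x u. \<bar>u $ i\<bar> ^ m * ?n j x u \<le> D i m" by metis
  define B where "B = CARD('n) ^ (2 * k) * ((\<Sum>i\<in>UNIV. \<bar>D i (2 * k)\<bar>) + \<bar>D lastc k\<bar>)"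
  have B: "hnorm u ^ (2 * k) * ?n j x u \<le> B" for j x u
    using hnorm_le_coordinate[of u]
  proof
    assume "\<exists>i. hnorm u \<le> CARD('n) * \<bar>u $ i\<bar>"
    then obtain i where i: "hnorm u \<le> CARD('n) * \<bar>u $ i\<bar>" by blast
    have "hnorm u ^ (2 * k) * ?n j x u \<le> (CARD('n) * \<bar>u $ i\<bar>) ^ (2 * k) * ?n j x u"
      by (intro mult_right_mono power_mono i hnorm_nonneg) auto
    also have "\<dots> = CARD('n) ^ (2 * k) * (\<bar>u $ i\<bar> ^ (2 * k) * ?n j x u)" by (simp add: power_mult_distrib)
    also have "\<dots> \<le> CARD('n) ^ (2 * k) * \<bar>D i (2 * k)\<bar>"
      by (intro mult_left_mono order_trans[OF D abs_ge_self]) auto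
    also have "\<dots> \<le> B" unfolding B_def
      by (intro mult_left_mono order_trans[OF member_le_sum[of i UNIV "\<lambda>i. \<bar>D i (2 * k)\<bar>"]]) auto
    finally show ?thesis .
  next
    assume i: "hnorm u \<le> CARD('n) * sqrt \<bar>u $ lastc\<bar>"
    have "hnorm u ^ (2 * k) * ?n j x u \<le> (CARD('n) * sqrt \<bar>u $ lastc\<bar>) ^ (2 * k) * ?n j x u"
      by (intro mult_right_mono power_mono i hnorm_nonneg) auto
    also have "\<dots> = CARD('n) ^ (2 * k) * (\<bar>u $ lastc\<bar> ^ k * ?n j x u)" by (simp add: power_mult_distrib power_mult)
    also have "\<dots> \<le> CARD('n) ^ (2 * k) * \<bar>D lastc k\<bar>"
      by (intro mult_left_mono order_trans[OF D abs_ge_self]) auto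
    also have "\<dots> \<le> B" unfolding B_def by (intro mult_left_mono) (auto intro!: sum_nonneg)
    finally show ?thesis .
  qed
  have "?n j x u \<le> max 0 (max C0 B) * max 1 (hnorm u) powr (- \<kappa>)" for j x u
  proof (cases "hnorm u \<le> 1")
    case True
    have "?n j x u \<le> max 0 (max C0 B)" using C0[of j x u] by (simp add: le_max_iff_disj)
    moreover have "max 1 (hnorm u) = 1" using True by simp
    ultimately show ?thesis by simp
  next
    case False
    then have h: "hnorm u > 1" by simp
    have "?n j x u = hnorm u powr (- real (2 * k)) * (hnorm u ^ (2 * k) * ?n j x u)"
      using h by (simp add: powr_minus powr_realpow[symmetric])
    also have "\<dots> \<le> hnorm u powr (- real (2 * k)) * B"
      by (intro mult_left_mono B) auto
    also have "\<dots> \<le> hnorm u powr (- real (2 * k)) * max 0 (max C0 B)"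
      by (intro mult_left_mono) auto
    also have "\<dots> \<le> hnorm u powr (- \<kappa>) * max 0 (max C0 B)"
      using h k by (intro mult_right_mono powr_mono) auto
    finally show ?thesis using h by (simp add: mult.commute max_def)
  qed
  then show ?thesis by (intro exI[of _ "max 0 (max C0 B)"]) auto
qed

text \<open>The rescaled transform of one dyadic block; with s = m + Q it is the transform of
  \<open>atom m\<close> at the same scale.\<close>

definition piece :: "real \<Rightarrow> real \<Rightarrow> (nat \<Rightarrow> real) \<Rightarrow> (nat \<Rightarrow> (real, 'n::{finite,linorder}) vec \<times> (real, 'n) vec \<Rightarrow> complex) \<Rightarrow>
    nat \<Rightarrow> (real, 'n) vec \<times> (real, 'n) vec \<Rightarrow> complex" where
  "piece \<tau> s R c j p = R j powr s *\<^sub>R FT \<tau> (c j) (dil2 (R j) p)"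

lemma piece_smooth:
  assumes "compact K" "compact_family K c"
  shows "smooth_on UNIV (piece \<tau> s R c j)"
  unfolding piece_def[abs_def]
  by (intro smooth_on_scaleR smooth_on_linear_comp[OF bounded_linear_dil2 FT_smooth[OF assms]]) auto

lemma cderiv_piece:
  fixes c :: "nat \<Rightarrow> (real, 'n::{finite,linorder}) vec \<times> (real, 'n) vec \<Rightarrow> complex"
  assumes "compact K" "compact_family K c" "R j > 0"
  shows "cderiv l (piece \<tau> s R c j) p = R j powr (s + lwt l) *\<^sub>R cderiv l (FT \<tau> (c j)) (dil2 (R j) p)"
proof -
  have "smooth_on UNIV (\<lambda>p. FT \<tau> (c j) (dil2 (R j) p))"
    by (intro smooth_on_linear_comp[OF bounded_linear_dil2 FT_smooth[OF assms(1,2)]]) auto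
  from iterdir_scaleR[OF open_UNIV this UNIV_I, of "map cdir l" "R j powr s" p]
  have "cderiv l (piece \<tau> s R c j) p = R j powr s *\<^sub>R cderiv l (\<lambda>p. FT \<tau> (c j) (dil2 (R j) p)) p"
    by (simp add: cderiv_def piece_def[abs_def])
  also have "\<dots> = R j powr s *\<^sub>R R j ^ lwt l *\<^sub>R cderiv l (FT \<tau> (c j)) (dil2 (R j) p)"
    by (subst cderiv_dil2[OF open_UNIV FT_smooth[OF assms(1,2)]]) auto
  finally show ?thesis using assms(3) by (simp add: powr_add powr_realpow)
qed

lemma piece_bound:
  fixes c :: "nat \<Rightarrow> (real, 'n::{finite,linorder}) vec \<times> (real, 'n) vec \<Rightarrow> complex"
  assumes K: "compact K" and c: "compact_family K c" and \<tau>: "\<tau> \<noteq> 0" and R: "\<And>j. R j > 0" and \<kappa>: "\<kappa> \<ge> 0"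
  shows "\<exists>C\<ge>0. \<forall>j x u. norm (cderiv l (piece \<tau> s R c j) (x, u)) \<le> C * (R j powr (s + lwt l) * max 1 (R j * hnorm u) powr (- \<kappa>))"
proof -
  obtain C where C: "C \<ge> 0" "\<And>j x u. norm (cderiv l (FT \<tau> (c j)) (x, u)) \<le> C * max 1 (hnorm u) powr (- \<kappa>)"
    using FT_hnorm_decay[OF K c \<tau> \<kappa>, of l] by blast
  have "norm (cderiv l (piece \<tau> s R c j) (x, u)) \<le> C * (R j powr (s + lwt l) * max 1 (R j * hnorm u) powr (- \<kappa>))" for j x u
  proof -
    have "norm (cderiv l (piece \<tau> s R c j) (x, u)) = R j powr (s + lwt l) * norm (cderiv l (FT \<tau> (c j)) (x, dil (R j) u))"
      by (subst cderiv_piece[OF K c R]) (simp add: dil2_def)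
    also have "\<dots> \<le> R j powr (s + lwt l) * (C * max 1 (hnorm (dil (R j) u)) powr (- \<kappa>))"
      by (intro mult_left_mono C) auto
    finally show ?thesis by (simp add: hnorm_dil[OF R] mult_ac)
  qed
  with C(1) show ?thesis by blast
qed

lemma smooth_on_suminf_cderiv:
  fixes g :: "nat \<Rightarrow> (real, 'n::{finite,linorder}) vec \<times> (real, 'n) vec \<Rightarrow> complex"
  assumes S: "open S" and g: "\<And>j. smooth_on S (g j)"
    and bound: "\<And>l p. p \<in> S \<Longrightarrow> \<exists>U M. open U \<and> p \<in> U \<and> U \<subseteq> S \<and> summable M \<and> (\<forall>j. \<forall>q\<in>U. norm (cderiv l (g j) q) \<le> M j)"
  shows "smooth_on S (\<lambda>p. \<Sum>j. g j p)" "\<And>p l. p \<in> S \<Longrightarrow> cderiv l (\<lambda>p. \<Sum>j. g j p) p = (\<Sum>j. cderiv l (g j) p)"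
proof -
  have b: "\<exists>U M. open U \<and> p \<in> U \<and> U \<subseteq> S \<and> summable M \<and> (\<forall>j. \<forall>q\<in>U. norm (iterdir vs (g j) q) \<le> M j)" if p: "p \<in> S" for vs p
  proof -
    let ?L = "{l :: ('n + 'n) list. length l = length vs}"
    obtain U M where UM: "\<And>l. open (U l) \<and> p \<in> U l \<and> U l \<subseteq> S \<and> summable (M l) \<and> (\<forall>j. \<forall>q\<in>U l. norm (cderiv l (g j) q) \<le> M l j)"
      using bound[OF p] by metis
    obtain C where C: "C \<ge> 0" "\<And>q j. q \<in> S \<Longrightarrow> norm (iterdir vs (g j) q) \<le> C * (\<Sum>l\<in>?L. norm (cderiv l (g j) q))"
      using iterdir_le_cderiv[of vs] S g by meson
    have ne: "?L \<noteq> {}" using Ex_list_of_length by auto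
    show ?thesis
    \<comment> \<open>Each coordinate word brings its own neighbourhood and majorant. There are
      finitely many words of the given length, so the neighbourhoods are intersected and the
      majorants added.\<close>
    proof (intro exI[of _ "\<Inter>l\<in>?L. U l"] exI[of _ "\<lambda>j. C * (\<Sum>l\<in>?L. M l j)"] conjI allI ballI)
      show "open (\<Inter>l\<in>?L. U l)" by (intro open_INT finite_lists_length ballI) (use UM in blast)
      show sub: "(\<Inter>l\<in>?L. U l) \<subseteq> S" using ne UM by blast
      show "summable (\<lambda>j. C * (\<Sum>l\<in>?L. M l j))" by (intro summable_mult summable_sum) (use UM in blast)
      fix j q assume q: "q \<in> (\<Inter>l\<in>?L. U l)"
      have "(\<Sum>l\<in>?L. norm (cderiv l (g j) q)) \<le> (\<Sum>l\<in>?L. M l j)"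
        by (intro sum_mono) (use UM q in blast)
      then show "norm (iterdir vs (g j) q) \<le> C * (\<Sum>l\<in>?L. M l j)"
        using C(2)[of q j] q sub C(1) by (meson mult_left_mono order_trans subsetD)
    qed (use UM in blast)
  qed
  show "smooth_on S (\<lambda>p. \<Sum>j. g j p)" using smooth_on_suminf(1)[OF S g b] .
  show "\<And>p l. p \<in> S \<Longrightarrow> cderiv l (\<lambda>p. \<Sum>j. g j p) p = (\<Sum>j. cderiv l (g j) p)"
    unfolding cderiv_def using smooth_on_suminf(2)[OF S g b] .
qed

text \<open>The positive exponent \<open>s\<close> makes the terms with R \<open>hnorm u\<close> < 1
  sum like a geometric series dominated by its last term; decay of the transforms handles the
  remaining scales.\<close>

lemma kernel_series:
  fixes c :: "nat \<Rightarrow> (real, 'n::{finite,linorder}) vec \<times> (real, 'n) vec \<Rightarrow> complex"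
  assumes K: "compact K" and c: "compact_family K c" and \<tau>: "\<tau> \<noteq> 0" and s: "s > 0"
  defines "R \<equiv> (\<lambda>j::nat. 2 ^ j :: real)"
  defines "k \<equiv> (\<lambda>p. \<Sum>j. piece \<tau> s R c j p)"
  shows "smooth_on (UNIV \<times> (UNIV - {0})) k"
    and "\<And>l M. M \<ge> 0 \<Longrightarrow> \<exists>C. \<forall>x u. u \<noteq> 0 \<longrightarrow> norm (cderiv l k (x, u)) \<le> C * hnorm u powr (- s - lwt l - M)"
    and "\<And>x u. u \<noteq> 0 \<Longrightarrow> summable (\<lambda>j. norm (piece \<tau> s R c j (x, u)))"
proof -
  let ?S = "UNIV \<times> (UNIV - {0}) :: ((real, 'n) vec \<times> (real, 'n) vec) set"
  have R: "R j > 0" for j by (simp add: R_def)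
  have S: "open ?S" by (intro open_Times) auto
  \<comment> \<open>Decay of order \<sigma> + M leaves the factor 2^(-M j), hence convergence when M
    > 0. The free lower bound \<open>h\<close> makes the estimate uniform on a neighbourhood of a
    point with u nonzero; M = 1 is used for the differentiability of the series.\<close>
  have fast: "\<exists>C\<ge>0. \<forall>j x u h. 0 < h \<longrightarrow> h \<le> hnorm u \<longrightarrow>
      norm (cderiv l (piece \<tau> s R c j) (x, u)) \<le> C * h powr (- s - lwt l - M) * (1/2) powr (M * real j)" if M: "M \<ge> 0" for l M
  proof -
    define \<sigma> where "\<sigma> = s + lwt l"
    have \<sigma>: "\<sigma> > 0" using s by (simp add: \<sigma>_def)
    obtain C where C: "C \<ge> 0" "\<And>j x u. norm (cderiv l (piece \<tau> s R c j) (x, u)) \<le> C * (R j powr \<sigma> * max 1 (R j * hnorm u) powr (- (\<sigma> + M)))"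
      using piece_bound[where s=s and l=l and R=R, OF K c \<tau> R, of "\<sigma> + M"] M \<sigma> unfolding \<sigma>_def[symmetric] by auto
    have "norm (cderiv l (piece \<tau> s R c j) (x, u)) \<le> C * h powr (- s - lwt l - M) * (1/2) powr (M * real j)"
      if h: "0 < h" "h \<le> hnorm u" for j x u h
    proof -
      have "R j powr \<sigma> * max 1 (R j * hnorm u) powr (- (\<sigma> + M)) \<le> R j powr \<sigma> * (R j * h) powr (- (\<sigma> + M))"
        using h R[of j] \<sigma> M
        by (intro mult_left_mono powr_mono2') (auto simp: le_max_iff_disj)
      also have "\<dots> = h powr (- (\<sigma> + M)) * (R j powr \<sigma> * R j powr (- (\<sigma> + M)))"
        using h R[of j] by (simp add: powr_mult)
      also have "R j powr \<sigma> * R j powr (- (\<sigma> + M)) = (1/2) powr (M * real j)"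
        using R[of j] by (simp add: powr_add[symmetric] R_def powr_realpow[symmetric] powr_powr powr_divide powr_minus field_simps)
      finally have le: "R j powr \<sigma> * max 1 (R j * hnorm u) powr (- (\<sigma> + M)) \<le> h powr (- (\<sigma> + M)) * (1/2) powr (M * real j)" .
      have e: "- s - real (lwt l) - M = - (\<sigma> + M)" by (simp add: \<sigma>_def)
      show ?thesis using order_trans[OF C(2)[of j x u] mult_left_mono[OF le C(1)]] unfolding e by (simp only: mult.assoc)
    qed
    with C(1) show ?thesis by blast
  qed
  have half: "summable (\<lambda>j. B * (1/2) powr (1 * real j))" for B :: real
    by (intro summable_mult) (simp add: powr_realpow summable_geometric)
  have loc: "\<exists>U M. open U \<and> p \<in> U \<and> U \<subseteq> ?S \<and> summable M \<and> (\<forall>j. \<forall>q\<in>U. norm (cderiv l (piece \<tau> s R c j) q) \<le> M j)" if p: "p \<in> ?S" for l p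
  proof -
    define h where "h = hnorm (snd p) / 2"
    have "snd p \<noteq> 0" using p by auto
    then have h: "h > 0" using hnorm_pos[of "snd p"] by (simp add: h_def)
    obtain C where C: "C \<ge> 0" "\<And>j x u. h \<le> hnorm u \<Longrightarrow>
      norm (cderiv l (piece \<tau> s R c j) (x, u)) \<le> C * h powr (- s - lwt l - 1) * (1/2) powr (1 * real j)"
      using fast[of 1 l] h by auto
    let ?U = "{q :: (real, 'n) vec \<times> (real, 'n) vec. h < hnorm (snd q)}"
    show ?thesis
    proof (intro exI[of _ ?U] exI conjI allI ballI)
      show "open ?U" by (intro open_Collect_less continuous_on_compose2[OF continuous_on_hnorm[of UNIV]] continuous_intros) auto
      show "p \<in> ?U" using h by (simp add: h_def)
      show "?U \<subseteq> ?S"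
      proof
        fix q :: "(real, 'n) vec \<times> (real, 'n) vec" assume "q \<in> ?U"
        then have "hnorm (snd q) \<noteq> 0" using h by auto
        then show "q \<in> ?S" using hnorm_eq_0_iff[of "snd q"] by (cases q) auto
      qed
      show "summable (\<lambda>j. C * h powr (- s - lwt l - 1) * (1/2) powr (1 * real j))" by (rule half)
      show "norm (cderiv l (piece \<tau> s R c j) q) \<le> C * h powr (- s - lwt l - 1) * (1/2) powr (1 * real j)" if "q \<in> ?U" for j q
        using C(2)[of "snd q" j "fst q"] that by simp
    qed
  qed
  note sm = smooth_on_suminf_cderiv[OF S smooth_on_subset[OF piece_smooth[OF K c] subset_UNIV] loc]
  show "smooth_on ?S k" unfolding k_def by (rule sm(1))
  have cd: "cderiv l k (x, u) = (\<Sum>j. cderiv l (piece \<tau> s R c j) (x, u))" if "u \<noteq> 0" for l x u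
    unfolding k_def by (rule sm(2)) (use that in auto)
  show "\<exists>C. \<forall>x u. u \<noteq> 0 \<longrightarrow> norm (cderiv l k (x, u)) \<le> C * hnorm u powr (- s - lwt l - M)" if M: "M \<ge> 0" for l M
  proof (cases "M = 0")
    case False
    obtain C where C: "C \<ge> 0" "\<And>j x u h. 0 < h \<Longrightarrow> h \<le> hnorm u \<Longrightarrow>
      norm (cderiv l (piece \<tau> s R c j) (x, u)) \<le> C * h powr (- s - lwt l - M) * (1/2) powr (M * real j)"
      using fast[OF M, of l] by blast
    define q :: real where "q = (1/2) powr M"
    have q: "0 < q" "q < 1" using False M powr_less_mono'[of "1/2::real" 0 M] by (auto simp: q_def)
    have qj: "(1/2) powr (M * real j) = q ^ j" for j using q(1) by (simp add: q_def powr_powr[symmetric] powr_realpow)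
    have geo: "(\<Sum>j<J. q ^ j) \<le> 1 / (1 - q)" for J
      using sum_le_suminf[of "\<lambda>n. q ^ n" "{..<J}"] suminf_geometric[of q] q by (auto simp: summable_geometric)
    have "norm (cderiv l k (x, u)) \<le> (C * (1 / (1 - q))) * hnorm u powr (- s - lwt l - M)" if u: "u \<noteq> 0" for x u
      unfolding cd[OF u]
    proof (rule suminf_norm_le(2))
      fix J
      have "(\<Sum>j<J. norm (cderiv l (piece \<tau> s R c j) (x, u))) \<le> (\<Sum>j<J. C * hnorm u powr (- s - lwt l - M) * q ^ j)"
        by (intro sum_mono order_trans[OF C(2)[OF hnorm_pos[OF u] order_refl]]) (simp add: qj)
      also have "\<dots> = C * hnorm u powr (- s - lwt l - M) * (\<Sum>j<J. q ^ j)" by (simp add: sum_distrib_left)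
      also have "\<dots> \<le> C * hnorm u powr (- s - lwt l - M) * (1 / (1 - q))"
        using C(1) by (intro mult_left_mono geo) auto
      finally show "(\<Sum>j<J. norm (cderiv l (piece \<tau> s R c j) (x, u))) \<le> (C * (1 / (1 - q))) * hnorm u powr (- s - lwt l - M)"
        by (simp add: mult_ac)
    qed
    then show ?thesis by blast
  next
    \<comment> \<open>For M = 0 the geometric factor is lost. Decay of order 2\<sigma> turns each
      term into \<open>hnorm u\<close> to the power -\<sigma> times a tent at R
      \<open>hnorm u\<close>, and these tents sum uniformly.\<close>
    case True
    define \<sigma> where "\<sigma> = s + lwt l"
    have \<sigma>: "\<sigma> > 0" using s by (simp add: \<sigma>_def)
    obtain C where C: "C \<ge> 0" "\<And>j x u. norm (cderiv l (piece \<tau> s R c j) (x, u)) \<le> C * (R j powr \<sigma> * max 1 (R j * hnorm u) powr (- (2 * \<sigma>)))"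
      using piece_bound[where s=s and l=l and R=R, OF K c \<tau> R, of "2 * \<sigma>"] \<sigma> unfolding \<sigma>_def[symmetric] by auto
    obtain B where B: "B \<ge> 0" "\<And>t F. t > 0 \<Longrightarrow> finite F \<Longrightarrow> (\<Sum>i\<in>F. tent \<sigma> (2 powr of_int i * t)) \<le> B"
      using dyadic_tent_sum[OF \<sigma>] by blast
    have "norm (cderiv l k (x, u)) \<le> (C * B) * hnorm u powr (- s - lwt l - M)" if u: "u \<noteq> 0" for x u
      unfolding cd[OF u]
    proof (rule suminf_norm_le(2))
      fix J
      have h: "hnorm u > 0" by (rule hnorm_pos[OF u])
      have "norm (cderiv l (piece \<tau> s R c j) (x, u)) \<le> C * hnorm u powr (- \<sigma>) * tent \<sigma> (2 powr of_int (int j) * hnorm u)" for j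
      proof -
        have Rj: "2 powr of_int (int j) = R j" by (simp add: R_def powr_realpow)
        have "hnorm u powr (- \<sigma>) * tent \<sigma> (R j * hnorm u) = R j powr \<sigma> * max 1 (R j * hnorm u) powr (- (2 * \<sigma>))"
          using h R[of j] by (simp add: tent_def powr_mult powr_minus field_simps)
        then show ?thesis using C(2)[of j x u] unfolding Rj by (simp add: mult.assoc)
      qed
      then have "(\<Sum>j<J. norm (cderiv l (piece \<tau> s R c j) (x, u))) \<le> C * hnorm u powr (- \<sigma>) * (\<Sum>j<J. tent \<sigma> (2 powr of_int (int j) * hnorm u))"
        by (simp add: sum_distrib_left sum_mono)
      also have "(\<Sum>j<J. tent \<sigma> (2 powr of_int (int j) * hnorm u)) = (\<Sum>i\<in>int ` {..<J}. tent \<sigma> (2 powr of_int i * hnorm u))"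
        by (subst sum.reindex) (auto simp: inj_on_def)
      also have "C * hnorm u powr (- \<sigma>) * \<dots> \<le> C * hnorm u powr (- \<sigma>) * B"
        using C(1) h by (intro mult_left_mono B) auto
      finally show "(\<Sum>j<J. norm (cderiv l (piece \<tau> s R c j) (x, u))) \<le> (C * B) * hnorm u powr (- s - lwt l - M)"
        using True by (simp add: mult_ac \<sigma>_def)
    qed
    then show ?thesis by blast
  qed
  show "summable (\<lambda>j. norm (piece \<tau> s R c j (x, u)))" if u: "u \<noteq> 0" for x u
  proof -
    obtain M where M: "summable M" "\<And>j. norm (cderiv [] (piece \<tau> s R c j) (x, u)) \<le> M j"
      using loc[of "(x, u)" "[]"] u by auto
    show ?thesis by (rule summable_comparison_test'[OF M(1), of 0]) (use M(2) in \<open>simp add: cderiv_def\<close>)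
  qed
qed

text \<open>\<open>int_decode\<close> is injective, so every partial sum runs over a finite set of
  integer scales and the uniform bound applies.\<close>

lemma summable_tent:
  assumes "\<sigma> > 0"
  shows "summable (\<lambda>j. B * tent \<sigma> (2 powr of_int (int_decode j)))"
proof -
  obtain B where B: "B \<ge> 0" "\<And>t F. t > 0 \<Longrightarrow> finite F \<Longrightarrow> (\<Sum>i\<in>F. tent \<sigma> (2 powr of_int i * t)) \<le> B"
    using dyadic_tent_sum[OF assms] by blast
  have "(\<Sum>j<J. tent \<sigma> (2 powr of_int (int_decode j))) \<le> B" for J
  proof -
    have "(\<Sum>j<J. tent \<sigma> (2 powr of_int (int_decode j))) = (\<Sum>i\<in>int_decode ` {..<J}. tent \<sigma> (2 powr of_int i * 1))"
      by (subst sum.reindex) (auto simp: inj_on_def inj_int_decode[THEN inj_eq])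
    also have "\<dots> \<le> B" by (rule B) auto
    finally show ?thesis .
  qed
  then show ?thesis by (intro summable_mult summableI_nonneg_bounded tent_nonneg)
qed

text \<open>The scales \<open>2 powr i\<close> range over all integers \<open>i\<close>, enumerated by \<open>int_decode\<close>.\<close>

lemma symbol_series:
  fixes c :: "nat \<Rightarrow> (real, 'n::{finite,linorder}) vec \<times> (real, 'n) vec \<Rightarrow> complex"
  assumes K: "compact K" and \<tau>: "\<tau> \<noteq> 0" and s: "s > 0"
  defines "R \<equiv> (\<lambda>j::nat. 2 powr of_int (int_decode j) :: real)"
  assumes c: "\<And>M. M \<ge> 0 \<Longrightarrow> compact_family K (\<lambda>j p. (max 1 (R j) powr M) *\<^sub>R c j p)"
  defines "a \<equiv> (\<lambda>p. \<Sum>j. piece \<tau> s R c j p)"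
  shows "smooth_on UNIV a"
    and "\<And>l. \<exists>C. \<forall>x u. norm (cderiv l a (x, u)) \<le> C * (1 + hnorm u) powr (- s - lwt l)"
    and "\<exists>M. summable M \<and> (\<forall>j p. norm (piece \<tau> s R c j p) \<le> M j)"
proof -
  have R: "R j > 0" for j by (simp add: R_def)
  have "max 1 (R j) powr 0 = 1" for j using less_le_trans[OF zero_less_one max.cobounded1[of 1 "R j"]] by simp
  then have c0: "compact_family K c" using c[of 0] by simp
  have bd: "\<exists>C\<ge>0. \<forall>j x u. norm (cderiv l (piece \<tau> s R c j) (x, u)) \<le>
      C * (max 1 (R j) powr (- 2 * (s + lwt l)) * (R j powr (s + lwt l) * max 1 (R j * hnorm u) powr (- 2 * (s + lwt l))))" for l
  proof -
    \<comment> \<open>With this exponent the weight in front of R^(s+w) completes it to a tent in R: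
      positivity of s + w handles small scales and the extra decay of the kernel handles large
      ones.\<close>
    define M where "M = 2 * (s + lwt l)"
    have M: "M \<ge> 0" using s by (simp add: M_def)
    define d where "d = (\<lambda>j p. (max 1 (R j) powr M) *\<^sub>R c j p)"
    have d: "compact_family K d" unfolding d_def by (rule c[OF M])
    obtain C where C: "C \<ge> 0" "\<And>j x u. norm (cderiv l (piece \<tau> s R d j) (x, u)) \<le> C * (R j powr (s + lwt l) * max 1 (R j * hnorm u) powr (- M))"
      using piece_bound[where s=s and l=l and R=R, OF K d \<tau> R M] by blast
    have "norm (cderiv l (piece \<tau> s R c j) (x, u)) \<le> C * (max 1 (R j) powr (- M) * (R j powr (s + lwt l) * max 1 (R j * hnorm u) powr (- M)))" for j x u
    proof -
      have "FT \<tau> (d j) q = max 1 (R j) powr M *\<^sub>R FT \<tau> (c j) q" for q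
        unfolding FT_def d_def by (subst integral_scaleR_right[symmetric]) (simp add: scaleR_conv_of_real mult_ac)
      then have "piece \<tau> s R c j = (\<lambda>q. max 1 (R j) powr (- M) *\<^sub>R piece \<tau> s R d j q)"
        by (simp add: piece_def fun_eq_iff powr_add[symmetric])
      then have "cderiv l (piece \<tau> s R c j) (x, u) = max 1 (R j) powr (- M) *\<^sub>R cderiv l (piece \<tau> s R d j) (x, u)"
        unfolding cderiv_def using iterdir_scaleR[OF open_UNIV piece_smooth[OF K d] UNIV_I] by metis
      then show ?thesis using mult_left_mono[OF C(2)[of j x u], of "max 1 (R j) powr (- M)"] by (simp add: mult_ac)
    qed
    with C(1) show ?thesis unfolding M_def by (intro exI[of _ C]) simp
  qed
  have le1: "max 1 y powr (- 2 * \<sigma>) \<le> 1" if "\<sigma> > 0" for y \<sigma> :: real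
    using that powr_mono[of "- 2 * \<sigma>" 0 "max 1 y"] by (cases "y \<le> 1") (auto simp: max_def)
  have glob: "\<exists>M. summable M \<and> (\<forall>j q. norm (cderiv l (piece \<tau> s R c j) q) \<le> M j)" for l
  proof -
    define \<sigma> where "\<sigma> = s + lwt l"
    have \<sigma>: "\<sigma> > 0" using s by (simp add: \<sigma>_def)
    obtain C where C: "C \<ge> 0" "\<And>j x u. norm (cderiv l (piece \<tau> s R c j) (x, u)) \<le>
      C * (max 1 (R j) powr (- 2 * \<sigma>) * (R j powr \<sigma> * max 1 (R j * hnorm u) powr (- 2 * \<sigma>)))"
      using bd[of l] unfolding \<sigma>_def by blast
    have "norm (cderiv l (piece \<tau> s R c j) (x, u)) \<le> C * tent \<sigma> (R j)" for j x u
    proof -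
      have "R j powr \<sigma> * max 1 (R j * hnorm u) powr (- 2 * \<sigma>) \<le> R j powr \<sigma> * 1"
        by (intro mult_left_mono le1 \<sigma>) auto
      then have "max 1 (R j) powr (- 2 * \<sigma>) * (R j powr \<sigma> * max 1 (R j * hnorm u) powr (- 2 * \<sigma>)) \<le> max 1 (R j) powr (- 2 * \<sigma>) * (R j powr \<sigma> * 1)"
        by (rule mult_left_mono) simp
      from order_trans[OF C(2) mult_left_mono[OF this C(1)]] show ?thesis by (simp add: tent_def mult.commute)
    qed
    then show ?thesis using summable_tent[OF \<sigma>, of C] by (intro exI[of _ "\<lambda>j. C * tent \<sigma> (R j)"]) (auto simp: R_def)
  qed
  then have loc: "\<exists>U M. open U \<and> p \<in> U \<and> U \<subseteq> UNIV \<and> summable M \<and> (\<forall>j. \<forall>q\<in>U. norm (cderiv l (piece \<tau> s R c j) q) \<le> M j)"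
    if "p \<in> UNIV" for l p
    using glob[of l] by (intro exI[of _ UNIV]) auto
  note sm = smooth_on_suminf_cderiv[OF open_UNIV piece_smooth[OF K c0] loc]
  show "smooth_on UNIV a" unfolding a_def by (rule sm(1))
  show "\<exists>M. summable M \<and> (\<forall>j p. norm (piece \<tau> s R c j p) \<le> M j)"
    using glob[of "[]"] by (simp add: cderiv_def)
  fix l :: "('n + 'n) list"
  define \<sigma> where "\<sigma> = s + lwt l"
  have \<sigma>: "\<sigma> > 0" using s by (simp add: \<sigma>_def)
  obtain C where C: "C \<ge> 0" "\<And>j x u. norm (cderiv l (piece \<tau> s R c j) (x, u)) \<le>
      C * (max 1 (R j) powr (- 2 * \<sigma>) * (R j powr \<sigma> * max 1 (R j * hnorm u) powr (- 2 * \<sigma>)))"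
    using bd[of l] unfolding \<sigma>_def by blast
  obtain B where B: "B \<ge> 0" "\<And>t F. t > 0 \<Longrightarrow> finite F \<Longrightarrow> (\<Sum>i\<in>F. tent \<sigma> (2 powr of_int i * t)) \<le> B"
    using dyadic_tent_sum[OF \<sigma>] by blast
  have "norm (cderiv l a (x, u)) \<le> (C * B * 2 powr \<sigma>) * (1 + hnorm u) powr (- s - lwt l)" for x u :: "(real, 'n) vec"
  proof -
    \<comment> \<open>For \<open>hnorm u\<close> at most 1 the tent comes from the weight max(1, R),
      otherwise from the decay in R \<open>hnorm u\<close>; with \<open>t\<close> both cases take
      the same form.\<close>
    define t where "t = max 1 (hnorm u)"
    have t: "t \<ge> 1" by (simp add: t_def)
    have le: "norm (cderiv l (piece \<tau> s R c j) (x, u)) \<le> C * t powr (- \<sigma>) * tent \<sigma> (2 powr of_int (int_decode j) * t)" for j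
    proof -
      have "max 1 (R j) powr (- 2 * \<sigma>) * (R j powr \<sigma> * max 1 (R j * hnorm u) powr (- 2 * \<sigma>)) \<le> R j powr \<sigma> * max 1 (R j * t) powr (- 2 * \<sigma>)"
      proof (cases "hnorm u \<le> 1")
        case True
        have "R j powr \<sigma> * max 1 (R j * hnorm u) powr (- 2 * \<sigma>) \<le> R j powr \<sigma> * 1"
          by (intro mult_left_mono le1 \<sigma>) auto
        then have "max 1 (R j) powr (- 2 * \<sigma>) * (R j powr \<sigma> * max 1 (R j * hnorm u) powr (- 2 * \<sigma>)) \<le> max 1 (R j) powr (- 2 * \<sigma>) * (R j powr \<sigma> * 1)"
          by (rule mult_left_mono) simp
        moreover have "t = 1" using True by (simp add: t_def)
        ultimately show ?thesis by (simp add: mult.commute)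
      next
        case False
        have "max 1 (R j) powr (- 2 * \<sigma>) * (R j powr \<sigma> * max 1 (R j * hnorm u) powr (- 2 * \<sigma>)) \<le> 1 * (R j powr \<sigma> * max 1 (R j * hnorm u) powr (- 2 * \<sigma>))"
          by (intro mult_right_mono le1 \<sigma>) auto
        moreover have "t = hnorm u" using False by (simp add: t_def)
        ultimately show ?thesis by simp
      qed
      also have "\<dots> = t powr (- \<sigma>) * tent \<sigma> (R j * t)"
        using t R[of j] by (simp add: tent_def powr_mult powr_minus field_simps)
      finally show ?thesis using order_trans[OF C(2) mult_left_mono[OF _ C(1)]] by (simp add: R_def mult.assoc)
    qed
    have cd: "cderiv l a (x, u) = (\<Sum>j. cderiv l (piece \<tau> s R c j) (x, u))"
      unfolding a_def by (rule sm(2)) auto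
    have "norm (cderiv l a (x, u)) \<le> C * t powr (- \<sigma>) * B"
      unfolding cd
    proof (rule suminf_norm_le(2))
      fix J
      have "(\<Sum>j<J. norm (cderiv l (piece \<tau> s R c j) (x, u))) \<le> C * t powr (- \<sigma>) * (\<Sum>j<J. tent \<sigma> (2 powr of_int (int_decode j) * t))"
        using le by (simp add: sum_distrib_left sum_mono)
      also have "(\<Sum>j<J. tent \<sigma> (2 powr of_int (int_decode j) * t)) = (\<Sum>i\<in>int_decode ` {..<J}. tent \<sigma> (2 powr of_int i * t))"
        by (subst sum.reindex) (auto simp: inj_on_def inj_int_decode[THEN inj_eq])
      also have "C * t powr (- \<sigma>) * \<dots> \<le> C * t powr (- \<sigma>) * B"
        using C(1) t by (intro mult_left_mono B) auto
      finally show "(\<Sum>j<J. norm (cderiv l (piece \<tau> s R c j) (x, u))) \<le> C * t powr (- \<sigma>) * B" .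
    qed
    also have "\<dots> \<le> C * (2 powr \<sigma> * (1 + hnorm u) powr (- \<sigma>)) * B"
    proof (intro mult_left_mono mult_right_mono B C)
      \<comment> \<open>The maximum of 1 and \<open>hnorm u\<close> is at least their mean, which is
        the origin of the factor 2^\<sigma>.\<close>
      have "t powr (- \<sigma>) \<le> ((1 + hnorm u) / 2) powr (- \<sigma>)"
        using \<sigma> hnorm_nonneg[of u] by (intro powr_mono2') (auto simp: t_def)
      also have "\<dots> = 2 powr \<sigma> * (1 + hnorm u) powr (- \<sigma>)"
        using hnorm_nonneg[of u] by (simp add: powr_divide powr_minus field_simps)
      finally show "t powr (- \<sigma>) \<le> 2 powr \<sigma> * (1 + hnorm u) powr (- \<sigma>)" .
    qed
    finally show ?thesis by (simp add: \<sigma>_def mult_ac)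
  qed
  then show "\<exists>C. \<forall>x u. norm (cderiv l a (x, u)) \<le> C * (1 + hnorm u) powr (- s - lwt l)" by blast
qed

subsection \<open>Multi-indices and lists of directions\<close>

definition index_list :: "('n::{finite,linorder} \<Rightarrow> nat) \<Rightarrow> 'n list" where
  "index_list \<alpha> = concat (map (\<lambda>i. replicate (\<alpha> i) i) (sorted_list_of_set UNIV))"

lemma count_index_list: "count (mset (index_list \<alpha>)) i = \<alpha> i"
proof -
  have "count (mset (concat (map (\<lambda>i. replicate (\<alpha> i) i) xs))) i = (if i \<in> set xs then \<alpha> i else 0)" if "distinct xs" for xs
    using that by (induction xs) auto
  from this[of "sorted_list_of_set UNIV"] show ?thesis by (simp add: index_list_def)
qed

lemma mset_index_list: "mset (index_list (\<lambda>i. count (mset l) i)) = mset l"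
  by (rule multiset_eqI) (simp add: count_index_list)

lemma mderiv_eq_iterdir: "mderiv \<alpha> f = iterdir (map (\<lambda>i. axis i 1) (index_list \<alpha>)) f"
  unfolding mderiv_def index_list_def by (simp add: map_concat o_def)

lemma sum_list_index_list: "sum_list (map wt (index_list \<alpha>)) = hord \<alpha>"
proof -
  have "sum_list (map wt (concat (map (\<lambda>i. replicate (\<alpha> i) i) xs))) = (\<Sum>i\<in>set xs. \<alpha> i * wt i)" if "distinct xs" for xs :: "'a list"
    using that by (induction xs) (auto simp: sum_list_replicate)
  from this[of "sorted_list_of_set UNIV"]
  have "sum_list (map wt (index_list \<alpha>)) = (\<Sum>i\<in>UNIV. \<alpha> i * wt i)" by (simp add: index_list_def)
  also have "\<dots> = \<alpha> lastc * wt (lastc :: 'a) + (\<Sum>i\<in>UNIV - {lastc}. \<alpha> i * wt i)" by (rule sum.remove) auto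
  also have "\<dots> = hord \<alpha>" by (simp add: hord_def wt_def)
  finally show ?thesis .
qed

lemma iterdir_Inl: "iterdir (map (cdir \<circ> Inl) l) f (x, u) = iterdir (map (\<lambda>i. axis i 1) l) (\<lambda>x. f (x, u)) x"
  by (induction l arbitrary: x) (simp_all add: cdir_def dirderiv_def)

lemma iterdir_Inr: "iterdir (map (cdir \<circ> Inr) l) f (x, u) = iterdir (map (\<lambda>i. axis i 1) l) (\<lambda>u. f (x, u)) u"
  by (induction l arbitrary: u) (simp_all add: cdir_def dirderiv_def)

lemma mderiv_mderiv:
  "mderiv I (\<lambda>x'. mderiv \<gamma> (k x') u) x = cderiv (map Inl (index_list I) @ map Inr (index_list \<gamma>)) (\<lambda>(x, u). k x u) (x, u)"
  by (simp add: cderiv_def iterdir_append iterdir_Inl iterdir_Inr mderiv_eq_iterdir del: comp_apply)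

lemma lwt_append_index_list: "lwt (map Inl l @ map Inr (index_list \<gamma>)) = hord \<gamma>"
  by (simp add: lwt_def cwt_def o_def sum_list_index_list)

text \<open>Any coordinate word can be rearranged into the normal form produced by two
  multi-indices, base-point directions in front and the others behind.\<close>

lemma split_list_mset:
  fixes l :: "('n::{finite,linorder} + 'n) list"
  shows "\<exists>I \<gamma>. mset l = mset (map Inl (index_list I) @ map Inr (index_list \<gamma>))"
proof -
  have "\<exists>l1 l2. mset l = mset (map Inl l1 @ map Inr l2)"
  proof (induction l)
    case (Cons k l)
    then obtain l1 l2 where "mset l = mset (map Inl l1 @ map Inr l2)" by blast
    then show ?case
    proof (cases k)
      case (Inl i)
      then show ?thesis using \<open>mset l = _\<close> by (intro exI[of _ "i # l1"] exI[of _ l2]) simp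
    next
      case (Inr i)
      then show ?thesis using \<open>mset l = _\<close> by (intro exI[of _ l1] exI[of _ "i # l2"]) simp
    qed
  qed (auto intro: exI[of _ "[]"])
  then obtain l1 l2 where "mset l = image_mset Inl (mset l1) + image_mset Inr (mset l2)" by auto
  then show ?thesis
    by (intro exI[of _ "\<lambda>i. count (mset l1) i"] exI[of _ "\<lambda>i. count (mset l2) i"]) (simp add: mset_index_list)
qed

text \<open>By symmetry of derivatives a word may be put in normal form, and rearranging does not
  change its weight; so bounds assumed for multi-indices hold for all words.\<close>

lemma cderiv_bound_from_mderiv:
  fixes k :: "(real, 'n::{finite,linorder}) vec \<Rightarrow> (real, 'n) vec \<Rightarrow> complex"
  assumes S: "open S" and k: "smooth_on S (\<lambda>(x, u). k x u)"
    and bound: "\<And>I \<gamma>. \<exists>C. \<forall>x u. (x, u) \<in> S \<longrightarrow> norm (mderiv I (\<lambda>x'. mderiv \<gamma> (k x') u) x) \<le> C * g (hord \<gamma>) u"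
  shows "\<exists>C. \<forall>x u. (x, u) \<in> S \<longrightarrow> norm (cderiv l (\<lambda>(x, u). k x u) (x, u)) \<le> C * g (lwt l) u"
proof -
  obtain I \<gamma> where m: "mset l = mset (map Inl (index_list I) @ map Inr (index_list \<gamma>))" using split_list_mset by blast
  let ?l = "map Inl (index_list I) @ map Inr (index_list \<gamma>)"
  have "lwt l = lwt ?l"
    unfolding lwt_def by (metis m mset_map sum_mset_sum_list)
  then have w: "lwt l = hord \<gamma>" by (simp only: lwt_append_index_list)
  have "cderiv l (\<lambda>(x, u). k x u) p = cderiv ?l (\<lambda>(x, u). k x u) p" if "p \<in> S" for p
    unfolding cderiv_def by (rule iterdir_mset_cong[OF S _ k that]) (metis m mset_map)
  then show ?thesis using bound[of I \<gamma>] unfolding w mderiv_mderiv by metis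
qed

subsection \<open>The determinant of the frame\<close>

lemma bdd_smooth_from_mderiv:
  fixes f :: "(real, 'n::{finite,linorder}) vec \<Rightarrow> real"
  assumes f: "smooth_on UNIV f" and bound: "\<And>\<beta>. \<exists>C. \<forall>x. \<bar>mderiv \<beta> f x\<bar> \<le> C"
  shows "bdd_smooth UNIV (\<lambda>_::'i. f)"
  unfolding bdd_smooth_def
proof (intro conjI allI f)
  fix vs :: "(real, 'n) vec list"
  let ?e = "\<lambda>i. axis i 1 :: (real, 'n) vec"
  have "\<exists>C\<ge>0. \<forall>S (f :: (real, 'n) vec \<Rightarrow> real) p. open S \<longrightarrow> smooth_on S f \<longrightarrow> p \<in> S \<longrightarrow>
     norm (iterdir vs f p) \<le> C * (\<Sum>l | length l = length vs. norm (iterdir (map ?e l) f p))"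
    by (rule iterdir_le_spanning) (use vec_eq_sum_axis in blast)
  then obtain C0 where C0: "C0 \<ge> 0" "\<And>p. norm (iterdir vs f p) \<le> C0 * (\<Sum>l | length l = length vs. norm (iterdir (map ?e l) f p))"
    using f by (metis UNIV_I open_UNIV)
  have "\<exists>C. \<forall>p. norm (iterdir (map ?e l) f p) \<le> C" for l
  proof -
    have "iterdir (map ?e l) f p = mderiv (\<lambda>i. count (mset l) i) f p" for p
      unfolding mderiv_eq_iterdir by (rule iterdir_mset_cong[OF open_UNIV _ f UNIV_I]) (metis mset_index_list mset_map)
    then show ?thesis using bound[of "\<lambda>i. count (mset l) i"] by simp
  qed
  then obtain C where C: "\<And>l p. norm (iterdir (map ?e l) f p) \<le> C l" by metis
  have "norm (iterdir vs f p) \<le> C0 * (\<Sum>l | length l = length vs. C l)" for p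
    by (rule order_trans[OF C0(2)]) (intro mult_left_mono sum_mono C C0)
  then show "\<exists>C. \<forall>j::'i. \<forall>p\<in>UNIV. norm (iterdir vs f p) \<le> C" by blast
qed

text \<open>The determinant is a polynomial in the bounded smooth entries, and its distance from 0
  gives the reciprocal.\<close>

lemma frame_det:
  fixes A :: "(real, 'n::{finite,linorder}) vec \<Rightarrow> ((real, 'n) vec, 'n) vec"
  assumes "admissible_frame A"
  shows "bdd_smooth UNIV (\<lambda>_::'i. \<lambda>x. \<bar>det (A x)\<bar>)" "bdd_smooth UNIV (\<lambda>_::'i. \<lambda>x. inverse \<bar>det (A x)\<bar>)" "\<And>x. det (A x) \<noteq> 0"
proof -
  obtain c where c: "c > 0" "\<And>x. \<bar>det (A x)\<bar> \<ge> c" using assms unfolding admissible_frame_def by blast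
  show nz: "det (A x) \<noteq> 0" for x using c(2)[of x] c(1) by auto
  have entry: "bdd_smooth UNIV (\<lambda>_::'i. \<lambda>x. A x $ i $ j)" for i j
    using assms unfolding admissible_frame_def by (intro bdd_smooth_from_mderiv) blast+
  have det: "bdd_smooth UNIV (\<lambda>_::'i. \<lambda>x. det (A x))"
    unfolding det_def by (intro bdd_smooth_sum bdd_smooth_mult bdd_smooth_prod bdd_smooth_const entry) (auto intro: finite_permutations)
  have cont: "continuous_on UNIV (\<lambda>x. det (A x))"
    using bounded_Ck_continuous[OF bdd_smooth_imp_bounded_Ck[OF det, of 0]] by blast
  \<comment> \<open>The space is connected and the determinant never vanishes, so it has constant
    sign; this makes the absolute value smooth.\<close>
  have "(\<forall>x. det (A x) > 0) \<or> (\<forall>x. det (A x) < 0)"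
  proof (rule ccontr)
    assume "\<not> ?thesis"
    then obtain x y where xy: "det (A x) \<le> 0" "det (A y) \<ge> 0" by (auto simp: not_less)
    have "connected (range (\<lambda>x. det (A x)))" using connected_continuous_image[OF cont connected_UNIV] .
    from connectedD_interval[OF this rangeI rangeI xy] obtain z where "det (A z) = 0" by auto
    then show False using nz by blast
  qed
  then obtain sg :: real where sg: "\<And>x. \<bar>det (A x)\<bar> = sg * det (A x)"
    by (metis abs_of_neg abs_of_pos minus_mult_left mult_1)
  show ab: "bdd_smooth UNIV (\<lambda>_::'i. \<lambda>x. \<bar>det (A x)\<bar>)"
    unfolding sg by (intro bdd_smooth_mult bdd_smooth_const det) auto
  show "bdd_smooth UNIV (\<lambda>_::'i. \<lambda>x. inverse \<bar>det (A x)\<bar>)"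
    by (rule bdd_smooth_inverse[OF open_UNIV c(1) _ ab]) (use c in auto)
qed

subsection \<open>Changes of variables\<close>

text \<open>The dilation is a diagonal matrix, and its determinant is R^Q because the weights of the
  coordinates add up to Q.\<close>

lemma
  fixes g :: "(real, 'n::{finite,linorder}) vec \<Rightarrow> complex"
  assumes R: "R > 0" and g: "g \<in> borel_measurable borel"
  shows integral_dil: "R ^ Qdim TYPE('n) *\<^sub>R (LINT x|lborel. g (dil R x)) = (LINT x|lborel. g x)"
    and integrable_dil: "integrable lborel (\<lambda>x. g (dil R x)) \<longleftrightarrow> integrable lborel g"
proof -
  define D :: "((real, 'n) vec, 'n) vec" where "D = (\<chi> i j. if i = j then R ^ wt i else 0)"
  have dil: "D *v x = dil R x" for x
    by (simp add: D_def dil_def matrix_vector_mult_def vec_eq_iff if_distrib if_distribR cong: if_cong)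
  have det: "det D = R ^ Qdim TYPE('n)"
    by (subst det_diagonal) (auto simp: D_def power_sum sum_wt[symmetric])
  have nz: "det D \<noteq> 0" using R by (simp add: det)
  show "R ^ Qdim TYPE('n) *\<^sub>R (LINT x|lborel. g (dil R x)) = (LINT x|lborel. g x)"
    using integral_lborel_matrix[OF nz g] R by (simp add: dil det)
  show "integrable lborel (\<lambda>x. g (dil R x)) \<longleftrightarrow> integrable lborel g"
    using integrable_lborel_matrix[OF nz g] by (simp add: dil)
qed

lemma
  fixes g :: "'a::euclidean_space \<Rightarrow> 'b::{banach,second_countable_topology}"
  assumes g [measurable]: "g \<in> borel_measurable borel"
  shows integral_lborel_reflect: "(LINT y|lborel. g (x - y)) = (LINT y|lborel. g y)"
    and integrable_lborel_reflect: "integrable lborel (\<lambda>y. g (x - y)) \<longleftrightarrow> integrable lborel g"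
proof -
  have 1: "(\<lambda>y. g (x + y)) \<in> borel_measurable borel" by measurable
  show "(LINT y|lborel. g (x - y)) = (LINT y|lborel. g y)"
    using integral_lborel_scaleR[OF _ 1, of "-1"] integral_lborel_shift[OF g, of x] by simp
  show "integrable lborel (\<lambda>y. g (x - y)) \<longleftrightarrow> integrable lborel g"
    using integrable_lborel_scaleR[OF _ 1, of "-1"] integrable_lborel_shift[OF g, of x] by simp
qed

text \<open>The inverse transpose, that is, the map dual to \<open>B\<close> for the inner product;
  at \<open>B = A x\<close> it is the linear part of \<open>Theta0\<close>.\<close>

definition cotangent :: "((real, 'n::finite) vec, 'n) vec \<Rightarrow> ((real, 'n) vec, 'n) vec" where
  "cotangent B = transpose (matrix_inv B)"

context
  fixes B :: "((real, 'n::{finite,linorder}) vec, 'n) vec"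
  assumes B: "det B \<noteq> 0"
begin

lemma cot_inner: "(cotangent B *v w) \<bullet> (B *v \<xi>) = w \<bullet> \<xi>"
proof -
  have "matrix_inv B ** B = mat 1"
    using B unfolding invertible_det_nz[symmetric] invertible_def matrix_inv_def by (rule someI2_ex) auto
  then show ?thesis
    by (simp add: cotangent_def transpose_matrix_vector dot_lmul_matrix matrix_vector_mul_assoc)
qed

lemma det_cot: "det (cotangent B) = inverse (det B)"
proof -
  have "matrix_inv B ** B = mat 1"
    using B unfolding invertible_det_nz[symmetric] invertible_def matrix_inv_def by (rule someI2_ex) auto
  then have "det (matrix_inv B) * det B = 1" by (metis det_I det_mul)
  then show ?thesis using inverse_unique[of "det B" "det (matrix_inv B)"] by (simp add: cotangent_def det_transpose mult.commute)
qed

lemma det_cot_nz: "det (cotangent B) \<noteq> 0"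
  using B by (simp only: det_cot) simp

text \<open>The Fourier transform of \<open>f\<close> is written out, Fubini exchanges the
  integrals, and the substitution \<eta> = B \<xi> absorbs the determinant while duality rewrites
  the phase.\<close>

lemma integral_forward_piece:
  fixes h f :: "(real, 'n) vec \<Rightarrow> complex"
  assumes h: "integrable lborel h" and f: "integrable lborel f"
  shows "(LINT \<xi>|lborel. of_real \<bar>det B\<bar> * h (B *v \<xi>) * fourier f \<xi> * osc (2 * pi) x \<xi>)
    = (LINT y|lborel. (LINT \<eta>|lborel. h \<eta> * osc (2 * pi) (cotangent B *v (x - y)) \<eta>) * f y)"
proof -
  have [measurable]: "h \<in> borel_measurable borel" "f \<in> borel_measurable borel"
    using borel_measurable_integrable[OF h] borel_measurable_integrable[OF f] by auto
  have hB: "integrable lborel (\<lambda>\<xi>. of_real \<bar>det B\<bar> * h (B *v \<xi>))"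
    using h B by (intro integrable_mult_right) (simp add: integrable_lborel_matrix)
  have "(LINT \<xi>|lborel. of_real \<bar>det B\<bar> * h (B *v \<xi>) * fourier f \<xi> * osc (2 * pi) x \<xi>)
     = (LINT \<xi>|lborel. LINT y|lborel. f y * (of_real \<bar>det B\<bar> * h (B *v \<xi>)) * (osc (- 2 * pi) y \<xi> * osc (2 * pi) x \<xi>))"
  proof (rule Bochner_Integration.integral_cong[OF refl])
    fix \<xi>
    have "(LINT y|lborel. f y * (of_real \<bar>det B\<bar> * h (B *v \<xi>)) * (osc (- 2 * pi) y \<xi> * osc (2 * pi) x \<xi>))
      = (LINT y|lborel. (of_real \<bar>det B\<bar> * h (B *v \<xi>) * osc (2 * pi) x \<xi>) * (f y * osc (- 2 * pi) y \<xi>))"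
      by (intro Bochner_Integration.integral_cong) (auto simp: mult_ac)
    then show "of_real \<bar>det B\<bar> * h (B *v \<xi>) * fourier f \<xi> * osc (2 * pi) x \<xi> = (LINT y|lborel. f y * (of_real \<bar>det B\<bar> * h (B *v \<xi>)) * (osc (- 2 * pi) y \<xi> * osc (2 * pi) x \<xi>))"
      unfolding fourier_osc integral_mult_right_zero by (simp add: mult_ac)
  qed
  also have "\<dots> = (LINT y|lborel. LINT \<xi>|lborel. f y * (of_real \<bar>det B\<bar> * h (B *v \<xi>)) * (osc (- 2 * pi) y \<xi> * osc (2 * pi) x \<xi>))"
    by (rule lborel_pair.Fubini_integral, rule integrable_lborel_tensor[OF f hB]) (auto simp: norm_mult)
  also have "\<dots> = (LINT y|lborel. (LINT \<eta>|lborel. h \<eta> * osc (2 * pi) (cotangent B *v (x - y)) \<eta>) * f y)"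
  proof (rule Bochner_Integration.integral_cong[OF refl])
    fix y
    have "f y * (of_real \<bar>det B\<bar> * h (B *v \<xi>)) * (osc (- 2 * pi) y \<xi> * osc (2 * pi) x \<xi>)
      = (f y * of_real \<bar>det B\<bar>) * (h (B *v \<xi>) * osc (2 * pi) (cotangent B *v (x - y)) (B *v \<xi>))" for \<xi>
      by (simp add: osc_def cot_inner cis_mult inner_diff_left algebra_simps)
    then have "(LINT \<xi>|lborel. f y * (of_real \<bar>det B\<bar> * h (B *v \<xi>)) * (osc (- 2 * pi) y \<xi> * osc (2 * pi) x \<xi>))
       = f y * (\<bar>det B\<bar> *\<^sub>R (LINT \<xi>|lborel. h (B *v \<xi>) * osc (2 * pi) (cotangent B *v (x - y)) (B *v \<xi>)))"
      by (simp only: integral_mult_right_zero scaleR_conv_of_real mult.assoc)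
    also have "\<bar>det B\<bar> *\<^sub>R (LINT \<xi>|lborel. h (B *v \<xi>) * osc (2 * pi) (cotangent B *v (x - y)) (B *v \<xi>)) = (LINT \<eta>|lborel. h \<eta> * osc (2 * pi) (cotangent B *v (x - y)) \<eta>)"
      by (rule integral_lborel_matrix[OF B]) measurable
    finally show "(LINT \<xi>|lborel. f y * (of_real \<bar>det B\<bar> * h (B *v \<xi>)) * (osc (- 2 * pi) y \<xi> * osc (2 * pi) x \<xi>))
       = (LINT \<eta>|lborel. h \<eta> * osc (2 * pi) (cotangent B *v (x - y)) \<eta>) * f y" by (simp add: mult.commute)
  qed
  finally show ?thesis .
qed

lemma integrable_cot:
  fixes h :: "(real, 'n) vec \<Rightarrow> 'b::{banach,second_countable_topology}"
  assumes h: "integrable lborel h"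
  shows "integrable lborel (\<lambda>y. h (cotangent B *v (x - y)))" "(LINT y|lborel. h (cotangent B *v (x - y))) = \<bar>det B\<bar> *\<^sub>R (LINT u|lborel. h u)"
proof -
  have [measurable]: "h \<in> borel_measurable borel"
    using borel_measurable_integrable[OF h] by auto
  have [measurable]: "(*v) (cotangent B) \<in> borel_measurable borel"
    by (intro borel_measurable_continuous_onI linear_continuous_on linear_conv_bounded_linear[THEN iffD1]) simp
  have m: "(\<lambda>w. h (cotangent B *v w)) \<in> borel_measurable borel" by measurable
  show "integrable lborel (\<lambda>y. h (cotangent B *v (x - y)))"
    using integrable_lborel_reflect[OF m, of x] integrable_lborel_matrix[OF det_cot_nz, of h] h by simp
  have "(LINT y|lborel. h (cotangent B *v (x - y))) = (LINT w|lborel. h (cotangent B *v w))"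
    by (rule integral_lborel_reflect[OF m])
  also have "\<dots> = \<bar>det B\<bar> *\<^sub>R \<bar>inverse (det B)\<bar> *\<^sub>R (LINT w|lborel. h (cotangent B *v w))"
    using B by (simp add: abs_inverse)
  also have "\<bar>inverse (det B)\<bar> *\<^sub>R (LINT w|lborel. h (cotangent B *v w)) = (LINT u|lborel. h u)"
    unfolding det_cot[symmetric] by (rule integral_lborel_matrix[OF det_cot_nz]) measurable
  finally show "(LINT y|lborel. h (cotangent B *v (x - y))) = \<bar>det B\<bar> *\<^sub>R (LINT u|lborel. h u)" .
qed

text \<open>Here \<open>f\<close> is replaced by its inverse transform before Fubini; the
  substitution u = \<open>cotangent B\<close> (x - y) then produces the factor |det B|. The pair
  \<open>f\<close>, \<open>F\<close> is kept abstract, so only the inversion formula and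
  integrability enter.\<close>

lemma integral_backward_piece:
  fixes h f F :: "(real, 'n) vec \<Rightarrow> complex"
  assumes h: "integrable lborel h" and F: "integrable lborel F"
    and inv: "\<And>y. f y = (LINT \<xi>|lborel. F \<xi> * osc (2 * pi) y \<xi>)"
  shows "(LINT y|lborel. h (cotangent B *v (x - y)) * f y)
    = (LINT \<xi>|lborel. of_real \<bar>det B\<bar> * (LINT u|lborel. h u * osc (- 2 * pi) (B *v \<xi>) u) * F \<xi> * osc (2 * pi) x \<xi>)"
proof -
  have [measurable]: "h \<in> borel_measurable borel" "F \<in> borel_measurable borel"
    using borel_measurable_integrable[OF h] borel_measurable_integrable[OF F] by auto
  have [measurable]: "(*v) (cotangent B) \<in> borel_measurable borel"
    by (intro borel_measurable_continuous_onI linear_continuous_on linear_conv_bounded_linear[THEN iffD1]) simp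
  note hc = integrable_cot(1)[OF h, of x]
  have "(LINT y|lborel. h (cotangent B *v (x - y)) * f y) = (LINT y|lborel. LINT \<xi>|lborel. F \<xi> * h (cotangent B *v (x - y)) * osc (2 * pi) y \<xi>)"
  proof (rule Bochner_Integration.integral_cong[OF refl])
    fix y
    have "(LINT \<xi>|lborel. F \<xi> * h (cotangent B *v (x - y)) * osc (2 * pi) y \<xi>) = (LINT \<xi>|lborel. h (cotangent B *v (x - y)) * (F \<xi> * osc (2 * pi) y \<xi>))"
      by (intro Bochner_Integration.integral_cong) (auto simp: mult_ac)
    then show "h (cotangent B *v (x - y)) * f y = (LINT \<xi>|lborel. F \<xi> * h (cotangent B *v (x - y)) * osc (2 * pi) y \<xi>)"
      by (simp only: inv integral_mult_right_zero)
  qed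
  also have "\<dots> = (LINT \<xi>|lborel. LINT y|lborel. F \<xi> * h (cotangent B *v (x - y)) * osc (2 * pi) y \<xi>)"
    by (rule lborel_pair.Fubini_integral, rule integrable_lborel_tensor[OF F hc]) auto
  also have "\<dots> = (LINT \<xi>|lborel. of_real \<bar>det B\<bar> * (LINT u|lborel. h u * osc (- 2 * pi) (B *v \<xi>) u) * F \<xi> * osc (2 * pi) x \<xi>)"
  proof (rule Bochner_Integration.integral_cong[OF refl])
    fix \<xi>
    let ?G = "\<lambda>u. h u * osc (- 2 * pi) (B *v \<xi>) u"
    have G: "integrable lborel ?G"
      by (rule Bochner_Integration.integrable_bound[OF h]) (auto simp: norm_mult)
    have "F \<xi> * h (cotangent B *v (x - y)) * osc (2 * pi) y \<xi> = (F \<xi> * osc (2 * pi) x \<xi>) * ?G (cotangent B *v (x - y))" for y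
    proof -
      have "osc (2 * pi) x \<xi> * osc (- 2 * pi) (B *v \<xi>) (cotangent B *v (x - y)) = osc (2 * pi) y \<xi>"
        by (simp add: osc_def inner_commute[of "B *v \<xi>"] cot_inner cis_mult inner_diff_left algebra_simps)
      then show ?thesis by (simp add: mult_ac)
    qed
    then have "(LINT y|lborel. F \<xi> * h (cotangent B *v (x - y)) * osc (2 * pi) y \<xi>) = (F \<xi> * osc (2 * pi) x \<xi>) * (LINT y|lborel. ?G (cotangent B *v (x - y)))"
      by (simp only: integral_mult_right_zero)
    also have "(LINT y|lborel. ?G (cotangent B *v (x - y))) = of_real \<bar>det B\<bar> * (LINT u|lborel. ?G u)"
      using integrable_cot(2)[OF G, of x] by (simp only: scaleR_conv_of_real)
    finally show "(LINT y|lborel. F \<xi> * h (cotangent B *v (x - y)) * osc (2 * pi) y \<xi>) = of_real \<bar>det B\<bar> * (LINT u|lborel. ?G u) * F \<xi> * osc (2 * pi) x \<xi>"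
      by (simp add: mult_ac)
  qed
  finally show ?thesis .
qed

end

lemma Mmap_eq: "Mmap A x \<xi> = A x *v \<xi>"
  by (simp add: Mmap_def matrix_vector_mult_def)

lemma Theta0_eq: "Theta0 A x y = cotangent (A x) *v (x - y)"
  by (simp add: Theta0_def Lmap_def cotangent_def matrix_vector_mult_def transpose_def del: transpose_matrix_vector)

subsection \<open>Dyadic partitions of unity\<close>

definition psi :: "nat \<Rightarrow> (real, 'n::{finite,linorder}) vec \<Rightarrow> real" where
  "psi j = (if j = 0 then chi else phi)"

text \<open>Up to index J the sum telescopes to \<open>chi\<close> at scale 2^J, which is 1 once
  16^J exceeds \<open>rho \<eta>\<close>; all later terms are differences of ones.\<close>

lemma psi_partition:
  "finite {j. psi j (dil (1 / 2 ^ j) \<eta>) \<noteq> 0}" "(\<lambda>j. psi j (dil (1 / 2 ^ j) \<eta>)) sums 1"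
proof -
  have step: "psi (Suc j) (dil (1 / 2 ^ Suc j) \<eta>) = chi (dil (1 / 2 ^ Suc j) \<eta>) - chi (dil (1 / 2 ^ j) \<eta>)" for j
    by (simp add: psi_def phi_def dil_dil)
  obtain J where J: "rho \<eta> < 16 ^ J" using real_arch_pow[of 16 "rho \<eta>"] by auto
  have one: "chi (dil (1 / 2 ^ j) \<eta>) = 1" if "j \<ge> J" for j
  proof (rule chi_1)
    have "(16 :: real) ^ J \<le> 16 ^ j" using that by (intro power_increasing) auto
    then have "rho \<eta> \<le> 16 ^ j" using J by linarith
    moreover have "(2 ^ j :: real) ^ 4 = (2 ^ 4) ^ j" by (simp only: power_mult[symmetric] mult.commute)
    then have "(2 ^ j :: real) ^ 4 = 16 ^ j" by simp
    ultimately show "rho (dil (1 / 2 ^ j) \<eta>) \<le> 1" by (simp add: rho_dil power_divide)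
  qed
  have zero: "psi j (dil (1 / 2 ^ j) \<eta>) = 0" if "j > J" for j
    using that step[of "j - 1"] one[of j] one[of "j - 1"] by simp
  then have "{j. psi j (dil (1 / 2 ^ j) \<eta>) \<noteq> 0} \<subseteq> {..J}"
    using not_le by blast
  then show fin: "finite {j. psi j (dil (1 / 2 ^ j) \<eta>) \<noteq> 0}"
    by (rule finite_subset) simp
  have "(\<lambda>j. psi j (dil (1 / 2 ^ j) \<eta>)) sums (\<Sum>j\<le>J. psi j (dil (1 / 2 ^ j) \<eta>))"
    by (rule sums_finite) (use zero not_le in auto)
  moreover have "(\<Sum>j\<le>J. psi j (dil (1 / 2 ^ j) \<eta>)) = chi (dil (1 / 2 ^ J) \<eta>)" for J
  proof (induction J)
    case 0
    show ?case by (simp add: psi_def)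
  next
    case (Suc J)
    then show ?case by (simp only: sum.atMost_Suc step)
  qed
  ultimately show "(\<lambda>j. psi j (dil (1 / 2 ^ j) \<eta>)) sums 1" using one[of J] by simp
qed

text \<open>Telescoping over all integer scales: for \<eta> nonzero the dilated \<open>chi\<close>
  is 0 at very small scales and 1 at very large ones, so only finitely many differences
  survive.\<close>

lemma phi_partition:
  fixes \<eta> :: "(real, 'n::{finite,linorder}) vec"
  assumes "\<eta> \<noteq> 0"
  shows "finite {j. phi (dil (1 / 2 powr of_int (int_decode j)) \<eta>) \<noteq> 0}"
    "(\<lambda>j. phi (dil (1 / 2 powr of_int (int_decode j)) \<eta>)) sums 1"
proof -
  define \<theta> where "\<theta> i = chi (dil (1 / 2 powr of_int i) \<eta>)" for i :: int
  have ph: "phi (dil (1 / 2 powr of_int i) \<eta>) = \<theta> i - \<theta> (i - 1)" for i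
    by (simp add: phi_def \<theta>_def dil_dil powr_diff)
  have rh: "rho (dil (1 / 2 powr of_int i) \<eta>) = rho \<eta> * 16 powr (- of_int i)" for i :: int
  proof -
    have "(16 :: real) powr of_int i = (2 powr 4) powr of_int i" by simp
    also have "\<dots> = (2 powr of_int i) powr 4" by (simp only: powr_powr mult.commute)
    also have "\<dots> = (2 powr of_int i) ^ 4" by simp
    finally have "(2 powr of_int i :: real) ^ 4 = 16 powr of_int i" ..
    then show ?thesis by (simp add: rho_dil power_divide powr_minus field_simps)
  qed
  have rp: "rho \<eta> > 0" using rho_pos[OF assms] .
  obtain J where J: "rho \<eta> < 16 ^ J" using real_arch_pow[of 16 "rho \<eta>"] by auto
  \<comment> \<open>\<open>J\<close> marks the scales at which the dilated rho is at most 1, and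
    \<open>- K\<close> those at which it is at least 2.\<close>
  obtain K where K: "2 / rho \<eta> < 16 ^ K" using real_arch_pow[of 16 "2 / rho \<eta>"] by auto
  have one: "\<theta> i = 1" if "i \<ge> int J" for i
  proof -
    have "rho \<eta> * 16 powr (- of_int i) \<le> 16 powr real J * 16 powr (- of_int i)"
      using J by (intro mult_right_mono) (auto simp: powr_realpow)
    also have "\<dots> \<le> 1" using that powr_mono[of "real J - of_int i" 0 16] by (simp flip: powr_add)
    finally show ?thesis unfolding \<theta>_def by (intro chi_1) (simp add: rh)
  qed
  have zero: "\<theta> i = 0" if "i \<le> - int K" for i
  proof -
    have "2 \<le> rho \<eta> * 16 powr real K" using K rp by (simp add: powr_realpow field_simps)
    also have "\<dots> \<le> rho \<eta> * 16 powr (- of_int i)" using that rp by (intro mult_left_mono powr_mono) auto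
    finally show ?thesis unfolding \<theta>_def by (intro chi_0) (simp add: rh)
  qed
  \<comment> \<open>The scales from -K + 1 to J, written in the shape that the telescoping sum
    expects.\<close>
  let ?I = "{- int K + 1..- int K + int (J + K)}"
  let ?N = "int_encode ` ?I"
  have out: "phi (dil (1 / 2 powr of_int (int_decode j)) \<eta>) = 0" if "j \<notin> ?N" for j
  proof -
    have "int_decode j \<notin> ?I" using that by (metis image_eqI int_decode_inverse)
    then have "int_decode j \<le> - int K \<or> int_decode j - 1 \<ge> int J" by auto
    then show ?thesis unfolding ph
    proof
      assume "int_decode j \<le> - int K"
      then show "\<theta> (int_decode j) - \<theta> (int_decode j - 1) = 0" using zero[of "int_decode j"] zero[of "int_decode j - 1"] by simp
    next
      assume "int_decode j - 1 \<ge> int J"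
      then show "\<theta> (int_decode j) - \<theta> (int_decode j - 1) = 0" using one[of "int_decode j"] one[of "int_decode j - 1"] by simp
    qed
  qed
  then show "finite {j. phi (dil (1 / 2 powr of_int (int_decode j)) \<eta>) \<noteq> 0}"
    by (intro finite_subset[where B="?N", OF _ finite_imageI[OF finite_atLeastAtMost_int]]) auto
  have tele: "(\<Sum>i\<in>{a + 1..a + int n}. \<theta> i - \<theta> (i - 1)) = \<theta> (a + int n) - \<theta> a" for a n
  proof (induction n)
    case (Suc n)
    have "{a + 1..a + int (Suc n)} = insert (a + int (Suc n)) {a + 1..a + int n}" by auto
    then show ?case using Suc by simp
  qed simp
  have "(\<Sum>j\<in>?N. phi (dil (1 / 2 powr of_int (int_decode j)) \<eta>)) = (\<Sum>i\<in>?I. \<theta> i - \<theta> (i - 1))"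
    by (subst sum.reindex) (auto simp: inj_on_def ph inj_int_encode[THEN inj_eq])
  also have "\<dots> = \<theta> (- int K + int (J + K)) - \<theta> (- int K)" by (rule tele)
  also have "\<dots> = 1" using one[of "int J"] zero[of "- int K"] by simp
  finally have eq: "(\<Sum>j\<in>?N. phi (dil (1 / 2 powr of_int (int_decode j)) \<eta>)) = 1" .
  have "(\<lambda>j. phi (dil (1 / 2 powr of_int (int_decode j)) \<eta>)) sums (\<Sum>j\<in>?N. phi (dil (1 / 2 powr of_int (int_decode j)) \<eta>))"
    by (rule sums_finite) (use out in auto)
  then show "(\<lambda>j. phi (dil (1 / 2 powr of_int (int_decode j)) \<eta>)) sums 1" by (simp only: eq)
qed

subsection \<open>Integrals of the pieces\<close>

lemma compact_family_L1:
  assumes K: "compact K" and c: "compact_family K c"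
  shows "\<exists>C\<ge>0. \<forall>j x. (LINT \<zeta>|lborel. norm (c j (x, \<zeta>))) \<le> C"
proof -
  obtain C where C: "C \<ge> 0" "\<And>j x \<eta>. norm (c j (x, \<eta>)) \<le> C * indicator K \<eta>"
    using compact_family_bound[OF c] by blast
  have "(LINT \<zeta>|lborel. norm (c j (x, \<zeta>))) \<le> (LINT \<zeta>|lborel. C * indicator K \<zeta>)" for j x
    by (rule integral_mono[OF integrable_norm[OF compact_family_integrable(2)[OF K c]] integrable_indicator_compact[OF K]]) (rule C)
  moreover have "(LINT \<zeta>|lborel. C * indicator K \<zeta>) \<ge> 0" using C(1) by (intro integral_nonneg_AE) auto
  ultimately show ?thesis by blast
qed

text \<open>Treating the index together with the base point as one index makes the majorant, and
  hence the constant, independent of both.\<close>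

lemma FT_L1:
  fixes c :: "'i \<Rightarrow> (real, 'n::{finite,linorder}) vec \<times> (real, 'n) vec \<Rightarrow> complex"
  assumes K: "compact K" and c: "compact_family K c" and \<tau>: "\<tau> \<noteq> 0"
  shows "\<exists>C\<ge>0. \<forall>j x. integrable lborel (\<lambda>u. FT \<tau> (c j) (x, u)) \<and> (LINT u|lborel. norm (FT \<tau> (c j) (x, u))) \<le> C"
proof -
  have "\<exists>C. \<forall>(jx :: 'i \<times> (real, 'n) vec) u. \<bar>u $ l\<bar> ^ k * norm (FT \<tau> (c (fst jx)) (snd jx, u)) \<le> C" for l k
    using FT_decay[OF K c \<tau>, of "axis l 1" k "[]"] by (auto simp: inner_axis')
  note b = this
  have "\<exists>C\<ge>0. \<forall>(jx :: 'i \<times> (real, 'n) vec) u. norm (FT \<tau> (c (fst jx)) (snd jx, u)) \<le> C * decay_weight u"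
    by (rule decay_weight_le_cart) (use b[of _ 0] b in auto)
  then obtain C where C: "C \<ge> 0" "\<And>j x u. norm (FT \<tau> (c j) (x, u)) \<le> C * decay_weight u" by force
  have meas: "(\<lambda>u. FT \<tau> (c j) (x, u)) \<in> borel_measurable borel" for j x
    by (rule borel_measurable_continuous_onI, rule continuous_on_compose2[OF FT_continuous[OF K c]]) (auto intro!: continuous_intros)
  have iw: "integrable lborel (\<lambda>u :: (real, 'n) vec. C * decay_weight u)"
    by (intro integrable_mult_right integrable_decay_weight)
  have int: "integrable lborel (\<lambda>u. FT \<tau> (c j) (x, u))" for j x
    by (rule Bochner_Integration.integrable_bound[OF iw]) (use meas C in \<open>auto intro!: AE_I2 order_trans[OF _ abs_ge_self]\<close>)
  moreover have "(LINT u|lborel. norm (FT \<tau> (c j) (x, u))) \<le> (LINT u|lborel. C * decay_weight (u :: (real, 'n) vec))" for j x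
    by (rule integral_mono[OF integrable_norm[OF int] iw]) (rule C)
  moreover have "(LINT u|lborel. C * decay_weight (u :: (real, 'n) vec)) \<ge> 0"
    using C(1) by (intro integral_nonneg_AE) (auto intro!: AE_I2 mult_nonneg_nonneg less_imp_le[OF decay_weight_pos])
  ultimately show ?thesis by blast
qed

text \<open>The block of size R^m living at scale R; undoing this rescaling leads back to the
  compact family \<open>c\<close>.\<close>

definition atom :: "real \<Rightarrow> (nat \<Rightarrow> real) \<Rightarrow> (nat \<Rightarrow> (real, 'n::{finite,linorder}) vec \<times> (real, 'n) vec \<Rightarrow> complex) \<Rightarrow>
    nat \<Rightarrow> (real, 'n) vec \<times> (real, 'n) vec \<Rightarrow> complex" where
  "atom m R c j p = R j powr m *\<^sub>R c j (fst p, dil (1 / R j) (snd p))"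

text \<open>The change of variables by \<open>dil R\<close> contributes R^Q, which turns the size
  R^m into the exponent m + Q in both the norm and the transform.\<close>

lemma
  fixes c :: "nat \<Rightarrow> (real, 'n::{finite,linorder}) vec \<times> (real, 'n) vec \<Rightarrow> complex"
  assumes K: "compact K" and c: "compact_family K c" and R: "R j > 0"
  shows integrable_atom: "integrable lborel (\<lambda>\<eta>. atom m R c j (x, \<eta>))"
    and integral_norm_atom: "(LINT \<eta>|lborel. norm (atom m R c j (x, \<eta>))) = R j powr (m + Qdim TYPE('n)) * (LINT \<zeta>|lborel. norm (c j (x, \<zeta>)))"
    and fourier_atom: "(LINT \<eta>|lborel. atom m R c j (x, \<eta>) * osc \<tau> u \<eta>) = piece \<tau> (m + Qdim TYPE('n)) R c j (x, u)"
proof -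
  note [measurable] = compact_family_measurable[OF c]
  have [measurable]: "(dil r :: (real, 'n) vec \<Rightarrow> _) \<in> borel_measurable borel" for r
    by (intro borel_measurable_continuous_onI linear_continuous_on bounded_linear_dil)
  have am [measurable]: "(\<lambda>\<eta>. atom m R c j (x, \<eta>)) \<in> borel_measurable borel"
    unfolding atom_def by simp
  have ad: "atom m R c j (x, dil (R j) \<zeta>) = R j powr m *\<^sub>R c j (x, \<zeta>)" for \<zeta>
    using R by (simp add: atom_def dil_dil)
  have "integrable lborel (\<lambda>\<zeta>. atom m R c j (x, dil (R j) \<zeta>))"
    unfolding ad by (intro integrable_scaleR_right compact_family_integrable(2)[OF K c])
  then show "integrable lborel (\<lambda>\<eta>. atom m R c j (x, \<eta>))"
    by (simp only: integrable_dil[OF R am])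
  have pw: "R j ^ Qdim TYPE('n) * R j powr m = R j powr (m + Qdim TYPE('n))"
    using R by (simp add: powr_add powr_realpow mult.commute)
  \<comment> \<open>The dilation formula is stated for complex functions, so the norm is regarded as
    complex and converted back.\<close>
  have "(LINT \<eta>|lborel. complex_of_real (norm (atom m R c j (x, \<eta>)))) = R j ^ Qdim TYPE('n) *\<^sub>R (LINT \<zeta>|lborel. complex_of_real (norm (atom m R c j (x, dil (R j) \<zeta>))))"
    by (rule integral_dil[OF R, symmetric]) measurable
  also have "\<dots> = complex_of_real (R j ^ Qdim TYPE('n) * (LINT \<zeta>|lborel. norm (atom m R c j (x, dil (R j) \<zeta>))))"
    by (simp add: scaleR_conv_of_real)
  also have "(LINT \<eta>|lborel. complex_of_real (norm (atom m R c j (x, \<eta>)))) = complex_of_real (LINT \<eta>|lborel. norm (atom m R c j (x, \<eta>)))"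
    by simp
  finally have "(LINT \<eta>|lborel. norm (atom m R c j (x, \<eta>))) = R j ^ Qdim TYPE('n) * (LINT \<zeta>|lborel. norm (atom m R c j (x, dil (R j) \<zeta>)))"
    by (simp only: of_real_eq_iff)
  then show "(LINT \<eta>|lborel. norm (atom m R c j (x, \<eta>))) = R j powr (m + Qdim TYPE('n)) * (LINT \<zeta>|lborel. norm (c j (x, \<zeta>)))"
    unfolding ad by (simp add: pw[symmetric] mult.assoc)
  have "(LINT \<eta>|lborel. atom m R c j (x, \<eta>) * osc \<tau> u \<eta>) = R j ^ Qdim TYPE('n) *\<^sub>R (LINT \<zeta>|lborel. atom m R c j (x, dil (R j) \<zeta>) * osc \<tau> u (dil (R j) \<zeta>))"
    by (rule integral_dil[OF R, symmetric]) measurable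
  also have "(LINT \<zeta>|lborel. atom m R c j (x, dil (R j) \<zeta>) * osc \<tau> u (dil (R j) \<zeta>)) = (LINT \<zeta>|lborel. R j powr m *\<^sub>R (c j (x, \<zeta>) * osc \<tau> (dil (R j) u) \<zeta>))"
    unfolding ad by (simp add: osc_def inner_dil)
  also have "\<dots> = R j powr m *\<^sub>R FT \<tau> (c j) (dil2 (R j) (x, u))"
    by (simp add: FT_def dil2_def)
  finally show "(LINT \<eta>|lborel. atom m R c j (x, \<eta>) * osc \<tau> u \<eta>) = piece \<tau> (m + Qdim TYPE('n)) R c j (x, u)"
    by (simp add: piece_def pw[symmetric])
qed

text \<open>The factor R^(m+Q) meets the Jacobian R^(-Q), so the mass of a piece is R^m times that
  of the undilated transform.\<close>

lemma
  fixes c :: "nat \<Rightarrow> (real, 'n::{finite,linorder}) vec \<times> (real, 'n) vec \<Rightarrow> complex" and m :: real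
  assumes K: "compact K" and c: "compact_family K c" and R: "R j > 0" and \<tau>: "\<tau> \<noteq> 0"
  shows integrable_piece: "integrable lborel (\<lambda>u. piece \<tau> (m + Qdim TYPE('n)) R c j (x, u))"
    and integral_norm_piece: "(LINT u|lborel. norm (piece \<tau> (m + Qdim TYPE('n)) R c j (x, u))) = R j powr m * (LINT v|lborel. norm (FT \<tau> (c j) (x, v)))"
proof -
  have int: "integrable lborel (\<lambda>u. FT \<tau> (c j) (x, u))" using FT_L1[OF K c \<tau>] by blast
  then have [measurable]: "(\<lambda>u. FT \<tau> (c j) (x, u)) \<in> borel_measurable borel"
    using borel_measurable_integrable by fastforce
  let ?s = "m + Qdim TYPE('n)"
  have p: "piece \<tau> ?s R c j (x, u) = R j powr ?s *\<^sub>R FT \<tau> (c j) (x, dil (R j) u)" for u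
    by (simp add: piece_def dil2_def)
  show "integrable lborel (\<lambda>u. piece \<tau> ?s R c j (x, u))"
    unfolding p by (intro integrable_scaleR_right integrable_dil[OF R, THEN iffD2] int) measurable
  have "R j ^ Qdim TYPE('n) *\<^sub>R (LINT u|lborel. complex_of_real (norm (FT \<tau> (c j) (x, dil (R j) u)))) = (LINT v|lborel. complex_of_real (norm (FT \<tau> (c j) (x, v))))"
    by (rule integral_dil[OF R]) measurable
  then have "complex_of_real (R j ^ Qdim TYPE('n) * (LINT u|lborel. norm (FT \<tau> (c j) (x, dil (R j) u)))) = complex_of_real (LINT v|lborel. norm (FT \<tau> (c j) (x, v)))"
    by (simp add: scaleR_conv_of_real)
  then have "R j ^ Qdim TYPE('n) * (LINT u|lborel. norm (FT \<tau> (c j) (x, dil (R j) u))) = (LINT v|lborel. norm (FT \<tau> (c j) (x, v)))"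
    by (simp only: of_real_eq_iff)
  then show "(LINT u|lborel. norm (piece \<tau> ?s R c j (x, u))) = R j powr m * (LINT v|lborel. norm (FT \<tau> (c j) (x, v)))"
    using R by (simp add: p powr_add powr_realpow mult.assoc)
qed

text \<open>Summability of the L1 norms justifies integrating each series term by term. Pointwise
  identities are asked only almost everywhere, because the kernel is not controlled on the
  diagonal.\<close>

lemma integral_eq_by_series:
  fixes t r :: "nat \<Rightarrow> 'a::euclidean_space \<Rightarrow> complex"
  assumes t: "\<And>j. integrable lborel (t j)" "summable (\<lambda>j. LINT x|lborel. norm (t j x))"
      "AE x in lborel. summable (\<lambda>j. norm (t j x)) \<and> (\<Sum>j. t j x) = T x" "T \<in> borel_measurable lborel"
    and r: "\<And>j. integrable lborel (r j)" "summable (\<lambda>j. LINT x|lborel. norm (r j x))"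
      "AE x in lborel. summable (\<lambda>j. norm (r j x)) \<and> (\<Sum>j. r j x) = U x" "U \<in> borel_measurable lborel"
    and eq: "\<And>j. (LINT x|lborel. t j x) = (LINT x|lborel. r j x)"
  shows "(LINT x|lborel. T x) = (LINT x|lborel. U x)"
proof -
  have "(LINT x|lborel. f x) = (\<Sum>j. LINT x|lborel. g j x)"
    if g: "\<And>j. integrable lborel (g j)" "summable (\<lambda>j. LINT x|lborel. norm (g j x))"
      "AE x in lborel. summable (\<lambda>j. norm (g j x)) \<and> (\<Sum>j. g j x) = f x" "f \<in> borel_measurable lborel"
    for f :: "'a \<Rightarrow> complex" and g
  proof -
    have [measurable]: "g j \<in> borel_measurable lborel" for j using g(1) by auto
    have "(LINT x|lborel. f x) = (LINT x|lborel. (\<Sum>j. g j x))"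
      by (rule integral_cong_AE) (use g(3,4) in auto)
    also have "\<dots> = (\<Sum>j. LINT x|lborel. g j x)"
      by (rule integral_suminf[OF g(1) _ g(2)]) (use g(3) in auto)
    finally show ?thesis .
  qed
  from this[OF t] this[OF r] eq show ?thesis by simp
qed

text \<open>The support of \<open>phi\<close> lies inside the annulus, so a family smooth only there
  becomes globally smooth after multiplication by it. \<open>J\<close> will be the determinant
  factor or its reciprocal.\<close>

lemma compact_family_cutoff:
  fixes F :: "'i \<Rightarrow> (real, 'n::{finite,linorder}) vec \<times> (real, 'n) vec \<Rightarrow> complex" and J :: "(real, 'n) vec \<Rightarrow> real"
  assumes F: "bdd_smooth (UNIV \<times> annulus) F" and J: "bdd_smooth UNIV (\<lambda>_::'i. J)"
  shows "compact_family cut_box (\<lambda>j p. J (fst p) *\<^sub>R (phi (snd p) *\<^sub>R F j p))"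
  unfolding compact_family_def
proof
  let ?S = "UNIV \<times> annulus :: ((real, 'n) vec \<times> (real, 'n) vec) set"
  have S: "open ?S" by (intro open_Times open_annulus) auto
  have "bdd_smooth ?S (\<lambda>(_::'i) p. phi (snd p))" "bdd_smooth ?S (\<lambda>(_::'i) p. J (fst p))"
    using bdd_smooth_precompose[OF bounded_linear_snd open_UNIV S _ bdd_smooth_phi]
      bdd_smooth_precompose[OF bounded_linear_fst open_UNIV S _ J] by auto
  then have "bdd_smooth ?S (\<lambda>j p. J (fst p) *\<^sub>R (phi (snd p) *\<^sub>R F j p))"
    by (intro bdd_smooth_scaleR[OF S] F)
  then show "bdd_smooth UNIV (\<lambda>j p. J (fst p) *\<^sub>R (phi (snd p) *\<^sub>R F j p))"
  proof (intro bdd_smooth_extend_zero[OF S, of "UNIV \<times> phi_supp"] closed_Times closed_phi_supp)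
    show "J (fst p) *\<^sub>R (phi (snd p) *\<^sub>R F j p) = 0" if "p \<notin> UNIV \<times> phi_supp" for j p
      using that phi_0[of "snd p"] by (auto simp: mem_Times_iff)
  qed (use phi_supp_annulus(1) in auto)
  show "\<forall>j x \<eta>. \<eta> \<notin> cut_box \<longrightarrow> J (fst (x, \<eta>)) *\<^sub>R (phi (snd (x, \<eta>)) *\<^sub>R F j (x, \<eta>)) = 0"
    using phi_supp_annulus(2) phi_0 by auto
qed

section \<open>The correspondence between symbols and kernels\<close>

text \<open>Allows the first member to be treated apart: the low-frequency cutoff does not vanish at
  the origin and needs a different argument.\<close>

lemma compact_family_Suc:
  assumes "compact_family K (\<lambda>j. c (Suc j))" "compact_family K (\<lambda>_::unit. c 0)"
  shows "compact_family K c"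
proof -
  have all: "P j" if "P 0" "\<And>j. P (Suc j)" for P :: "nat \<Rightarrow> bool" and j
    using that by (cases j) auto
  have "\<exists>C. \<forall>j. \<forall>p\<in>UNIV. norm (iterdir vs (c j) p) \<le> C" for vs
  proof -
    obtain C D where C: "\<And>j p. norm (iterdir vs (c (Suc j)) p) \<le> C" and D: "\<And>p. norm (iterdir vs (c 0) p) \<le> D"
      using assms unfolding compact_family_def bdd_smooth_def by (metis UNIV_I)
    have "norm (iterdir vs (c j) p) \<le> max C D" for j p
      by (rule all[of "\<lambda>j. norm (iterdir vs (c j) p) \<le> max C D"]) (auto simp: le_max_iff_disj C D)
    then show ?thesis by blast
  qed
  moreover have "smooth_on UNIV (c j)" for j
    by (rule all) (use assms in \<open>auto simp: compact_family_def bdd_smooth_def\<close>)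
  moreover have "c j (x, \<eta>) = 0" if "\<eta> \<notin> K" for j x \<eta>
    by (rule all[of "\<lambda>j. c j (x, \<eta>) = 0"]) (use assms that in \<open>auto simp: compact_family_def\<close>)
  ultimately show ?thesis by (simp add: compact_family_def bdd_smooth_def)
qed

lemma borel_measurable_matrix_vector: "(*v) (B :: real^'n^'m) \<in> borel_measurable borel"
  by (intro borel_measurable_continuous_onI linear_continuous_on linear_conv_bounded_linear[THEN iffD1]) simp

lemma borel_measurable_Theta0: "Theta0 A x \<in> borel_measurable borel"
proof -
  note [measurable] = borel_measurable_matrix_vector[of "cotangent (A x)"]
  show ?thesis unfolding Theta0_eq[abs_def] by measurable
qed

lemma cotangent_eq_0:
  fixes B :: "((real, 'n::{finite,linorder}) vec, 'n) vec"
  assumes "det B \<noteq> 0" "cotangent B *v w = 0"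
  shows "w = 0"
proof -
  have "w \<bullet> w = 0" using cot_inner[OF assms(1), of w w] assms(2) by simp
  then show ?thesis by simp
qed

lemma summable_norm_finite_support:
  fixes g :: "nat \<Rightarrow> 'a::real_normed_vector"
  assumes "finite {j. g j \<noteq> 0}"
  shows "summable (\<lambda>j. norm (g j))"
  by (rule summable_finite[OF assms]) auto

lemma symbol_kernel:
  fixes A :: "(real, 'n::{finite,linorder}) vec \<Rightarrow> ((real, 'n) vec, 'n) vec"
  assumes A: "admissible_frame A" and n: "- real (Qdim TYPE('n)) < n" "n < 0" and a0: "symbol_class n a0"
  shows "\<exists>k0. smooth_on (UNIV \<times> (UNIV - {0})) (\<lambda>(x, u). k0 x u) \<and>
    (\<forall>I \<gamma> :: 'n \<Rightarrow> nat. \<forall>M::real. M \<ge> 0 \<longrightarrow> (\<exists>C. \<forall>x u. u \<noteq> 0 \<longrightarrow>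
       norm (mderiv I (\<lambda>x'. mderiv \<gamma> (k0 x') u) x) \<le> C * hnorm u powr (- real (Qdim TYPE('n)) - n - real (hord \<gamma>) - M))) \<and>
    (\<forall>f. schwartz f \<longrightarrow> (\<forall>x. (LINT \<xi>|lborel. a0 x (Mmap A x \<xi>) * fourier f \<xi> * cis (2 * pi * (x \<bullet> \<xi>)))
       = (LINT y|lborel. k0 x (Theta0 A x y) * f y)))"
proof -
  let ?Q = "real (Qdim TYPE('n))"
  define a where "a = (\<lambda>(x, \<xi>). a0 x \<xi>)"
  define J where "J x = \<bar>det (A x)\<bar>" for x
  define R where "R j = (2 ^ j :: real)" for j :: nat
  \<comment> \<open>Normalised so that \<open>atom n\<close> multiplies the symbol by the cutoff at
    scale R; the reciprocal of \<open>J\<close> compensates the Jacobian of \<xi> -> A(x)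
    \<xi>.\<close>
  define c where "c j p = inverse (J (fst p)) *\<^sub>R (psi j (snd p) *\<^sub>R (R j powr (- n) *\<^sub>R a (dil2 (R j) p)))" for j p
  have Rp: "R j > 0" for j by (simp add: R_def)
  have det: "det (A x) \<noteq> 0" for x by (rule frame_det(3)[OF A])
  have Jp: "J x > 0" for x using det[of x] by (simp add: J_def)
  have Jinv: "bdd_smooth UNIV (\<lambda>_::'i. \<lambda>x. inverse (J x))" unfolding J_def by (rule frame_det(2)[OF A])
  have sm: "smooth_on UNIV a" using a0 by (simp add: symbol_class_def a_def)
  have bd: "\<exists>C. \<forall>x u. norm (cderiv l a (x, u)) \<le> C * (1 + hnorm u) powr (n - real (lwt l))" for l
    using cderiv_bound_from_mderiv[OF open_UNIV, of a0 "\<lambda>w u. (1 + hnorm u) powr (n - real w)" l] a0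
    by (auto simp: symbol_class_def a_def)
  have bdh: "\<exists>C. \<forall>x u. u \<noteq> 0 \<longrightarrow> norm (cderiv l a (x, u)) \<le> C * hnorm u powr (n - real (lwt l))" for l
  proof -
    obtain C where C: "\<And>x u. norm (cderiv l a (x, u)) \<le> C * (1 + hnorm u) powr (n - real (lwt l))" using bd by blast
    have "norm (cderiv l a (x, u)) \<le> max C 0 * hnorm u powr (n - real (lwt l))" if u: "u \<noteq> 0" for x u
    proof -
      have "norm (cderiv l a (x, u)) \<le> max C 0 * (1 + hnorm u) powr (n - real (lwt l))"
        by (rule order_trans[OF C mult_right_mono]) auto
      also have "\<dots> \<le> max C 0 * hnorm u powr (n - real (lwt l))"
        using hnorm_pos[OF u] n by (intro mult_left_mono powr_mono2') auto
      finally show ?thesis .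
    qed
    then show ?thesis by blast
  qed
  have "compact_family cut_box (\<lambda>j. c (Suc j))"
  proof -
    have "bdd_smooth (UNIV \<times> annulus) (\<lambda>j p. (max 1 (R (Suc j)) powr 0 * R (Suc j) powr (- n)) *\<^sub>R a (dil2 (R (Suc j)) p))"
      by (rule bdd_smooth_rescaled[OF smooth_on_subset[OF sm] Rp]) (use n bdh in auto)
    from compact_family_cutoff[OF this Jinv]
    have "compact_family cut_box (\<lambda>j p. inverse (J (fst p)) *\<^sub>R (phi (snd p) *\<^sub>R ((max 1 (R (Suc j)) powr 0 * R (Suc j) powr (- n)) *\<^sub>R a (dil2 (R (Suc j)) p))))" .
    moreover have "max 1 (R (Suc j)) powr 0 = 1" for j
      using less_le_trans[OF zero_less_one max.cobounded1[of 1 "R (Suc j)"]] by simp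
    ultimately show ?thesis by (simp add: c_def[abs_def] psi_def)
  qed
  moreover have "compact_family cut_box (\<lambda>_::unit. c 0)"
  proof -
    have "bdd_smooth UNIV (\<lambda>_::unit. a)"
    proof (rule bdd_smooth_cderivI[OF open_UNIV sm])
      fix l
      obtain C where C: "\<And>x u. norm (cderiv l a (x, u)) \<le> C * (1 + hnorm u) powr (n - real (lwt l))" using bd by blast
      have "norm (cderiv l a (x, u)) \<le> max C 0 * 1" for x u
      proof -
        have "norm (cderiv l a (x, u)) \<le> max C 0 * (1 + hnorm u) powr (n - real (lwt l))"
          by (rule order_trans[OF C mult_right_mono]) auto
        also have "\<dots> \<le> max C 0 * (1 + hnorm u) powr 0"
          using hnorm_nonneg[of u] n by (intro mult_left_mono powr_mono) auto
        finally show ?thesis using hnorm_nonneg[of u] by (simp add: add_nonneg_eq_0_iff)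
      qed
      then show "\<exists>C. \<forall>j::unit. \<forall>p\<in>UNIV. norm (cderiv l a p) \<le> C" by force
    qed
    then have "bdd_smooth UNIV (\<lambda>(_::unit) p. inverse (J (fst p)) *\<^sub>R (chi (snd p) *\<^sub>R a p))"
      by (intro bdd_smooth_scaleR bdd_smooth_precompose[OF bounded_linear_fst open_UNIV open_UNIV _ Jinv]
        bdd_smooth_precompose[OF bounded_linear_snd open_UNIV open_UNIV _ bdd_smooth_chi]) auto
    moreover have "chi \<eta> = 0" if "\<eta> \<notin> cut_box" for \<eta> :: "(real, 'n) vec"
      by (rule chi_0) (use rho_gt_2[OF that] in simp)
    ultimately show ?thesis
      by (auto simp: compact_family_def c_def[abs_def] psi_def R_def dil2_def)
  qed
  ultimately have c: "compact_family cut_box c" by (rule compact_family_Suc)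
  note K = compact_cut_box
  define s where "s = n + ?Q"
  have s: "s > 0" using n by (simp add: s_def)
  have s_neg: "- s = - ?Q - n" by (simp add: s_def)
  have R_eq: "R = (\<lambda>j. 2 ^ j)" by (simp add: R_def fun_eq_iff)
  have pi0: "2 * pi \<noteq> 0" by simp
  define k0 where "k0 x u = (\<Sum>j. piece (2 * pi) s R c j (x, u))" for x u
  have k: "(\<lambda>(x, u). k0 x u) = (\<lambda>p. \<Sum>j. piece (2 * pi) s R c j p)" by (auto simp: k0_def)
  note ser = kernel_series[OF K c pi0 s, folded R_eq, folded k]
  have "\<exists>C. \<forall>x u. u \<noteq> 0 \<longrightarrow> norm (mderiv I (\<lambda>x'. mderiv \<gamma> (k0 x') u) x) \<le> C * hnorm u powr (- ?Q - n - real (hord \<gamma>) - M)"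
    if "M \<ge> 0" for I \<gamma> :: "'n \<Rightarrow> nat" and M
    using ser(2)[OF that, of "map Inl (index_list I) @ map Inr (index_list \<gamma>)"]
    unfolding mderiv_mderiv lwt_append_index_list s_neg by blast
  moreover have "(LINT \<xi>|lborel. a0 x (Mmap A x \<xi>) * fourier f \<xi> * cis (2 * pi * (x \<bullet> \<xi>))) = (LINT y|lborel. k0 x (Theta0 A x y) * f y)"
    if f: "schwartz f" for f x
  proof -
    define t where "t j \<xi> = of_real (J x) * atom n R c j (x, A x *v \<xi>) * fourier f \<xi> * osc (2 * pi) x \<xi>" for j \<xi>
    define r where "r j y = piece (2 * pi) s R c j (x, Theta0 A x y) * f y" for j y
    have fint: "integrable lborel f" using schwartz_integrable[OF f, of 0] by simp
    have Fint: "integrable lborel (fourier f)" by (rule schwartz_fourier_integrable[OF f])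
    obtain B where B: "\<And>y. norm (f y) \<le> B" using schwartz_bounded[OF f] by blast
    have [measurable]: "f \<in> borel_measurable borel" "fourier f \<in> borel_measurable borel"
      using borel_measurable_integrable[OF fint] borel_measurable_integrable[OF Fint] by auto
    have Am [measurable]: "(*v) (A x) \<in> borel_measurable borel" by (rule borel_measurable_matrix_vector)
    have atm [measurable]: "(\<lambda>\<eta>. atom n R c j (x, \<eta>)) \<in> borel_measurable borel" for j
      using borel_measurable_integrable[OF integrable_atom[where R=R, OF K c Rp]] by simp
    have pcm [measurable]: "(\<lambda>u. piece (2 * pi) s R c j (x, u)) \<in> borel_measurable borel" for j
      using borel_measurable_integrable[OF integrable_piece[where R=R and m=n, OF K c Rp pi0]] by (simp add: s_def)
    have Th [measurable]: "Theta0 A x \<in> borel_measurable borel" by (rule borel_measurable_Theta0)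
    \<comment> \<open>The hypothesis n < 0 enters here: the L1 norms of the blocks on both the
      frequency side and the kernel side are of size 2^(n j).\<close>
    have geo: "summable (\<lambda>j. D * R j powr n)" for D
    proof -
      have "R j powr n = (2 powr n) ^ j" for j
        by (simp add: R_def powr_realpow[symmetric] powr_powr mult.commute)
      moreover have "2 powr n < (1 :: real)" using n powr_less_mono[of n 0 "2 :: real"] by simp
      ultimately show ?thesis by (intro summable_mult) (simp add: summable_geometric)
    qed
    obtain C where C: "C \<ge> 0" "\<And>j x \<eta>. norm (c j (x, \<eta>)) \<le> C * indicator cut_box \<eta>"
      using compact_family_bound[OF c] by blast
    have cC: "norm (c j (x, \<eta>)) \<le> C" for j x \<eta>
      using C(2)[of j x \<eta>] C(1) by (auto split: split_indicator_asm intro: order_trans)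
    have tb: "norm (t j \<xi>) \<le> (J x * C * R j powr n) * norm (fourier f \<xi>)" for j \<xi>
    proof -
      have "norm (t j \<xi>) = (J x * norm (c j (x, dil (1 / R j) (A x *v \<xi>))) * R j powr n) * norm (fourier f \<xi>)"
        using Jp[of x] by (simp add: t_def atom_def norm_mult mult_ac)
      also have "\<dots> \<le> (J x * C * R j powr n) * norm (fourier f \<xi>)"
        using Jp[of x] cC by (intro mult_right_mono mult_left_mono) auto
      finally show ?thesis .
    qed
    have tm [measurable]: "t j \<in> borel_measurable borel" for j unfolding t_def[abs_def] by measurable
    have ti: "integrable lborel (t j)" for j
      by (rule Bochner_Integration.integrable_bound[OF integrable_mult_right[OF integrable_norm[OF Fint], of "J x * C * R j powr n"]])
         (use tb in \<open>auto intro!: AE_I2 order_trans[OF _ abs_ge_self]\<close>)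
    have rm [measurable]: "r j \<in> borel_measurable borel" for j unfolding r_def[abs_def] by measurable
    have pci: "integrable lborel (\<lambda>y. norm (piece (2 * pi) s R c j (x, cotangent (A x) *v (x - y))))"
        "(LINT y|lborel. norm (piece (2 * pi) s R c j (x, cotangent (A x) *v (x - y)))) = J x * (R j powr n * (LINT v|lborel. norm (FT (2 * pi) (c j) (x, v))))" for j
      using integrable_cot[OF det integrable_norm[OF integrable_piece[where R=R and m=n and x=x and j=j, OF K c Rp pi0]], of x x]
        integral_norm_piece[where R=R and m=n and x=x and j=j, OF K c Rp pi0] by (simp_all add: s_def J_def)
    have rb: "norm (r j y) \<le> B * norm (piece (2 * pi) s R c j (x, cotangent (A x) *v (x - y)))" for j y
      unfolding r_def Theta0_eq norm_mult using B by (simp add: mult.commute mult_right_mono)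
    have ri: "integrable lborel (r j)" for j
      by (rule Bochner_Integration.integrable_bound[OF integrable_mult_right[OF pci(1), of B]])
         (use rb in \<open>auto intro!: AE_I2 order_trans[OF _ abs_ge_self]\<close>)
    obtain D where D: "D \<ge> 0" "\<And>j x. (LINT u|lborel. norm (FT (2 * pi) (c j) (x, u))) \<le> D"
      using FT_L1[OF K c pi0] by blast
    have B0: "B \<ge> 0" using B[of 0] norm_ge_zero order_trans by blast
    have "(LINT \<xi>|lborel. a0 x (Mmap A x \<xi>) * fourier f \<xi> * osc (2 * pi) x \<xi>) = (LINT y|lborel. k0 x (Theta0 A x y) * f y)"
    proof (rule integral_eq_by_series[of t _ r, OF ti _ _ _ ri])
      show "summable (\<lambda>j. LINT \<xi>|lborel. norm (t j \<xi>))"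
      proof (rule summable_comparison_test'[OF geo[of "J x * C * (LINT \<xi>|lborel. norm (fourier f \<xi>))"], of 0])
        fix j
        have "(LINT \<xi>|lborel. norm (t j \<xi>)) \<le> (LINT \<xi>|lborel. (J x * C * R j powr n) * norm (fourier f \<xi>))"
          by (rule integral_mono[OF integrable_norm[OF ti] integrable_mult_right[OF integrable_norm[OF Fint]] tb])
        then show "norm (LINT \<xi>|lborel. norm (t j \<xi>)) \<le> J x * C * (LINT \<xi>|lborel. norm (fourier f \<xi>)) * R j powr n"
          by (simp add: mult_ac)
      qed
      show "summable (\<lambda>j. LINT y|lborel. norm (r j y))"
      proof (rule summable_comparison_test'[OF geo[of "B * (J x * D)"], of 0])
        fix j
        have "(LINT y|lborel. norm (r j y)) \<le> (LINT y|lborel. B * norm (piece (2 * pi) s R c j (x, cotangent (A x) *v (x - y))))"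
          by (rule integral_mono[OF integrable_norm[OF ri] integrable_mult_right[OF pci(1)] rb])
        also have "\<dots> = B * (J x * (R j powr n * (LINT v|lborel. norm (FT (2 * pi) (c j) (x, v)))))"
          by (simp add: pci(2))
        also have "\<dots> \<le> B * (J x * (R j powr n * D))"
          using D B0 Jp[of x] by (intro mult_left_mono) auto
        finally show "norm (LINT y|lborel. norm (r j y)) \<le> B * (J x * D) * R j powr n"
          by (simp add: mult_ac)
      qed
      have at: "of_real (J x) * atom n R c j (x, \<eta>) = of_real (psi j (dil (1 / 2 ^ j) \<eta>)) * a0 x \<eta>" for j \<eta>
      proof -
        have "R j powr n * R j powr (- n) = 1" using Rp[of j] by (simp flip: powr_add)
        moreover have "dil (R j) (dil (1 / R j) \<eta>) = \<eta>" using Rp[of j] by (simp add: dil_dil)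
        ultimately show ?thesis using Jp[of x]
          by (simp add: atom_def c_def a_def dil2_def scaleR_conv_of_real R_def field_simps flip: of_real_mult)
      qed
      show "AE \<xi> in lborel. summable (\<lambda>j. norm (t j \<xi>)) \<and> (\<Sum>j. t j \<xi>) = a0 x (Mmap A x \<xi>) * fourier f \<xi> * osc (2 * pi) x \<xi>"
      proof (rule AE_I2)
        fix \<xi>
        let ?X = "a0 x (A x *v \<xi>) * fourier f \<xi> * osc (2 * pi) x \<xi>"
        have t: "t j \<xi> = of_real (psi j (dil (1 / 2 ^ j) (A x *v \<xi>))) * ?X" for j
          by (simp add: t_def at mult.assoc)
        have "summable (\<lambda>j. norm (t j \<xi>))"
          by (rule summable_norm_finite_support, rule finite_subset[OF _ psi_partition(1)[of "A x *v \<xi>"]]) (auto simp: t)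
        moreover have "(\<lambda>j. t j \<xi>) sums (of_real 1 * ?X)"
          unfolding t by (intro sums_mult2 sums_of_real psi_partition(2))
        ultimately show "summable (\<lambda>j. norm (t j \<xi>)) \<and> (\<Sum>j. t j \<xi>) = a0 x (Mmap A x \<xi>) * fourier f \<xi> * osc (2 * pi) x \<xi>"
          by (simp add: sums_iff Mmap_eq)
      qed
      have "continuous_on UNIV (\<lambda>\<eta>. a (x, \<eta>))"
        by (rule continuous_on_compose2[OF smooth_on_continuous[OF sm, of "[]", simplified]]) (auto intro!: continuous_intros)
      then have [measurable]: "a0 x \<in> borel_measurable borel"
        by (simp add: a_def borel_measurable_continuous_onI)
      show "(\<lambda>\<xi>. a0 x (Mmap A x \<xi>) * fourier f \<xi> * osc (2 * pi) x \<xi>) \<in> borel_measurable lborel"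
        unfolding Mmap_eq by measurable
      show "AE y in lborel. summable (\<lambda>j. norm (r j y)) \<and> (\<Sum>j. r j y) = k0 x (Theta0 A x y) * f y"
      \<comment> \<open>The kernel series is known to converge only for u nonzero, that is for y
        different from x, which excludes a null set.\<close>
      proof (rule AE_mp[OF AE_lborel_singleton[of x]], rule AE_I2, rule impI)
        fix y assume "y \<noteq> x"
        then have "Theta0 A x y \<noteq> 0" using cotangent_eq_0[OF det] by (fastforce simp: Theta0_eq)
        then have sn: "summable (\<lambda>j. norm (piece (2 * pi) s R c j (x, Theta0 A x y)))" by (rule ser(3))
        then show "summable (\<lambda>j. norm (r j y)) \<and> (\<Sum>j. r j y) = k0 x (Theta0 A x y) * f y"
          unfolding r_def k0_def norm_mult
          by (auto intro!: summable_mult2 suminf_mult2[symmetric] summable_norm_cancel[OF sn])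
      qed
      show "(\<lambda>y. k0 x (Theta0 A x y) * f y) \<in> borel_measurable lborel"
        unfolding k0_def by measurable
      show "(LINT \<xi>|lborel. t j \<xi>) = (LINT y|lborel. r j y)" for j
        using integral_forward_piece[OF det integrable_atom[where R=R and m=n and j=j and x=x, OF K c Rp] fint, of x x]
        unfolding fourier_atom[where R=R, OF K c Rp] by (simp add: t_def[abs_def] r_def[abs_def] s_def J_def Theta0_eq)
    qed
    then show ?thesis by (simp add: osc_def)
  qed
  ultimately show ?thesis using ser(1) unfolding k by (intro exI[of _ k0]) (auto simp: k[symmetric])
qed

lemma kernel_symbol:
  fixes A :: "(real, 'n::{finite,linorder}) vec \<Rightarrow> ((real, 'n) vec, 'n) vec"
  assumes A: "admissible_frame A" and n: "- real (Qdim TYPE('n)) < n" "n < 0"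
    and sm: "smooth_on (UNIV \<times> (UNIV - {0})) (\<lambda>(x, u). k0 x u)"
    and bound: "\<And>(I :: 'n \<Rightarrow> nat) \<gamma> M. M \<ge> (0::real) \<Longrightarrow> \<exists>C. \<forall>x u. u \<noteq> 0 \<longrightarrow>
       norm (mderiv I (\<lambda>x'. mderiv \<gamma> (k0 x') u) x) \<le> C * hnorm u powr (- real (Qdim TYPE('n)) - n - real (hord \<gamma>) - M)"
  shows "\<exists>a0. symbol_class n a0 \<and>
    (\<forall>f. schwartz f \<longrightarrow> (\<forall>x. (LINT y|lborel. k0 x (Theta0 A x y) * f y)
      = (LINT \<xi>|lborel. a0 x (Mmap A x \<xi>) * fourier f \<xi> * cis (2 * pi * (x \<bullet> \<xi>)))))"
proof -
  let ?Q = "real (Qdim TYPE('n))"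
  \<comment> \<open>The homogeneity degree of the kernel at the origin; m + Q = -n is the exponent
    of the resulting pieces.\<close>
  define m where "m = - ?Q - n"
  have m: "m \<le> 0" using n by (simp add: m_def)
  define k where "k = (\<lambda>(x, u). k0 x u)"
  define J where "J x = \<bar>det (A x)\<bar>" for x
  define R where "R j = (2 powr of_int (int_decode j) :: real)" for j :: nat
  \<comment> \<open>The factor \<open>J\<close> is built into the blocks because the symbol is |det
    A(x)| times the transform of the kernel.\<close>
  define c where "c j p = J (fst p) *\<^sub>R (phi (snd p) *\<^sub>R (R j powr (- m) *\<^sub>R k (dil2 (R j) p)))" for j p
  have Rp: "R j > 0" for j by (simp add: R_def)
  have det: "det (A x) \<noteq> 0" for x by (rule frame_det(3)[OF A])
  have Jp: "J x > 0" for x using det[of x] by (simp add: J_def)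
  have Jb: "bdd_smooth UNIV (\<lambda>_::'i. J)" unfolding J_def[abs_def] by (rule frame_det(1)[OF A])
  let ?S = "UNIV \<times> (UNIV - {0}) :: ((real, 'n) vec \<times> (real, 'n) vec) set"
  have S: "open ?S" by (intro open_Times) auto
  have bd: "\<exists>C. \<forall>x u. u \<noteq> 0 \<longrightarrow> norm (cderiv l k (x, u)) \<le> C * hnorm u powr (m - real (lwt l) - M)" if "M \<ge> 0" for l M
    using cderiv_bound_from_mderiv[OF S sm, of "\<lambda>w u. hnorm u powr (m - real w - M)" l] bound[OF that]
    by (simp add: m_def k_def)
  have cM: "compact_family cut_box (\<lambda>j p. (max 1 (R j) powr M) *\<^sub>R c j p)" if M: "M \<ge> 0" for M
  proof -
    have "bdd_smooth (UNIV \<times> annulus) (\<lambda>j p. (max 1 (R j) powr M * R j powr (- m)) *\<^sub>R k (dil2 (R j) p))"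
      by (rule bdd_smooth_rescaled[OF _ Rp m M _ bd[OF M]]) (use bd[of 0] sm in \<open>auto simp: k_def\<close>)
    from compact_family_cutoff[OF this Jb] show ?thesis
      by (simp add: c_def[abs_def] mult_ac)
  qed
  note K = compact_cut_box
  define s where "s = m + ?Q"
  have s: "s > 0" "s = - n" using n by (simp_all add: s_def m_def)
  have R_eq: "R = (\<lambda>j. 2 powr of_int (int_decode j))" by (simp add: R_def fun_eq_iff)
  have pi0: "- 2 * pi \<noteq> 0" by simp
  have c: "compact_family cut_box c"
  proof -
    have "max 1 (R j) powr 0 = 1" for j
      using less_le_trans[OF zero_less_one max.cobounded1[of 1 "R j"]] by simp
    then show ?thesis using cM[of 0] by simp
  qed
  define a0 where "a0 x \<xi> = (\<Sum>j. piece (- 2 * pi) s R c j (x, \<xi>))" for x \<xi>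
  have a: "(\<lambda>(x, \<xi>). a0 x \<xi>) = (\<lambda>p. \<Sum>j. piece (- 2 * pi) s R c j p)" by (auto simp: a0_def)
  note ser = symbol_series[OF K pi0 s(1), of c, OF cM[unfolded R_def], folded R_eq, folded a]
  have "symbol_class n a0"
    unfolding symbol_class_def
  proof (intro conjI allI)
    show "smooth_on UNIV (\<lambda>(x, \<xi>). a0 x \<xi>)" by (rule ser(1))
    fix I \<alpha> :: "'n \<Rightarrow> nat"
    show "\<exists>C. \<forall>x \<xi>. norm (mderiv I (\<lambda>x'. mderiv \<alpha> (a0 x') \<xi>) x) \<le> C * (1 + hnorm \<xi>) powr (n - real (hord \<alpha>))"
      using ser(2)[of "map Inl (index_list I) @ map Inr (index_list \<alpha>)"]
      unfolding mderiv_mderiv lwt_append_index_list s(2) by simp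
  qed
  moreover have "(LINT y|lborel. k0 x (Theta0 A x y) * f y) = (LINT \<xi>|lborel. a0 x (Mmap A x \<xi>) * fourier f \<xi> * cis (2 * pi * (x \<bullet> \<xi>)))"
    if f: "schwartz f" for f x
  proof -
    \<comment> \<open>Dividing by \<open>J\<close> gives back the kernel times its dyadic cutoff;
      the determinant reappears from the change of variables in y.\<close>
    define h where "h j u = inverse (J x) *\<^sub>R atom m R c j (x, u)" for j u
    define t where "t j y = h j (Theta0 A x y) * f y" for j y
    define r where "r j \<xi> = piece (- 2 * pi) s R c j (x, A x *v \<xi>) * fourier f \<xi> * osc (2 * pi) x \<xi>" for j \<xi>
    have fint: "integrable lborel f" using schwartz_integrable[OF f, of 0] by simp
    have Fint: "integrable lborel (fourier f)" by (rule schwartz_fourier_integrable[OF f])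
    obtain B where B: "\<And>y. norm (f y) \<le> B" using schwartz_bounded[OF f] by blast
    have B0: "B \<ge> 0" using B[of 0] norm_ge_zero order_trans by blast
    have [measurable]: "f \<in> borel_measurable borel" "fourier f \<in> borel_measurable borel"
      using borel_measurable_integrable[OF fint] borel_measurable_integrable[OF Fint] by auto
    have Am [measurable]: "(*v) (A x) \<in> borel_measurable borel" by (rule borel_measurable_matrix_vector)
    have hi: "integrable lborel (h j)" for j
      unfolding h_def[abs_def] by (intro integrable_scaleR_right integrable_atom[where R=R, OF K c Rp])
    have hm [measurable]: "h j \<in> borel_measurable borel" for j
      using borel_measurable_integrable[OF hi] by simp
    have pcm [measurable]: "(\<lambda>u. piece (- 2 * pi) s R c j (x, u)) \<in> borel_measurable borel" for j
      using borel_measurable_integrable[OF integrable_piece[where R=R and m=m, OF K c Rp pi0]] by (simp add: s_def)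
    have Th [measurable]: "Theta0 A x \<in> borel_measurable borel" by (rule borel_measurable_Theta0)
    have tm [measurable]: "t j \<in> borel_measurable borel" for j unfolding t_def[abs_def] by measurable
    have hci: "integrable lborel (\<lambda>y. norm (h j (cotangent (A x) *v (x - y))))"
        "(LINT y|lborel. norm (h j (cotangent (A x) *v (x - y)))) = R j powr s * (LINT \<zeta>|lborel. norm (c j (x, \<zeta>)))" for j
    proof -
      show "integrable lborel (\<lambda>y. norm (h j (cotangent (A x) *v (x - y))))"
        using integrable_cot(1)[OF det[of x] integrable_norm[OF hi[of j]], of x] .
      have "(LINT y|lborel. norm (h j (cotangent (A x) *v (x - y)))) = J x * (LINT u|lborel. norm (h j u))"
        using integrable_cot(2)[OF det[of x] integrable_norm[OF hi[of j]], of x] by (simp add: J_def)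
      also have "\<dots> = J x * (inverse (J x) * (LINT u|lborel. norm (atom m R c j (x, u))))"
        using Jp[of x] by (simp add: h_def)
      also have "\<dots> = R j powr s * (LINT \<zeta>|lborel. norm (c j (x, \<zeta>)))"
        using Jp[of x] integral_norm_atom[where R=R and m=m and j=j and x=x, OF K c Rp] by (simp add: s_def)
      finally show "(LINT y|lborel. norm (h j (cotangent (A x) *v (x - y)))) = R j powr s * (LINT \<zeta>|lborel. norm (c j (x, \<zeta>)))" .
    qed
    have tb: "norm (t j y) \<le> B * norm (h j (cotangent (A x) *v (x - y)))" for j y
      unfolding t_def Theta0_eq norm_mult using B by (simp add: mult.commute mult_right_mono)
    have ti: "integrable lborel (t j)" for j
      by (rule Bochner_Integration.integrable_bound[OF integrable_mult_right[OF hci(1), of B]])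
         (use tb in \<open>auto intro!: AE_I2 order_trans[OF _ abs_ge_self]\<close>)
    obtain N where N: "summable N" "\<And>j p. norm (piece (- 2 * pi) s R c j p) \<le> N j" using ser(3) by blast
    have rm [measurable]: "r j \<in> borel_measurable borel" for j unfolding r_def[abs_def] by measurable
    have rb: "norm (r j \<xi>) \<le> N j * norm (fourier f \<xi>)" for j \<xi>
      unfolding r_def norm_mult using N(2) by (simp add: mult_right_mono)
    have ri: "integrable lborel (r j)" for j
      by (rule Bochner_Integration.integrable_bound[OF integrable_mult_right[OF integrable_norm[OF Fint], of "N j"]])
         (use rb in \<open>auto intro!: AE_I2 order_trans[OF _ abs_ge_self]\<close>)
    \<comment> \<open>The weight with exponent 2s turns the L1 norm of a block, R^s times a
      constant, into a tent in R, which is summable over all integer scales.\<close>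
    obtain D where D: "D \<ge> 0" "\<And>j x. (LINT \<zeta>|lborel. norm ((max 1 (R j) powr (2 * s)) *\<^sub>R c j (x, \<zeta>))) \<le> D"
      using compact_family_L1[OF K cM[of "2 * s"]] s(1) by auto
    have cD: "R j powr s * (LINT \<zeta>|lborel. norm (c j (x, \<zeta>))) \<le> D * tent s (R j)" for j
    proof -
      have mx: "max 1 (R j) powr (2 * s) * max 1 (R j) powr (- 2 * s) = 1"
        using less_le_trans[OF zero_less_one max.cobounded1[of 1 "R j"]] by (simp flip: powr_add)
      have "max 1 (R j) powr (2 * s) * (LINT \<zeta>|lborel. norm (c j (x, \<zeta>))) \<le> D"
        using D(2)[of j x] by simp
      then have le: "(R j powr s * max 1 (R j) powr (- 2 * s)) * (max 1 (R j) powr (2 * s) * (LINT \<zeta>|lborel. norm (c j (x, \<zeta>)))) \<le> (R j powr s * max 1 (R j) powr (- 2 * s)) * D"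
        by (intro mult_left_mono) auto
      have eq: "(R j powr s * max 1 (R j) powr (- 2 * s)) * (max 1 (R j) powr (2 * s) * (LINT \<zeta>|lborel. norm (c j (x, \<zeta>)))) = R j powr s * (LINT \<zeta>|lborel. norm (c j (x, \<zeta>))) * (max 1 (R j) powr (2 * s) * max 1 (R j) powr (- 2 * s))"
        by (simp only: mult_ac)
      show ?thesis using le unfolding eq mx tent_def by (simp only: mult_1_right mult.commute[of D])
    qed
    have at: "h j u = of_real (phi (dil (1 / 2 powr of_int (int_decode j)) u)) * k0 x u" for j u
    proof -
      have "R j powr m * R j powr (- m) = 1" using Rp[of j] by (simp flip: powr_add)
      moreover have "dil (R j) (dil (1 / R j) u) = u" using Rp[of j] by (simp add: dil_dil)
      ultimately show ?thesis using Jp[of x]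
        by (simp add: h_def atom_def c_def k_def dil2_def scaleR_conv_of_real R_def field_simps flip: of_real_mult)
    qed
    have tsum: "summable (\<lambda>j. norm (t j y)) \<and> (\<Sum>j. t j y) = k0 x (Theta0 A x y) * f y" if "y \<noteq> x" for y
    proof -
      have nz: "Theta0 A x y \<noteq> 0" using that cotangent_eq_0[OF det] by (fastforce simp: Theta0_eq)
      let ?X = "k0 x (Theta0 A x y) * f y"
      have t: "t j y = of_real (phi (dil (1 / 2 powr of_int (int_decode j)) (Theta0 A x y))) * ?X" for j
        by (simp add: t_def at mult.assoc)
      have "summable (\<lambda>j. norm (t j y))"
        by (rule summable_norm_finite_support, rule finite_subset[OF _ phi_partition(1)[OF nz]]) (auto simp: t)
      moreover have "(\<lambda>j. t j y) sums (of_real 1 * ?X)"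
        unfolding t by (intro sums_mult2 sums_of_real phi_partition(2) nz)
      ultimately show ?thesis by (simp add: sums_iff)
    qed
    have "(LINT y|lborel. k0 x (Theta0 A x y) * f y) = (LINT \<xi>|lborel. a0 x (Mmap A x \<xi>) * fourier f \<xi> * osc (2 * pi) x \<xi>)"
    proof (rule integral_eq_by_series[of t _ r, OF ti _ _ _ ri])
      show "summable (\<lambda>j. LINT y|lborel. norm (t j y))"
      proof (rule summable_comparison_test'[OF summable_tent[OF s(1), of "B * D"], of 0])
        fix j
        have "(LINT y|lborel. norm (t j y)) \<le> (LINT y|lborel. B * norm (h j (cotangent (A x) *v (x - y))))"
          by (rule integral_mono[OF integrable_norm[OF ti] integrable_mult_right[OF hci(1)] tb])
        also have "\<dots> = B * (R j powr s * (LINT \<zeta>|lborel. norm (c j (x, \<zeta>))))"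
          by (simp add: hci(2))
        also have "\<dots> \<le> B * (D * tent s (R j))" by (intro mult_left_mono cD B0)
        finally show "norm (LINT y|lborel. norm (t j y)) \<le> B * D * tent s (2 powr of_int (int_decode j))"
          by (simp add: mult.assoc R_def)
      qed
      show "summable (\<lambda>j. LINT \<xi>|lborel. norm (r j \<xi>))"
      proof (rule summable_comparison_test'[OF summable_mult2[OF N(1), of "LINT \<xi>|lborel. norm (fourier f \<xi>)"], of 0])
        fix j
        have "(LINT \<xi>|lborel. norm (r j \<xi>)) \<le> (LINT \<xi>|lborel. N j * norm (fourier f \<xi>))"
          by (rule integral_mono[OF integrable_norm[OF ri] integrable_mult_right[OF integrable_norm[OF Fint]] rb])
        then show "norm (LINT \<xi>|lborel. norm (r j \<xi>)) \<le> N j * (LINT \<xi>|lborel. norm (fourier f \<xi>))" by simp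
      qed
      show "AE y in lborel. summable (\<lambda>j. norm (t j y)) \<and> (\<Sum>j. t j y) = k0 x (Theta0 A x y) * f y"
        by (rule AE_mp[OF AE_lborel_singleton[of x]], rule AE_I2) (use tsum in blast)
      \<comment> \<open>Nothing is assumed about the kernel at u = 0, so measurability is taken from
        the series, which agrees with the integrand except at y = x.\<close>
      have "(\<lambda>y. \<Sum>j. t j y) \<in> borel_measurable lborel" by measurable
      then show "(\<lambda>y. k0 x (Theta0 A x y) * f y) \<in> borel_measurable lborel"
        by (rule measurable_discrete_difference[where X="{x}"]) (use tsum in auto)
      show "AE \<xi> in lborel. summable (\<lambda>j. norm (r j \<xi>)) \<and> (\<Sum>j. r j \<xi>) = a0 x (Mmap A x \<xi>) * fourier f \<xi> * osc (2 * pi) x \<xi>"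
      proof (rule AE_I2)
        fix \<xi>
        have sn: "summable (\<lambda>j. norm (piece (- 2 * pi) s R c j (x, A x *v \<xi>)))"
          by (rule summable_comparison_test'[OF N(1), of 0]) (use N(2) in simp)
        have "(\<lambda>j. r j \<xi>) sums (a0 x (A x *v \<xi>) * fourier f \<xi> * osc (2 * pi) x \<xi>)"
          unfolding r_def a0_def by (intro sums_mult2 summable_sums summable_norm_cancel[OF sn])
        moreover have "summable (\<lambda>j. norm (r j \<xi>))"
          unfolding r_def norm_mult by (intro summable_mult2 sn)
        ultimately show "summable (\<lambda>j. norm (r j \<xi>)) \<and> (\<Sum>j. r j \<xi>) = a0 x (Mmap A x \<xi>) * fourier f \<xi> * osc (2 * pi) x \<xi>"
          by (simp add: sums_iff Mmap_eq)
      qed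
      show "(\<lambda>\<xi>. a0 x (Mmap A x \<xi>) * fourier f \<xi> * osc (2 * pi) x \<xi>) \<in> borel_measurable lborel"
        unfolding Mmap_eq a0_def by measurable
      show "(LINT y|lborel. t j y) = (LINT \<xi>|lborel. r j \<xi>)" for j
      proof -
        have hf: "(LINT u|lborel. h j u * osc (- 2 * pi) v u) = inverse (J x) *\<^sub>R piece (- 2 * pi) s R c j (x, v)" for v
          using fourier_atom[where R=R and m=m and j=j and x=x and \<tau>="- 2 * pi" and u=v, OF K c Rp] by (simp add: h_def s_def)
        have "(LINT y|lborel. t j y) = (LINT \<xi>|lborel. of_real \<bar>det (A x)\<bar> * (LINT u|lborel. h j u * osc (- 2 * pi) (A x *v \<xi>) u) * fourier f \<xi> * osc (2 * pi) x \<xi>)"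
          unfolding t_def Theta0_eq
          by (rule integral_backward_piece[OF det hi Fint schwartz_fourier_inversion[OF f, symmetric]])
        also have "\<dots> = (LINT \<xi>|lborel. r j \<xi>)"
          unfolding hf r_def using Jp[of x] by (simp add: J_def[symmetric] scaleR_conv_of_real mult.assoc[symmetric])
        finally show ?thesis .
      qed
    qed
    then show ?thesis by (simp add: osc_def)
  qed
  ultimately show ?thesis by blast
qed

theorem theorem6p1:
  fixes A :: "(real, 'n::{finite,linorder}) vec \<Rightarrow> ((real, 'n) vec, 'n) vec"
    and n :: real
    and T :: "((real, 'n) vec \<Rightarrow> complex) \<Rightarrow> ((real, 'n) vec \<Rightarrow> complex)"
  assumes "CARD('n) \<ge> 2"
    and "admissible_frame A"
    and "- real (Qdim TYPE('n)) < n" and "n < 0"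
  shows "T \<in> PsiD A n \<longleftrightarrow>
    (\<exists>k0 :: (real, 'n) vec \<Rightarrow> (real, 'n) vec \<Rightarrow> complex.
       smooth_on (UNIV \<times> (UNIV - {0})) (\<lambda>(x, u). k0 x u) \<and>
       (\<forall>I \<gamma> :: 'n \<Rightarrow> nat. \<forall>M::real. M \<ge> 0 \<longrightarrow> (\<exists>C. \<forall>x u. u \<noteq> 0 \<longrightarrow>
          norm (mderiv I (\<lambda>x'. mderiv \<gamma> (k0 x') u) x)
            \<le> C * hnorm u powr (- real (Qdim TYPE('n)) - n - real (hord \<gamma>) - M))) \<and>
       (\<forall>f. schwartz f \<longrightarrow> (\<forall>x. T f x = (LINT y|lborel. k0 x (Theta0 A x y) * f y))))"
    (is "_ \<longleftrightarrow> (\<exists>k0. ?P k0)")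
proof
  assume "T \<in> PsiD A n"
  then obtain a0 where a0: "symbol_class n a0"
    and T: "\<And>f x. schwartz f \<Longrightarrow> T f x = (LINT \<xi>|lborel. a0 x (Mmap A x \<xi>) * fourier f \<xi> * cis (2 * pi * (x \<bullet> \<xi>)))"
    unfolding PsiD_def by blast
  from symbol_kernel[OF assms(2-4) a0] show "\<exists>k0. ?P k0"
    by (elim ex_forward) (use T in simp)
next
  assume "\<exists>k0. ?P k0"
  then obtain k0 where k0: "?P k0" by blast
  obtain a0 where "symbol_class n a0"
    "\<forall>f. schwartz f \<longrightarrow> (\<forall>x. (LINT y|lborel. k0 x (Theta0 A x y) * f y)
      = (LINT \<xi>|lborel. a0 x (Mmap A x \<xi>) * fourier f \<xi> * cis (2 * pi * (x \<bullet> \<xi>))))"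
    using kernel_symbol[OF assms(2-4), of k0] k0 by blast
  then show "T \<in> PsiD A n" using k0 unfolding PsiD_def by (intro CollectI exI[of _ a0]) simp
qed

end
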